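(* There is a universal constant $c_0\in(0,1)$ with the following property. Let the fixed data $N,p,\gamma,\Lambda,\delta,R,a_1,\dots,a_N,\bar Y_1,\dots,\bar Y_N$ be as in the context and suppose $R\le c_0\delta$. Then there exist $\varepsilon_0\in(0,1]$, a time $T>0$ and a constant $C>0$, all depending only on the fixed data (in particular $T$ and $C$ do not depend on $\varepsilon$ or on the solution), such that the solution $(Y_1,\dots,Y_N)$ of the point vortex system exists on $[0,T]$ and, for every $\varepsilon\in(0,\varepsilon_0]$, every $\varepsilon$-admissible solution $(\omega,\omega_1,\dots,\omega_N)$ and every $i\in\{1,\dots,N\}$, $$W_2\left(\frac{\omega_i(t)}{a_i},\delta_{Y_i(t)}\right)\le C e^{Ct}\varepsilon\qquad\text{for all } t\in[0,T].$$
   Context: Fixed data (independent of $\varepsilon$): $N\in\mathbb{N}$, $p\in(2,\infty)$, $\gamma>0$, $\Lambda>0$, $0<R<\delta$, nonzero real numbers $a_1,\dots,a_N$ (intensities), and distinct points $\bar Y_1,\dots,\bar Y_N\in\mathbb{R}^2$. Biot--Savart kernel: $K(z)=\frac{1}{2\pi}\frac{z^\perp}{|z|^2}$ with $z^\perp=(-z_2,z_1)$. Wasserstein distance to an atom: if $f$ is integrable of one sign, $a=\int f\,dx\neq0$ and $Y\in\mathbb{R}^2$, then $W_2\left(\frac{f}{a},\delta_Y\right)=\sqrt{\frac1a\int_{\mathbb{R}^2}|x-Y|^2f(x)\,dx}$ (here $\delta_Y$ is the Dirac measure, not to be confused with the number $\delta$). $\varepsilon$-admissible solution. For $\varepsilon\in(0,1]$,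 an $\varepsilon$-admissible solution $(\omega,\omega_1,\dots,\omega_N)$ consists of the following. (i) Initial data $\bar\omega=\sum_{i=1}^N\bar\omega_i$ with each $\bar\omega_i\in L^p(\mathbb{R}^2)$ compactly supported, either $\bar\omega_i\ge0$ or $\bar\omega_i\le0$, $\int\bar\omega_i\,dx=a_i$, and $\min_{i\ne j}\operatorname{dist}(\operatorname{spt}\bar\omega_i,\operatorname{spt}\bar\omega_j)\ge\delta$. (ii) $W_2\left(\bar\omega_i/a_i,\delta_{\bar Y_i}\right)\le\varepsilon$ for all $i$. (iii) $\|\bar\omega\|_{L^p}\le\Lambda\varepsilon^{-\gamma}$. (iv) $\operatorname{spt}\bar\omega_i\subset B_R(\bar X_i)$ for all $i$, where $\bar X_i=\frac1{a_i}\int x\,\bar\omega_i(x)\,dx$ and $B_R$ denotes the open ball. (v) $\omega\in C^0([0,\infty);L^p(\mathbb{R}^2))$ is a distributional solution of the Euler vorticity equation $\partial_t\omega+u\cdot\nabla\omega=0$, $\omega(0,\cdot)=\bar\omega$, where $u(t,\cdot)=K*\omega(t,\cdot)$ (so $\nabla\cdot u=0$), and $\omega_i\in C^0([0,\infty);L^p(\mathbb{R}^2))$ is the solution of the linear transport equation $\partial_t\omega_i+u\cdot\nabla\omega_i=0$, $\omega_i(0,\cdot)=\bar\omega_i$. These solutions are understood to be renormalized (DiPerna--Lions) and Lagrangian, i.e. transported by the flow of $u$; in particular they are compactly supported at each time, $\omega=\sum_i\omega_i$, the sign of $\omega_i$ is preserved, $\int\omega_i(t,x)\,dx=a_i$,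 and $\|\omega_i(t)\|_{L^p}=\|\bar\omega_i\|_{L^p}$. Point vortex system: $(Y_1,\dots,Y_N)$ is the solution of $\frac{d}{dt}Y_i(t)=\sum_{j\ne i}a_jK(Y_i(t)-Y_j(t))$, $Y_i(0)=\bar Y_i$, $i=1,\dots,N$. *)

theory Defs
  imports "HOL-Probability.Probability"
begin

section \<open>Wasserstein distance\<close>

definition ennsqrt :: "ennreal \<Rightarrow> ennreal" where
  "ennsqrt x = (if x = \<top> then \<top> else ennreal (sqrt (enn2real x)))"

definition couplings :: "'a::topological_space measure \<Rightarrow> 'a measure \<Rightarrow> ('a \<times> 'a) measure set" where
  "couplings \<mu> \<nu> = {\<pi>. sets \<pi> = sets (borel \<Otimes>\<^sub>M borel) \<and>
     distr \<pi> borel fst = \<mu> \<and> distr \<pi> borel snd = \<nu>}"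

text \<open>The quadratic Wasserstein distance, with value \<open>\<top>\<close> if every coupling has infinite cost.\<close>

definition W2 :: "'a::metric_space measure \<Rightarrow> 'a measure \<Rightarrow> ennreal" where
  "W2 \<mu> \<nu> = (INF \<pi>\<in>couplings \<mu> \<nu>. ennsqrt (\<integral>\<^sup>+z. ennreal ((dist (fst z) (snd z))\<^sup>2) \<partial>\<pi>))"

lemma W2_return:
  fixes \<mu> :: "'a::{second_countable_topology, metric_space} measure"
  assumes "prob_space \<mu>" and sets: "sets \<mu> = sets borel"
  shows "W2 \<mu> (return borel Y) = ennsqrt (\<integral>\<^sup>+x. ennreal ((dist x Y)\<^sup>2) \<partial>\<mu>)"
proof -
  let ?c = "\<integral>\<^sup>+x. ennreal ((dist x Y)\<^sup>2) \<partial>\<mu>"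
  interpret prob_space \<mu> by fact
  have cost: "(\<integral>\<^sup>+z. ennreal ((dist (fst z) (snd z))\<^sup>2) \<partial>\<pi>) = ?c"
    if "\<pi> \<in> couplings \<mu> (return borel Y)" for \<pi>
  proof -
    have s [measurable_cong]: "sets \<pi> = sets (borel \<Otimes>\<^sub>M borel)"
      and 1: "distr \<pi> borel fst = \<mu>" and 2: "distr \<pi> borel snd = return borel Y"
      using that by (auto simp: couplings_def)
    have "AE y in distr \<pi> borel snd. y = Y"
      unfolding 2 by (subst AE_return) auto
    then have "AE z in \<pi>. snd z = Y"
      by (subst (asm) AE_distr_iff) auto
    then have "(\<integral>\<^sup>+z. ennreal ((dist (fst z) (snd z))\<^sup>2) \<partial>\<pi>)
        = (\<integral>\<^sup>+z. ennreal ((dist (fst z) Y)\<^sup>2) \<partial>\<pi>)"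
      by (intro nn_integral_cong_AE) auto
    also have "\<dots> = (\<integral>\<^sup>+x. ennreal ((dist x Y)\<^sup>2) \<partial>distr \<pi> borel fst)"
      by (subst nn_integral_distr) auto
    finally show ?thesis by (simp add: 1)
  qed
  let ?p = "distr \<mu> (borel \<Otimes>\<^sub>M borel) (\<lambda>x. (x, Y))"
  have m [measurable]: "(\<lambda>x. (x, Y)) \<in> \<mu> \<rightarrow>\<^sub>M borel \<Otimes>\<^sub>M borel" "(\<lambda>x. x) \<in> \<mu> \<rightarrow>\<^sub>M borel"
    by (auto simp: measurable_cong_sets[OF sets refl])
  have "distr ?p borel fst = \<mu>"
    by (subst distr_distr) (auto simp: o_def sets intro: distr_id2)
  moreover have "distr ?p borel snd = return borel Y"
    by (subst distr_distr) (auto simp: o_def)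
  ultimately have ne: "couplings \<mu> (return borel Y) \<noteq> {}"
    by (auto simp: couplings_def intro!: exI[of _ ?p])
  show ?thesis
    unfolding W2_def using ne by (simp add: cost cong: INF_cong)
qed

text \<open>The probability measure \<open>(f / a) dx\<close> for \<open>f\<close> of one sign with \<open>\<integral>f = a \<noteq> 0\<close>.\<close>

definition normalized_measure :: "real \<Rightarrow> (real^2 \<Rightarrow> real) \<Rightarrow> (real^2) measure" where
  "normalized_measure a f = density lborel (\<lambda>x. ennreal (f x / a))"

lemma W2_normalized_measure:
  assumes "a \<noteq> 0" "integrable lborel f" "(LINT x|lborel. f x) = a"
    and sgn: "(AE x in lborel. f x \<ge> 0) \<or> (AE x in lborel. f x \<le> 0)"
    and int: "integrable lborel (\<lambda>x. (norm (x - Y))\<^sup>2 * f x)"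
  shows "W2 (normalized_measure a f) (return borel Y)
    = ennreal (sqrt (1 / a * (LINT x|lborel. (norm (x - Y))\<^sup>2 * f x)))"
proof -
  have [measurable]: "f \<in> borel_measurable lborel" using assms(2) by auto
  have nn: "AE x in lborel. f x / a \<ge> 0"
    using sgn
  proof
    assume *: "AE x in lborel. f x \<ge> 0"
    then have "a \<ge> 0" using integral_nonneg_AE[where M=lborel and f=f] assms(3) by simp
    then show ?thesis using * by (auto simp: divide_nonneg_nonneg)
  next
    assume *: "AE x in lborel. f x \<le> 0"
    then have "a \<le> 0" using integral_nonneg_AE[where M=lborel and f="\<lambda>x. - f x"] assms(2,3) by simp
    then show ?thesis using * by (auto simp: divide_nonpos_nonpos)
  qed
  let ?M = "normalized_measure a f"
  have "emeasure ?M (space ?M) = (\<integral>\<^sup>+x. ennreal (f x / a) \<partial>lborel)"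
    by (simp add: normalized_measure_def emeasure_density)
  also have "\<dots> = ennreal (LINT x|lborel. f x / a)"
    using nn assms(2) by (intro nn_integral_eq_integral) auto
  also have "\<dots> = 1" using assms by simp
  finally have "prob_space ?M" by (rule prob_spaceI)
  then have "W2 ?M (return borel Y) = ennsqrt (\<integral>\<^sup>+x. ennreal ((dist x Y)\<^sup>2) \<partial>?M)"
    by (rule W2_return) (simp add: normalized_measure_def)
  also have "(\<integral>\<^sup>+x. ennreal ((dist x Y)\<^sup>2) \<partial>?M)
      = (\<integral>\<^sup>+x. ennreal (f x / a) * ennreal ((dist x Y)\<^sup>2) \<partial>lborel)"
    unfolding normalized_measure_def by (subst nn_integral_density) auto
  also have "\<dots> = (\<integral>\<^sup>+x. ennreal (1 / a * ((norm (x - Y))\<^sup>2 * f x)) \<partial>lborel)"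
    using nn by (intro nn_integral_cong_AE)
      (auto simp: ennreal_mult[symmetric] dist_norm mult.commute)
  also have "\<dots> = ennreal (LINT x|lborel. 1 / a * ((norm (x - Y))\<^sup>2 * f x))"
  proof (intro nn_integral_eq_integral)
    show "integrable lborel (\<lambda>x. 1 / a * ((norm (x - Y))\<^sup>2 * f x))"
      using int by simp
    show "AE x in lborel. 0 \<le> 1 / a * ((norm (x - Y))\<^sup>2 * f x)"
      using nn
    proof eventually_elim
      case (elim x)
      have "0 \<le> (norm (x - Y))\<^sup>2 * (f x / a)" using elim by (intro mult_nonneg_nonneg) auto
      then show ?case by (simp add: mult.commute)
    qed
  qed
  also have "(LINT x|lborel. 1 / a * ((norm (x - Y))\<^sup>2 * f x))
      = 1 / a * (LINT x|lborel. (norm (x - Y))\<^sup>2 * f x)"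
    by (rule integral_mult_right_zero)
  finally have W: "W2 ?M (return borel Y)
      = ennsqrt (ennreal (1 / a * (LINT x|lborel. (norm (x - Y))\<^sup>2 * f x)))" .
  have "0 \<le> (LINT x|lborel. (norm (x - Y))\<^sup>2 * (f x / a))"
    using nn by (intro integral_nonneg_AE) (auto elim!: eventually_mono intro: mult_nonneg_nonneg simp del: times_divide_eq_right)
  also have "\<dots> = 1 / a * (LINT x|lborel. (norm (x - Y))\<^sup>2 * f x)"
    by simp
  finally show ?thesis
    unfolding W by (simp add: ennsqrt_def)
qed


section \<open>Lebesgue spaces on the plane\<close>

definition Lp :: "real \<Rightarrow> (real^2 \<Rightarrow> real) \<Rightarrow> bool" where
  "Lp p f \<longleftrightarrow> f \<in> borel_measurable lborel \<and> integrable lborel (\<lambda>x. \<bar>f x\<bar> powr p)"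

definition Lp_norm :: "real \<Rightarrow> (real^2 \<Rightarrow> real) \<Rightarrow> real" where
  "Lp_norm p f = (LINT x|lborel. \<bar>f x\<bar> powr p) powr (1 / p)"

text \<open>\<open>w \<in> C\<^sup>0([0,\<infinity>); L\<^sup>p)\<close>; functions in \<open>L\<^sup>p\<close> are handled through Borel representatives.\<close>

definition continuous_Lp :: "real \<Rightarrow> (real \<Rightarrow> real^2 \<Rightarrow> real) \<Rightarrow> bool" where
  "continuous_Lp p w \<longleftrightarrow> (\<forall>t\<ge>0. Lp p (w t) \<and>
     ((\<lambda>s. Lp_norm p (\<lambda>x. w s x - w t x)) \<longlongrightarrow> 0) (at t within {0..}))"

text \<open>The support of an equivalence class modulo null sets: the complement of the
  largest open set on which the function vanishes almost everywhere.\<close>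

definition spt :: "(real^2 \<Rightarrow> real) \<Rightarrow> (real^2) set" where
  "spt f = {x. \<forall>r>0. \<not> (AE y in lborel. y \<in> ball x r \<longrightarrow> f y = 0)}"


section \<open>Biot-Savart law and point vortices\<close>

definition perp :: "real^2 \<Rightarrow> real^2" where
  "perp z = vector [- z $ 2, z $ 1]"

definition K :: "real^2 \<Rightarrow> real^2" where
  "K z = (1 / (2 * pi)) *\<^sub>R ((1 / (norm z)\<^sup>2) *\<^sub>R perp z)"

definition biot_savart :: "(real^2 \<Rightarrow> real) \<Rightarrow> real^2 \<Rightarrow> real^2" where
  "biot_savart w x = (LINT y|lborel. w y *\<^sub>R K (x - y))"

text \<open>Collisions have to be excluded explicitly, because \<open>K 0 = 0\<close> in HOL.\<close>

definition point_vortex_solution ::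
  "nat \<Rightarrow> (nat \<Rightarrow> real) \<Rightarrow> (nat \<Rightarrow> real^2) \<Rightarrow> real \<Rightarrow> (nat \<Rightarrow> real \<Rightarrow> real^2) \<Rightarrow> bool" where
  "point_vortex_solution N a Ybar T Y \<longleftrightarrow>
     (\<forall>i\<in>{1..N}. Y i 0 = Ybar i) \<and>
     (\<forall>t\<in>{0..T}. \<forall>i\<in>{1..N}. \<forall>j\<in>{1..N}. i \<noteq> j \<longrightarrow> Y i t \<noteq> Y j t) \<and>
     (\<forall>t\<in>{0..T}. \<forall>i\<in>{1..N}.
        (Y i has_vector_derivative (\<Sum>j\<in>{1..N} - {i}. a j *\<^sub>R K (Y i t - Y j t)))
          (at t within {0..T}))"


section \<open>Transport equation\<close>

primrec differentiable_upto :: "nat \<Rightarrow> ('a::euclidean_space \<Rightarrow> real) \<Rightarrow> bool" where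
  "differentiable_upto 0 f \<longleftrightarrow> continuous_on UNIV f"
| "differentiable_upto (Suc k) f \<longleftrightarrow> (\<forall>z. f differentiable at z) \<and>
     (\<forall>v. differentiable_upto k (\<lambda>z. frechet_derivative f (at z) v))"

definition test_function :: "('a::euclidean_space \<Rightarrow> real) \<Rightarrow> bool" where
  "test_function \<phi> \<longleftrightarrow> (\<forall>k. differentiable_upto k \<phi>) \<and> compact (closure {z. \<phi> z \<noteq> 0})"

text \<open>Distributional solutions of \<open>\<partial>\<^sub>t w + u \<cdot> \<nabla>w = 0\<close>, \<open>w(0,\<cdot>) = w0\<close> on \<open>[0,\<infinity>)\<close> for a divergence-free
  field \<open>u\<close>. The derivative of \<open>\<phi>\<close> at \<open>(t, x)\<close> in direction \<open>(1, u t x)\<close> is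
  \<open>\<partial>\<^sub>t\<phi> + u \<cdot> \<nabla>\<phi>\<close>. Test functions live on the full space-time and need not vanish at
  \<open>t = 0\<close>, which encodes the initial condition.\<close>

definition transport_solution ::
  "(real \<Rightarrow> real^2 \<Rightarrow> real^2) \<Rightarrow> (real^2 \<Rightarrow> real) \<Rightarrow> (real \<Rightarrow> real^2 \<Rightarrow> real) \<Rightarrow> bool" where
  "transport_solution u w0 w \<longleftrightarrow> (\<forall>\<phi> :: real \<times> (real^2) \<Rightarrow> real. test_function \<phi> \<longrightarrow>
     (LINT t:{0..}|lborel.
        (LINT x|lborel. w t x * frechet_derivative \<phi> (at (t, x)) (1, u t x)))
     + (LINT x|lborel. w0 x * \<phi> (0, x)) = 0)"

text \<open>Renormalized solutions in the sense of DiPerna and Lions.\<close>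

definition renormalized_solution ::
  "(real \<Rightarrow> real^2 \<Rightarrow> real^2) \<Rightarrow> (real^2 \<Rightarrow> real) \<Rightarrow> (real \<Rightarrow> real^2 \<Rightarrow> real) \<Rightarrow> bool" where
  "renormalized_solution u w0 w \<longleftrightarrow> (\<forall>\<beta> :: real \<Rightarrow> real.
     \<beta> C1_differentiable_on UNIV \<and> bounded (range \<beta>) \<and> bounded (range (deriv \<beta>)) \<longrightarrow>
     transport_solution u (\<lambda>x. \<beta> (w0 x)) (\<lambda>t x. \<beta> (w t x)))"

text \<open>The (regular Lagrangian) flow of a divergence-free field: almost every trajectory is an
  absolutely continuous integral curve, and each flow map preserves Lebesgue measure.\<close>

definition lagrangian_flow ::
  "(real \<Rightarrow> real^2 \<Rightarrow> real^2) \<Rightarrow> (real \<Rightarrow> real^2 \<Rightarrow> real^2) \<Rightarrow> bool" where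
  "lagrangian_flow u X \<longleftrightarrow>
     (\<forall>t\<ge>0. X t \<in> borel_measurable lborel \<and> distr lborel lborel (X t) = lborel) \<and>
     (AE x in lborel. \<forall>t\<ge>0. (\<lambda>s. u s (X s x)) absolutely_integrable_on {0..t} \<and>
        X t x = x + integral {0..t} (\<lambda>s. u s (X s x)))"

definition transported_by ::
  "(real \<Rightarrow> real^2 \<Rightarrow> real^2) \<Rightarrow> (real^2 \<Rightarrow> real) \<Rightarrow> (real \<Rightarrow> real^2 \<Rightarrow> real) \<Rightarrow> bool" where
  "transported_by X w0 w \<longleftrightarrow> (\<forall>t\<ge>0. AE x in lborel. w t (X t x) = w0 x)"


section \<open>Admissible solutions\<close>

definition center :: "real \<Rightarrow> (real^2 \<Rightarrow> real) \<Rightarrow> real^2" where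
  "center a f = (1 / a) *\<^sub>R (LINT x|lborel. f x *\<^sub>R x)"

definition admissible_data ::
  "nat \<Rightarrow> real \<Rightarrow> real \<Rightarrow> real \<Rightarrow> real \<Rightarrow> real \<Rightarrow> (nat \<Rightarrow> real) \<Rightarrow> (nat \<Rightarrow> real^2) \<Rightarrow> real
   \<Rightarrow> (real^2 \<Rightarrow> real) \<Rightarrow> (nat \<Rightarrow> real^2 \<Rightarrow> real) \<Rightarrow> bool" where
  "admissible_data N p \<gamma> \<Lambda> \<delta> R a Ybar \<epsilon> wbar wibar \<longleftrightarrow>
     (\<forall>x. wbar x = (\<Sum>i\<in>{1..N}. wibar i x)) \<and>
     (\<forall>i\<in>{1..N}.
        Lp p (wibar i) \<and> compact (spt (wibar i)) \<and>
        ((AE x in lborel. wibar i x \<ge> 0) \<or> (AE x in lborel. wibar i x \<le> 0)) \<and>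
        (LINT x|lborel. wibar i x) = a i) \<and>
     (\<forall>i\<in>{1..N}. \<forall>j\<in>{1..N}. i \<noteq> j \<longrightarrow> setdist (spt (wibar i)) (spt (wibar j)) \<ge> \<delta>) \<and>
     (\<forall>i\<in>{1..N}.
        W2 (normalized_measure (a i) (wibar i)) (return borel (Ybar i)) \<le> ennreal \<epsilon>) \<and>
     Lp_norm p wbar \<le> \<Lambda> * \<epsilon> powr (- \<gamma>) \<and>
     (\<forall>i\<in>{1..N}. spt (wibar i) \<subseteq> ball (center (a i) (wibar i)) R)"

text \<open>Compact support, \<open>w = \<Sum>i wi\<close>, and the conservation of sign, integral and \<open>L\<^sup>p\<close> norm are not
  listed: they follow from transport by the common measure-preserving flow \<open>X\<close>.\<close>

definition admissible_solution ::
  "nat \<Rightarrow> real \<Rightarrow> real \<Rightarrow> real \<Rightarrow> real \<Rightarrow> real \<Rightarrow> (nat \<Rightarrow> real) \<Rightarrow> (nat \<Rightarrow> real^2) \<Rightarrow> real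
   \<Rightarrow> (real \<Rightarrow> real^2 \<Rightarrow> real) \<Rightarrow> (nat \<Rightarrow> real \<Rightarrow> real^2 \<Rightarrow> real) \<Rightarrow> bool" where
  "admissible_solution N p \<gamma> \<Lambda> \<delta> R a Ybar \<epsilon> w wi \<longleftrightarrow> (\<exists>wbar wibar.
     admissible_data N p \<gamma> \<Lambda> \<delta> R a Ybar \<epsilon> wbar wibar \<and>
     (let u = (\<lambda>t. biot_savart (w t)) in
        continuous_Lp p w \<and> (AE x in lborel. w 0 x = wbar x) \<and>
        transport_solution u wbar w \<and> renormalized_solution u wbar w \<and>
        (\<forall>i\<in>{1..N}.
           continuous_Lp p (wi i) \<and> (AE x in lborel. wi i 0 x = wibar i x) \<and>
           transport_solution u (wibar i) (wi i) \<and> renormalized_solution u (wibar i) (wi i)) \<and>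
        (\<exists>X. lagrangian_flow u X \<and> transported_by X wbar w \<and>
           (\<forall>i\<in>{1..N}. transported_by X (wibar i) (wi i)))))"

end

theory Submission
  imports Defs
begin

text \<open>
  Everything is read in Lagrangian terms. By transport, \<open>\<omega>\<^sub>i(t)/a\<^sub>i\<close> is the law of \<open>X\<^sub>t\<close> under the
  probability measure \<open>\<mu>\<^sub>i\<close> with density \<open>\<omega>\<^sub>i(0)/a\<^sub>i\<close>, and the velocity is the one these laws
  induce, so the solution is a family of interacting clouds of particles. The squared Wasserstein
  distance to the vortex \<open>Y\<^sub>i\<close> is the second moment \<open>E\<^sub>i\<close> of the \<open>i\<close>-th cloud about \<open>Y\<^sub>i\<close>.

  In the derivative of \<open>E\<^sub>i\<close> the singular self-interaction cancels by Newton's third law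
  (\<open>self_interaction\<close>). The interaction with another cloud compares \<open>K(x - y)\<close> with
  \<open>K(Y\<^sub>i - Y\<^sub>j)\<close>. For particles within a fixed radius \<open>b\<close> of their vortices this is a Lipschitz error, which
  Gronwall's inequality absorbs. A particle further away may come close to another cloud, where the
  kernel is singular. There the \<open>L\<^sup>p\<close> bound, with \<open>p > 2\<close>, controls the velocity by a negative power
  of \<open>\<epsilon>\<close> (\<open>transported_density_diffuse\<close>), so such particles are harmless once their mass, the tail,
  is smaller than a high power of \<open>\<epsilon>\<close> (\<open>energy_growth\<close>).

  Chebyshev's inequality only bounds the tails by \<open>\<epsilon>\<^sup>2\<close>. They are controlled by the mean \<open>\<Phi>\<^sub>i\<close> of a
  weight growing from \<open>exp(-\<beta>)\<close> at \<open>Y\<^sub>i\<close> to \<open>1\<close> at distance \<open>b\<close>, with \<open>\<beta>\<close> a large multiple of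
  \<open>ln(1/\<epsilon>)\<close>. After symmetrization the self-interaction contributes at most
  \<open>C \<beta>\<^sup>2 \<surd>E\<^sub>i \<Phi>\<^sub>i\<close> to the derivative of \<open>\<Phi>\<^sub>i\<close>, and the other clouds at most \<open>C \<beta> \<Phi>\<^sub>i\<close>
  (\<open>outer_growth\<close>). Since \<open>\<beta>\<epsilon>\<close> is bounded, \<open>\<Phi>\<^sub>i\<close> grows at most like \<open>exp(C\<beta>t)\<close>. The clouds start well
  inside the discs of radius \<open>b\<close>, because \<open>R\<close> is small compared with \<open>\<delta>\<close>, so \<open>\<Phi>\<^sub>i\<close> starts below
  \<open>exp(-\<beta>/2)\<close>. Therefore it stays below \<open>exp(-\<beta>/4)\<close>, a high power of \<open>\<epsilon>\<close>, up to a time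
  that does not depend on \<open>\<epsilon>\<close>. The two estimates presuppose each other, and a continuation argument closes the
  circle (\<open>concentration\<close>).

  Derivatives of such means are classical because almost every trajectory is \<open>C\<^sup>1\<close>
  (\<open>velocity_continuous\<close>). Point vortices exist, and stay near their initial positions, on a short
  time interval by Banach's fixed point theorem (\<open>point_vortices_short_time\<close>).
\<close>

section \<open>The Biot--Savart kernel\<close>

lemma perp_nth [simp]: "perp z $ 1 = - z $ 2" "perp z $ 2 = z $ 1"
  by (simp_all add: perp_def)

lemma inner_real2: "x \<bullet> y = x $ 1 * y $ 1 + x $ 2 * y $ (2 :: 2)" for x y :: "real^2"
  by (simp add: inner_vec_def sum_2)

lemma linear_perp: "linear perp"
  by (rule linearI) (simp_all add: vec_eq_iff forall_2)

lemma perp_diff: "perp (x - y) = perp x - perp y"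
  using linear_perp by (rule linear_diff)

lemma perp_minus: "perp (- x) = - perp x"
  using linear_perp by (rule linear_neg)

lemma inner_perp_perp: "perp x \<bullet> perp y = x \<bullet> y"
  by (simp add: inner_real2 mult.commute)

lemma norm_perp [simp]: "norm (perp z) = norm z"
  by (simp add: norm_eq_sqrt_inner inner_perp_perp)

lemma inner_perp_self [simp]: "z \<bullet> perp z = 0"
  by (simp add: inner_real2 mult.commute)

lemma continuous_on_perp [continuous_intros]:
  "continuous_on S f \<Longrightarrow> continuous_on S (\<lambda>x. perp (f x))"
  by (rule bounded_linear.continuous_on[OF linear_perp[unfolded linear_conv_bounded_linear]])

lemma measurable_perp [measurable]: "perp \<in> borel_measurable borel"
  by (intro borel_measurable_continuous_onI continuous_intros)

lemma measurable_K [measurable]: "K \<in> borel_measurable borel"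
  unfolding K_def by measurable

lemma norm_K: "norm (K z) = 1 / (2 * pi * norm z)"
  by (simp add: K_def power2_eq_square)

lemma norm_K_le: "norm (K z) \<le> 1 / norm z"
proof -
  have "1 / (2 * pi) * (1 / norm z) \<le> 1 * (1 / norm z)"
    using pi_gt3 by (intro mult_right_mono) auto
  then show ?thesis by (simp add: norm_K)
qed

lemma norm_K_le_inverse:
  assumes "b > 0" "b \<le> norm z" shows "norm (K z) \<le> 1 / b"
proof -
  have "1 / norm z \<le> 1 / b" using assms by (intro divide_left_mono mult_pos_pos) auto
  then show ?thesis using norm_K_le[of z] by linarith
qed

lemma norm_diff_detour: "norm (p - q) \<le> norm (x - p) + norm (x - y) + norm (y - q)"
  for p q x y :: "'a::real_normed_vector"
  using norm_triangle_ineq4[of "(x - y) + (y - q)" "x - p"] norm_triangle_ineq[of "x - y" "y - q"] by simp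

definition near_inverse :: "real \<Rightarrow> real^2 \<Rightarrow> real" where
  "near_inverse \<eta> z = indicator (ball 0 \<eta>) z * (1 / norm z)"

lemma measurable_near_inverse [measurable]: "near_inverse \<eta> \<in> borel_measurable borel"
proof -
  have [measurable]: "ball (0 :: real^2) \<eta> \<in> sets borel" by simp
  show ?thesis unfolding near_inverse_def[abs_def] by measurable
qed

lemma K_minus: "K (- z) = - K z"
  by (simp add: K_def perp_minus)

lemma inner_K_self [simp]: "z \<bullet> K z = 0"
  by (simp add: K_def)

text \<open>The force between two points is orthogonal to the line joining them, so that its
  radial components seen from the two points agree.\<close>

lemma inner_K_diff: "x \<bullet> K (x - y) = y \<bullet> K (x - y)"
  using inner_K_self[of "x - y"] unfolding inner_diff_left by simp

text \<open>Freezing the kernel inside the disc of radius \<open>\<eta>\<close> to the rotation field with the same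
  boundary values gives a globally Lipschitz approximation.\<close>

definition K_reg :: "real \<Rightarrow> real^2 \<Rightarrow> real^2" where
  "K_reg \<eta> z = (1 / (2 * pi)) *\<^sub>R ((1 / (max (norm z) \<eta>)\<^sup>2) *\<^sub>R perp z)"

lemma K_reg_eq_K: "\<eta> \<le> norm z \<Longrightarrow> K_reg \<eta> z = K z"
  by (simp add: K_reg_def K_def max_def)

lemma norm_K_reg_le:
  assumes "\<eta> > 0"
  shows "norm (K_reg \<eta> z) \<le> 1 / (2 * pi * \<eta>)"
proof -
  have "norm z * \<eta> \<le> (max (norm z) \<eta>)\<^sup>2"
    unfolding power2_eq_square by (intro mult_mono) (use assms in auto)
  moreover have "(max (norm z) \<eta>)\<^sup>2 > 0" using assms by (simp add: max.strict_coboundedI2 zero_less_power)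
  ultimately have "norm z / (max (norm z) \<eta>)\<^sup>2 \<le> 1 / \<eta>"
    using assms by (simp add: divide_simps)
  then have "norm z / (max (norm z) \<eta>)\<^sup>2 / (2 * pi) \<le> 1 / \<eta> / (2 * pi)"
    by (intro divide_right_mono) auto
  then show ?thesis by (simp add: K_reg_def field_simps)
qed

lemma norm_K_diff_K_reg_le:
  assumes "\<eta> > 0"
  shows "norm (K z - K_reg \<eta> z) \<le> near_inverse \<eta> z"
proof (cases "norm z < \<eta> \<and> z \<noteq> 0")
  case True
  have "K z - K_reg \<eta> z = (1 / (2 * pi)) *\<^sub>R ((1 / (norm z)\<^sup>2 - 1 / \<eta>\<^sup>2) *\<^sub>R perp z)"
    using True by (simp add: K_def K_reg_def max_def scaleR_diff_left scaleR_diff_right)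
  moreover have "1 / \<eta>\<^sup>2 \<le> 1 / (norm z)\<^sup>2"
    using True assms by (intro divide_left_mono power_mono mult_pos_pos zero_less_power) auto
  ultimately have "norm (K z - K_reg \<eta> z) = (1 / (2 * pi)) * ((1 / (norm z)\<^sup>2 - 1 / \<eta>\<^sup>2) * norm z)"
    by (simp add: abs_mult)
  also have "\<dots> \<le> 1 * ((1 / (norm z)\<^sup>2) * norm z)"
    using True pi_gt3 \<open>1 / \<eta>\<^sup>2 \<le> 1 / (norm z)\<^sup>2\<close>
    by (intro mult_mono) (auto simp: divide_simps)
  finally show ?thesis using True by (simp add: near_inverse_def power2_eq_square)
next
  case False
  then show ?thesis by (auto simp: near_inverse_def K_reg_eq_K) (simp add: K_def K_reg_def perp_def vec_eq_iff forall_2)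
qed

text \<open>Inversion in the unit circle turns the distance \<open>|x - y|\<close> into \<open>|x - y| / (|x| |y|)\<close>, and up to a
  rotation by a right angle the kernel is this inversion. The proof checks that replacing \<open>|z|\<close> by \<open>max |z| \<eta>\<close>
  turns the identity into an inequality.\<close>

lemma norm_K_reg_diff_le:
  assumes h: "\<eta> > 0"
  shows "norm (K_reg \<eta> x - K_reg \<eta> y)
    \<le> norm (x - y) / (2 * pi * max (norm x) \<eta> * max (norm y) \<eta>)"
proof -
  define m where "m = max (norm x) \<eta>"
  define n where "n = max (norm y) \<eta>"
  have pos: "m > 0" "n > 0" using h by (auto simp: m_def n_def max_def)
  have main: "(norm x)\<^sup>2 * n ^ 4 + (norm y)\<^sup>2 * m ^ 4 \<le> ((norm x)\<^sup>2 + (norm y)\<^sup>2) * (m\<^sup>2 * n\<^sup>2)"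
  proof -
    have "((norm x)\<^sup>2 * n\<^sup>2 - (norm y)\<^sup>2 * m\<^sup>2) * (n\<^sup>2 - m\<^sup>2) \<le> 0"
    proof (cases "norm x \<ge> \<eta>"; cases "norm y \<ge> \<eta>")
      assume "norm x \<ge> \<eta>" "norm y \<ge> \<eta>" then show ?thesis by (simp add: m_def n_def max_def)
    next
      assume "norm x \<ge> \<eta>" "\<not> norm y \<ge> \<eta>"
      then have "m = norm x" "n = \<eta>" by (auto simp: m_def n_def)
      moreover have "(norm y)\<^sup>2 \<le> \<eta>\<^sup>2" "\<eta>\<^sup>2 \<le> (norm x)\<^sup>2"
        using \<open>norm x \<ge> \<eta>\<close> \<open>\<not> norm y \<ge> \<eta>\<close> h by (auto intro!: power_mono)
      ultimately show ?thesis
        by (intro mult_nonneg_nonpos) (use mult_right_mono[OF \<open>(norm y)\<^sup>2 \<le> \<eta>\<^sup>2\<close>, of "(norm x)\<^sup>2"] in \<open>auto simp: mult.commute\<close>)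
    next
      assume "\<not> norm x \<ge> \<eta>" "norm y \<ge> \<eta>"
      then have "n = norm y" "m = \<eta>" by (auto simp: m_def n_def)
      moreover have "(norm x)\<^sup>2 \<le> \<eta>\<^sup>2" "\<eta>\<^sup>2 \<le> (norm y)\<^sup>2"
        using \<open>\<not> norm x \<ge> \<eta>\<close> \<open>norm y \<ge> \<eta>\<close> h by (auto intro!: power_mono)
      ultimately show ?thesis
        by (intro mult_nonpos_nonneg) (auto simp: mult.commute mult_left_mono mult_right_mono)
    next
      assume "\<not> norm x \<ge> \<eta>" "\<not> norm y \<ge> \<eta>" then show ?thesis by (simp add: m_def n_def)
    qed
    moreover have "(norm x)\<^sup>2 * n ^ 4 + (norm y)\<^sup>2 * m ^ 4 - ((norm x)\<^sup>2 + (norm y)\<^sup>2) * (m\<^sup>2 * n\<^sup>2)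
       = ((norm x)\<^sup>2 * n\<^sup>2 - (norm y)\<^sup>2 * m\<^sup>2) * (n\<^sup>2 - m\<^sup>2)"
      by (simp add: algebra_simps power2_eq_square power4_eq_xxxx)
    ultimately show ?thesis by linarith
  qed
  have eq: "n\<^sup>2 *\<^sub>R perp x - m\<^sup>2 *\<^sub>R perp y = perp (n\<^sup>2 *\<^sub>R x - m\<^sup>2 *\<^sub>R y)"
    by (simp add: perp_diff linear_cmul[OF linear_perp])
  have "(norm (n\<^sup>2 *\<^sub>R x - m\<^sup>2 *\<^sub>R y))\<^sup>2 = (norm x)\<^sup>2 * n ^ 4 + (norm y)\<^sup>2 * m ^ 4 - 2 * (m\<^sup>2 * n\<^sup>2) * (x \<bullet> y)"
    unfolding power2_norm_eq_inner
    by (simp add: inner_diff_left inner_diff_right inner_commute algebra_simps power2_eq_square power4_eq_xxxx)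
  also have "\<dots> \<le> ((norm x)\<^sup>2 + (norm y)\<^sup>2) * (m\<^sup>2 * n\<^sup>2) - 2 * (m\<^sup>2 * n\<^sup>2) * (x \<bullet> y)"
    using main by linarith
  also have "\<dots> = (m * n * norm (x - y))\<^sup>2"
    unfolding power_mult_distrib power2_norm_eq_inner
    by (simp add: inner_diff_left inner_diff_right inner_commute algebra_simps)
  finally have "norm (n\<^sup>2 *\<^sub>R x - m\<^sup>2 *\<^sub>R y) \<le> m * n * norm (x - y)"
    by (rule power2_le_imp_le) (use pos in auto)
  then have le: "norm (n\<^sup>2 *\<^sub>R perp x - m\<^sup>2 *\<^sub>R perp y) \<le> m * n * norm (x - y)"
    by (simp add: eq)
  have "K_reg \<eta> x - K_reg \<eta> y = (1 / (2 * pi * m\<^sup>2 * n\<^sup>2)) *\<^sub>R (n\<^sup>2 *\<^sub>R perp x - m\<^sup>2 *\<^sub>R perp y)"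
    using pos by (simp add: K_reg_def m_def[symmetric] n_def[symmetric] scaleR_diff_right field_simps)
  then have "norm (K_reg \<eta> x - K_reg \<eta> y) = (1 / (2 * pi * m\<^sup>2 * n\<^sup>2)) * norm (n\<^sup>2 *\<^sub>R perp x - m\<^sup>2 *\<^sub>R perp y)"
    by simp
  also have "\<dots> \<le> (1 / (2 * pi * m\<^sup>2 * n\<^sup>2)) * (m * n * norm (x - y))"
    using le by (intro mult_left_mono) auto
  also have "\<dots> = norm (x - y) / (2 * pi * m * n)"
    using pos by (simp add: field_simps power2_eq_square)
  finally show ?thesis by (simp add: m_def n_def)
qed

lemma norm_K_diff_le:
  assumes "x \<noteq> 0" "y \<noteq> 0"
  shows "norm (K x - K y) \<le> norm (x - y) / (2 * pi * norm x * norm y)"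
proof -
  define h where "h = min (norm x) (norm y)"
  have "h > 0" "h \<le> norm x" "h \<le> norm y" using assms by (auto simp: h_def)
  then show ?thesis
    using norm_K_reg_diff_le[of h x y] by (simp add: K_reg_eq_K max_absorb1)
qed

lemma norm_K_reg_diff_le':
  assumes "\<eta> > 0"
  shows "norm (K_reg \<eta> x - K_reg \<eta> y) \<le> (1 / (2 * pi * \<eta>\<^sup>2)) * norm (x - y)"
proof -
  have "2 * pi * \<eta>\<^sup>2 \<le> 2 * pi * max (norm x) \<eta> * max (norm y) \<eta>"
    using assms by (simp add: power2_eq_square mult.assoc mult_mono)
  then have "norm (x - y) / (2 * pi * max (norm x) \<eta> * max (norm y) \<eta>) \<le> norm (x - y) / (2 * pi * \<eta>\<^sup>2)"
    using assms by (intro divide_left_mono mult_pos_pos) (auto simp: max_def)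
  then show ?thesis using norm_K_reg_diff_le[OF assms, of x y] by simp
qed

lemma continuous_on_K_reg:
  assumes "\<eta> > 0" "continuous_on S f"
  shows "continuous_on S (\<lambda>x. K_reg \<eta> (f x))"
  unfolding K_reg_def using assms
  by (intro continuous_intros) (auto dest: order.strict_trans2)

lemma measurable_K_reg [measurable]: "\<eta> > 0 \<Longrightarrow> K_reg \<eta> \<in> borel_measurable borel"
  unfolding K_reg_def by measurable

section \<open>Continuation and comparison arguments in one real variable\<close>

text \<open>The first time at which \<open>f\<close> reaches the level \<open>M\<close> contradicts the hypothesis \<open>step\<close>.\<close>

lemma continuity_bootstrap:
  fixes f :: "real \<Rightarrow> real"
  assumes cont: "continuous_on {0..T} f" and init: "f 0 < M"
    and step: "\<And>t. 0 \<le> t \<Longrightarrow> t \<le> T \<Longrightarrow> (\<And>s. 0 \<le> s \<Longrightarrow> s \<le> t \<Longrightarrow> f s \<le> M) \<Longrightarrow> f t < M"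
    and t: "0 \<le> t" "t \<le> T"
  shows "f t < M"
proof (rule ccontr)
  assume "\<not> f t < M"
  define S where "S = {s\<in>{0..t}. M \<le> f s}"
  have c: "continuous_on {0..t} f" using cont t by (auto intro: continuous_on_subset)
  have "closed S"
    unfolding S_def by (intro continuous_on_closed_Collect_le c continuous_intros) 
  moreover have "S \<noteq> {}" "bdd_below S" using t \<open>\<not> f t < M\<close> by (auto simp: S_def)
  ultimately have I: "Inf S \<in> S" by (intro closed_contains_Inf)
  define s where "s = Inf S"
  have s: "0 \<le> s" "s \<le> t" "M \<le> f s" using I by (auto simp: S_def s_def)
  have below: "f r < M" if "0 \<le> r" "r < s" for r
    using that cInf_lower[OF _ \<open>bdd_below S\<close>, of r] s unfolding s_def
    by (force simp: S_def)
  obtain r where r: "0 \<le> r" "r \<le> s" "f r = M"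
    using IVT'[of f 0 M s] init s continuous_on_subset[OF c, of "{0..s}"] by auto
  then have "r = s" using below[of r] by force
  then have "f s < M" using r below s t by (intro step) (auto simp: less_eq_real_def)
  then show False using s by simp
qed

lemma gronwall:
  fixes f :: "real \<Rightarrow> real"
  assumes der: "\<And>s. s \<in> {0..t} \<Longrightarrow> (f has_real_derivative f' s) (at s within {0..t})"
    and le: "\<And>s. s \<in> {0..t} \<Longrightarrow> f' s \<le> c * f s" and t: "0 \<le> t"
  shows "f t \<le> f 0 * exp (c * t)"
proof (cases "t = 0")
  case False
  define g where "g s = f s * exp (- c * s)" for s
  have g: "(g has_derivative (\<lambda>h. h * ((f' s - c * f s) * exp (- c * s)))) (at s within {0..t})"
    if "s \<in> {0..t}" for s
  proof -
    have "(g has_real_derivative (f' s * exp (- c * s) + (exp (- c * s) * (- c)) * f s)) (at s within {0..t})"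
      unfolding g_def
      by (rule DERIV_mult[OF der[OF that]]) (auto intro!: derivative_eq_intros)
    moreover have "f' s * exp (- c * s) + (exp (- c * s) * (- c)) * f s = (f' s - c * f s) * exp (- c * s)"
      by (simp add: algebra_simps)
    ultimately show ?thesis by (simp add: has_field_derivative_def mult_commute_abs)
  qed
  from mvt_simple[OF _ g] obtain s where "s \<in> {0<..<t}"
    "g t - g 0 = (t - 0) * ((f' s - c * f s) * exp (- c * s))"
    using False t by auto
  moreover have "t * ((f' s - c * f s) * exp (- c * s)) \<le> 0"
    using le[of s] \<open>s \<in> {0<..<t}\<close> t by (intro mult_nonneg_nonpos mult_nonpos_nonneg) auto
  ultimately have "f t * exp (- c * t) \<le> f 0" by (simp add: g_def)
  then have "f t * exp (- c * t) * exp (c * t) \<le> f 0 * exp (c * t)" by (intro mult_right_mono) auto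
  then show ?thesis by (simp add: mult.assoc exp_add[symmetric])
qed simp

section \<open>Point vortices on short time intervals\<close>

lemma displacement_le:
  fixes f :: "real \<Rightarrow> 'a::real_normed_vector"
  assumes der: "\<And>s. s \<in> {0..t} \<Longrightarrow> (f has_vector_derivative f' s) (at s within {0..T})"
    and B: "\<And>s. s \<in> {0..t} \<Longrightarrow> norm (f' s) \<le> B" and t: "0 \<le> t" "t \<le> T"
  shows "norm (f t - f 0) \<le> B * t"
proof -
  have "norm (f t - f 0) \<le> B * norm (t - 0)"
  proof (rule differentiable_bound)
    show "(f has_derivative (\<lambda>h. h *\<^sub>R f' s)) (at s within {0..t})" if "s \<in> {0..t}" for s
      using der[OF that] t unfolding has_vector_derivative_def
      by (auto intro: has_derivative_subset)
    show "onorm (\<lambda>h. h *\<^sub>R f' s) \<le> B" if "s \<in> {0..t}" for s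
      using mult_left_mono[OF B[OF that]] by (intro onorm_le) (simp add: mult.commute[of B])
  qed (use t in auto)
  then show ?thesis using t by simp
qed

lemma continuous_on_discrete_Times:
  fixes f :: "'a discrete \<times> 'b::topological_space \<Rightarrow> 'c::topological_space"
  assumes "\<And>i. continuous_on UNIV (\<lambda>t. f (i, t))"
  shows "continuous_on UNIV f"
proof -
  have "continuous_on (\<Union>i. {i} \<times> UNIV) f"
  proof (rule continuous_on_open_UN)
    show "continuous_on ({i} \<times> UNIV) f" for i
    proof -
      have "continuous_on ({i} \<times> UNIV) (\<lambda>z. f (i, snd z))"
        by (rule continuous_on_compose2[OF assms]) (auto intro!: continuous_intros)
      then show ?thesis by (rule continuous_on_eq) auto
    qed
    show "open ({i} \<times> (UNIV :: 'b set))" for i :: "'a discrete"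
      by (intro open_Times open_UNIV open_discrete)
  qed
  moreover have "(\<Union>i. {i} \<times> UNIV) = (UNIV :: ('a discrete \<times> 'b) set)" by auto
  ultimately show ?thesis by simp
qed

text \<open>The number of vortices is not a type, so the Picard iteration is carried out in the Banach space
  of bounded continuous functions of the pair (index, time), where indices are discrete. Outside
  the time interval the trajectories are frozen.\<close>

lemma regularized_vortices_exist:
  fixes Ybar :: "nat \<Rightarrow> real^2"
  assumes h: "\<eta> > 0" and T: "T \<ge> 0"
    and short: "(\<Sum>j\<in>{1..N}. \<bar>a j\<bar>) / (pi * \<eta>\<^sup>2) * T < 1"
  obtains Y where "\<And>i. i \<in> {1..N} \<Longrightarrow> Y i 0 = Ybar i"
    "\<And>i t. i \<in> {1..N} \<Longrightarrow> t \<in> {0..T} \<Longrightarrow>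
      (Y i has_vector_derivative (\<Sum>j\<in>{1..N} - {i}. a j *\<^sub>R K_reg \<eta> (Y i t - Y j t))) (at t within {0..T})"
proof -
  define A where "A = (\<Sum>j\<in>{1..N}. \<bar>a j\<bar>)"
  define V where "V y i s = (\<Sum>j\<in>{1..N} - {i}. a j *\<^sub>R K_reg \<eta> (y (discrete i, s) - y (discrete j, s)))"
    for y :: "nat discrete \<times> real \<Rightarrow> real^2" and i s
  define cl where "cl t = max 0 (min T t)" for t
  define F where "F y = (\<lambda>(k, t). let i = of_discrete k in
      if i \<in> {1..N} then Ybar i + integral {0..cl t} (V y i) else 0)"
    for y
  have A: "A \<ge> 0" "\<And>i. (\<Sum>j\<in>{1..N} - {i}. \<bar>a j\<bar>) \<le> A"
    unfolding A_def by (auto intro!: sum_nonneg sum_mono2)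
  have cl: "0 \<le> cl t" "cl t \<le> T" "t \<in> {0..T} \<Longrightarrow> cl t = t" for t using T by (auto simp: cl_def)
  have contV: "continuous_on S (V y i)" if "continuous_on UNIV y" for y i S
    unfolding V_def
    by (intro continuous_intros continuous_on_K_reg h continuous_on_compose2[OF that]) auto
  have Vle: "norm (V y i s) \<le> A * (1 / (2 * pi * \<eta>))" for y i s
  proof -
    have "norm (V y i s) \<le> (\<Sum>j\<in>{1..N} - {i}. \<bar>a j\<bar> * (1 / (2 * pi * \<eta>)))"
      unfolding V_def by (intro sum_norm_le) (auto intro!: mult_left_mono norm_K_reg_le h simp del: times_divide_eq_right)
    also have "\<dots> = (\<Sum>j\<in>{1..N} - {i}. \<bar>a j\<bar>) * (1 / (2 * pi * \<eta>))" by (rule sum_distrib_right[symmetric])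
    also have "\<dots> \<le> A * (1 / (2 * pi * \<eta>))" using A h by (intro mult_right_mono) auto
    finally show ?thesis .
  qed
  have der: "((\<lambda>t. F y (discrete i, t)) has_vector_derivative V y i t) (at t within {0..T})"
    if "continuous_on UNIV y" "i \<in> {1..N}" "t \<in> {0..T}" for y i t
  proof -
    have "((\<lambda>t. integral {0..t} (V y i)) has_vector_derivative V y i t) (at t within {0..T})"
      using that by (intro integral_has_vector_derivative contV) auto
    then have "((\<lambda>t. Ybar i + integral {0..t} (V y i)) has_vector_derivative V y i t) (at t within {0..T})"
      by (auto intro!: derivative_eq_intros)
    then show ?thesis
      by (rule has_vector_derivative_transform[rotated 2]) (use that cl in \<open>auto simp: F_def Let_def discrete_inverse\<close>)
  qed
  have F: "F y \<in> bcontfun" if y: "continuous_on UNIV y" for y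
  proof (rule bcontfun_normI)
    show "continuous_on UNIV (F y)"
    proof (rule continuous_on_discrete_Times)
      fix k :: "nat discrete"
      obtain i where k: "k = discrete i" by (cases k)
      have "continuous_on {0..T} (\<lambda>t. F y (k, t))"
      proof (cases "i \<in> {1..N}")
        case True
        then show ?thesis using der[OF y True] has_vector_derivative_continuous
          by (fastforce simp: continuous_on_eq_continuous_within k)
      qed (auto simp: F_def Let_def discrete_inverse k)
      then have "continuous_on UNIV (\<lambda>t. F y (k, cl t))"
        by (rule continuous_on_compose2) (auto simp: cl_def T intro!: continuous_intros)
      moreover have "F y (k, cl t) = F y (k, t)" for t using cl T by (auto simp: F_def Let_def discrete_inverse cl_def)
      ultimately show "continuous_on UNIV (\<lambda>t. F y (k, t))" by simp
    qed
    show "norm (F y z) \<le> (\<Sum>i\<in>{1..N}. norm (Ybar i)) + A * (1 / (2 * pi * \<eta>)) * T" for z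
    proof -
      obtain i t where Pair: "z = (discrete i, t)" by (metis surj_pair discrete_cases)
      have "norm (integral {0..cl t} (V y i)) \<le> A * (1 / (2 * pi * \<eta>)) * (cl t - 0)"
        using cl Vle by (intro integral_bound contV y) auto
      also have "\<dots> \<le> A * (1 / (2 * pi * \<eta>)) * T"
        using cl[of t] A h by (intro mult_left_mono) auto
      finally have 1: "norm (integral {0..cl t} (V y i)) \<le> A * (1 / (2 * pi * \<eta>)) * T" .
      have 2: "i \<in> {1..N} \<Longrightarrow> norm (Ybar i) \<le> (\<Sum>i\<in>{1..N}. norm (Ybar i))"
        by (rule member_le_sum) auto
      show ?thesis
      proof (cases "i \<in> {1..N}")
        case True
        then show ?thesis using 1 2 norm_triangle_ineq[of "Ybar i" "integral {0..cl t} (V y i)"]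
          by (simp add: F_def Let_def discrete_inverse Pair)
      next
        case False
        have "0 \<le> A * (1 / (2 * pi * \<eta>)) * T" using A h T by auto
        then show ?thesis using False by (auto simp: F_def Let_def discrete_inverse Pair intro!: add_nonneg_nonneg sum_nonneg)
      qed
    qed
  qed
  define G where "G y = Bcontfun (F (apply_bcontfun y))" for y
  have G: "apply_bcontfun (G y) = F (apply_bcontfun y)" for y
    unfolding G_def by (intro Bcontfun_inverse F) auto
  have "\<exists>!y. y \<in> UNIV \<and> G y = y"
  proof (rule Banach_fix)
    show "0 \<le> A / (pi * \<eta>\<^sup>2) * T" using A T by auto
    show "A / (pi * \<eta>\<^sup>2) * T < 1" using short by (simp add: A_def)
    fix x y :: "(nat discrete \<times> real) \<Rightarrow>\<^sub>C (real^2)"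
    show "dist (G x) (G y) \<le> A / (pi * \<eta>\<^sup>2) * T * dist x y"
    proof (rule dist_bound)
      fix z :: "nat discrete \<times> real"
      obtain i t where z: "z = (discrete i, t)" by (metis surj_pair discrete_cases)
      show "dist (apply_bcontfun (G x) z) (apply_bcontfun (G y) z) \<le> A / (pi * \<eta>\<^sup>2) * T * dist x y"
      proof (cases "i \<in> {1..N}")
        case True
        have "norm (V x i s - V y i s) \<le> A * (1 / (2 * pi * \<eta>\<^sup>2) * (2 * dist x y))" for s
        proof -
          have "norm (V x i s - V y i s)
            \<le> (\<Sum>j\<in>{1..N} - {i}. \<bar>a j\<bar> * (1 / (2 * pi * \<eta>\<^sup>2) * (2 * dist x y)))"
            unfolding V_def sum_subtractf[symmetric] scaleR_diff_right[symmetric]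
          proof (rule sum_norm_le)
            fix j
            have "norm (x (discrete i, s) - x (discrete j, s) - (y (discrete i, s) - y (discrete j, s)))
              \<le> dist (x (discrete i, s)) (y (discrete i, s)) + dist (x (discrete j, s)) (y (discrete j, s))"
              unfolding dist_norm
              by (rule order.trans[OF _ norm_triangle_ineq4]) (simp add: algebra_simps)
            also have "\<dots> \<le> 2 * dist x y" using dist_bounded[of x "(discrete i, s)" y] dist_bounded[of x "(discrete j, s)" y] by linarith
            finally have "norm (K_reg \<eta> (x (discrete i, s) - x (discrete j, s)) - K_reg \<eta> (y (discrete i, s) - y (discrete j, s)))
              \<le> 1 / (2 * pi * \<eta>\<^sup>2) * (2 * dist x y)"
              by (intro order.trans[OF norm_K_reg_diff_le'[OF h]] mult_left_mono) auto
            then show "norm (a j *\<^sub>R (K_reg \<eta> (x (discrete i, s) - x (discrete j, s)) - K_reg \<eta> (y (discrete i, s) - y (discrete j, s))))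
              \<le> \<bar>a j\<bar> * (1 / (2 * pi * \<eta>\<^sup>2) * (2 * dist x y))"
              unfolding norm_scaleR by (intro mult_left_mono) auto
          qed
          also have "\<dots> = (\<Sum>j\<in>{1..N} - {i}. \<bar>a j\<bar>) * (1 / (2 * pi * \<eta>\<^sup>2) * (2 * dist x y))"
            by (rule sum_distrib_right[symmetric])
          also have "\<dots> \<le> A * (1 / (2 * pi * \<eta>\<^sup>2) * (2 * dist x y))"
            using A by (intro mult_right_mono) auto
          finally show ?thesis .
        qed
        then have "norm (integral {0..cl t} (\<lambda>s. V x i s - V y i s))
          \<le> A * (1 / (2 * pi * \<eta>\<^sup>2) * (2 * dist x y)) * (cl t - 0)"
          using cl by (intro integral_bound continuous_intros contV) auto
        also have "\<dots> \<le> A * (1 / (2 * pi * \<eta>\<^sup>2) * (2 * dist x y)) * T"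
          using cl[of t] A by (intro mult_left_mono) auto
        also have "\<dots> = A / (pi * \<eta>\<^sup>2) * T * dist x y" by simp
        also have "integral {0..cl t} (\<lambda>s. V x i s - V y i s) = integral {0..cl t} (V x i) - integral {0..cl t} (V y i)"
          by (intro integral_diff integrable_continuous_real contV) auto
        finally show ?thesis using True by (simp add: G F_def Let_def discrete_inverse z dist_norm)
      qed (use A T in \<open>auto simp: G F_def Let_def discrete_inverse z\<close>)
    qed
  qed (auto intro: Elementary_Metric_Spaces.complete_UNIV)
  then obtain y where "G y = y" by auto
  then have y: "F y = apply_bcontfun y" using G[of y] by simp
  show thesis
  proof (rule that[of "\<lambda>i t. y (discrete i, t)"])
    show "y (discrete i, 0) = Ybar i" if "i \<in> {1..N}" for i
    proof -
      have "F y (discrete i, 0) = Ybar i" using that T by (simp add: F_def Let_def discrete_inverse cl_def)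
      then show ?thesis by (simp add: y)
    qed
    show "((\<lambda>t. y (discrete i, t)) has_vector_derivative
        (\<Sum>j\<in>{1..N} - {i}. a j *\<^sub>R K_reg \<eta> (y (discrete i, t) - y (discrete j, t)))) (at t within {0..T})"
      if "i \<in> {1..N}" "t \<in> {0..T}" for i t
      using der[of y i t] that by (simp add: y V_def)
  qed
qed

lemma finite_pos_lower_bound:
  fixes f :: "'a \<Rightarrow> real"
  assumes "finite S" "\<And>x. x \<in> S \<Longrightarrow> f x > 0"
  obtains d where "d > 0" "\<And>x. x \<in> S \<Longrightarrow> d \<le> f x"
proof (rule that[of "Min (insert 1 (f ` S))"])
  show "0 < Min (insert 1 (f ` S))" using assms by auto
  show "Min (insert 1 (f ` S)) \<le> f x" if "x \<in> S" for x using assms(1) that by auto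
qed

text \<open>As long as the vortices keep half of the smallest initial distance, their speed is bounded by a constant, so
  no solution whatsoever can move by more than \<open>\<kappa>\<close> within a time depending only on the data.\<close>

lemma point_vortices_short_time:
  fixes Ybar :: "nat \<Rightarrow> real^2"
  assumes inj: "inj_on Ybar {1..N}" and k: "\<kappa> > 0"
  obtains T0 where "T0 > 0"
    "\<And>T. 0 \<le> T \<Longrightarrow> T \<le> T0 \<Longrightarrow> \<exists>Y. point_vortex_solution N a Ybar T Y"
    "\<And>T Y i t. T \<le> T0 \<Longrightarrow> point_vortex_solution N a Ybar T Y \<Longrightarrow> i \<in> {1..N} \<Longrightarrow> t \<in> {0..T} \<Longrightarrow>
       norm (Y i t - Ybar i) \<le> \<kappa>"
proof -
  let ?P = "{z \<in> {1..N} \<times> {1..N}. fst z \<noteq> snd z}"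
  obtain d where d: "d > 0" and "\<And>z. z \<in> ?P \<Longrightarrow> d \<le> norm (Ybar (fst z) - Ybar (snd z))"
    by (rule finite_pos_lower_bound[of ?P "\<lambda>z. norm (Ybar (fst z) - Ybar (snd z))"])
      (use inj in \<open>auto dest: inj_onD\<close>)
  then have dist: "d \<le> norm (Ybar i - Ybar j)" if "i \<in> {1..N}" "j \<in> {1..N}" "i \<noteq> j" for i j
    using that by fastforce
  define A where "A = (\<Sum>j\<in>{1..N}. \<bar>a j\<bar>)"
  define S where "S = A / (pi * d)"
  define k' where "k' = min \<kappa> (d / 4)"
  define T0 where "T0 = min (k' / ((1 + N) * (1 + S))) (1 / (1 + A / (pi * (d / 2)\<^sup>2)))"
  have A: "A \<ge> 0" "\<And>i. (\<Sum>j\<in>{1..N} - {i}. \<bar>a j\<bar>) \<le> A"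
    unfolding A_def by (auto intro!: sum_nonneg sum_mono2)
  have S: "S \<ge> 0" using A d by (simp add: S_def)
  have k': "k' > 0" "k' \<le> \<kappa>" "k' \<le> d / 4" using k d by (auto simp: k'_def)
  have A': "A / (pi * (d / 2)\<^sup>2) \<ge> 0" using A by simp
  have T0: "T0 > 0" unfolding T0_def using k' S A' by (auto intro!: divide_pos_pos mult_pos_pos add_pos_nonneg)
  have NST: "real (Suc N) * (S * T) < k'" if "0 \<le> T" "T \<le> T0" for T
  proof -
    have "T * ((1 + real N) * (1 + S)) \<le> k'"
      using that S unfolding T0_def by (subst pos_le_divide_eq[symmetric]) (auto intro!: mult_pos_pos add_pos_nonneg)
    moreover have "T * ((1 + real N) * (1 + S)) = real (Suc N) * (S * T) + real (Suc N) * T"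
      by (simp add: algebra_simps)
    moreover have "real (Suc N) * T > 0" if "T \<noteq> 0" using that \<open>0 \<le> T\<close> by simp
    ultimately show ?thesis using k' by (cases "T = 0") auto
  qed
  have ST: "S * T \<le> k'" if "0 \<le> T" "T \<le> T0" for T
  proof -
    have "S * T \<le> real (Suc N) * (S * T)" using S that by (simp add: mult_nonneg_nonneg algebra_simps)
    then show ?thesis using NST[OF that] by simp
  qed
  have speed: "norm (\<Sum>j\<in>{1..N} - {i}. a j *\<^sub>R k j) \<le> S"
    if "\<And>j. j \<in> {1..N} - {i} \<Longrightarrow> norm (k j) \<le> 1 / (pi * d)" for i and k :: "nat \<Rightarrow> real^2"
  proof -
    have "norm (\<Sum>j\<in>{1..N} - {i}. a j *\<^sub>R k j) \<le> (\<Sum>j\<in>{1..N} - {i}. \<bar>a j\<bar> * (1 / (pi * d)))"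
      using that by (intro sum_norm_le) (auto intro!: mult_left_mono simp del: times_divide_eq_right)
    also have "\<dots> = (\<Sum>j\<in>{1..N} - {i}. \<bar>a j\<bar>) * (1 / (pi * d))" by (rule sum_distrib_right[symmetric])
    also have "\<dots> \<le> A * (1 / (pi * d))" using A d by (intro mult_right_mono) auto
    finally show ?thesis by (simp add: S_def)
  qed
  have half: "d / 2 \<le> norm (y - z)"
    if "norm (y - Ybar i) \<le> k'" "norm (z - Ybar j) \<le> k'" "i \<in> {1..N}" "j \<in> {1..N}" "i \<noteq> j" for y z i j
  proof -
    have "norm (Ybar i - Ybar j) \<le> norm (y - Ybar i) + norm (y - z) + norm (z - Ybar j)"
      by (rule norm_diff_detour)
    then show ?thesis using dist[OF that(3-5)] that(1,2) k' by linarith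
  qed
  show thesis
  proof (rule that[OF T0])
    fix T assume T: "0 \<le> T" "T \<le> T0"
    have "A / (pi * (d / 2)\<^sup>2) * T \<le> A / (pi * (d / 2)\<^sup>2) * (1 / (1 + A / (pi * (d / 2)\<^sup>2)))"
      using T A' by (intro mult_left_mono) (auto simp: T0_def)
    also have "\<dots> < 1"
    proof -
      have "x * (1 / (1 + x)) < 1" if "x \<ge> 0" for x :: real using that by (simp add: divide_less_eq)
      then show ?thesis using A' .
    qed
    finally have "(\<Sum>j\<in>{1..N}. \<bar>a j\<bar>) / (pi * (d / 2)\<^sup>2) * T < 1" by (simp add: A_def)
    then obtain Y where Y0: "\<And>i. i \<in> {1..N} \<Longrightarrow> Y i 0 = Ybar i"
      and Y: "\<And>i t. i \<in> {1..N} \<Longrightarrow> t \<in> {0..T} \<Longrightarrow>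
        (Y i has_vector_derivative (\<Sum>j\<in>{1..N} - {i}. a j *\<^sub>R K_reg (d / 2) (Y i t - Y j t))) (at t within {0..T})"
      by (rule regularized_vortices_exist[rotated 2, where N=N and a=a and \<eta>="d / 2" and T=T and Ybar=Ybar]) (use d T in auto)
    have near: "norm (Y i t - Ybar i) \<le> k'" if "i \<in> {1..N}" "t \<in> {0..T}" for i t
    proof -
      have "norm (Y i t - Y i 0) \<le> S * t"
      proof (rule displacement_le)
        show "(Y i has_vector_derivative (\<Sum>j\<in>{1..N} - {i}. a j *\<^sub>R K_reg (d / 2) (Y i s - Y j s))) (at s within {0..T})"
          if "s \<in> {0..t}" for s using Y \<open>i \<in> _\<close> \<open>t \<in> _\<close> that by auto
        show "norm (\<Sum>j\<in>{1..N} - {i}. a j *\<^sub>R K_reg (d / 2) (Y i s - Y j s)) \<le> S" for s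
          using norm_K_reg_le[of "d / 2"] d by (intro speed) simp
      qed (use that in auto)
      also have "\<dots> \<le> S * T" using S that by (intro mult_left_mono) auto
      also have "\<dots> \<le> k'" using ST T by simp
      finally show ?thesis using Y0 that by simp
    qed
    have far: "d / 2 \<le> norm (Y i t - Y j t)" if "i \<in> {1..N}" "j \<in> {1..N}" "i \<noteq> j" "t \<in> {0..T}" for i j t
      using half near that by blast
    have "point_vortex_solution N a Ybar T Y"
      unfolding point_vortex_solution_def
    proof (intro conjI ballI impI)
      show "Y i 0 = Ybar i" if "i \<in> {1..N}" for i using Y0 that .
      show "Y i t \<noteq> Y j t" if "i \<in> {1..N}" "j \<in> {1..N}" "i \<noteq> j" "t \<in> {0..T}" for i j t
        using far[OF that] d by auto
      show "(Y i has_vector_derivative (\<Sum>j\<in>{1..N} - {i}. a j *\<^sub>R K (Y i t - Y j t))) (at t within {0..T})"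
        if "t \<in> {0..T}" "i \<in> {1..N}" for i t
      proof -
        have "(\<Sum>j\<in>{1..N} - {i}. a j *\<^sub>R K (Y i t - Y j t)) = (\<Sum>j\<in>{1..N} - {i}. a j *\<^sub>R K_reg (d / 2) (Y i t - Y j t))"
          using far that by (intro sum.cong refl) (auto simp: K_reg_eq_K)
        then show ?thesis using Y[OF that(2,1)] by simp
      qed
    qed
    then show "\<exists>Y. point_vortex_solution N a Ybar T Y" by blast
  next
    fix T Y i t
    assume "T \<le> T0" and sol: "point_vortex_solution N a Ybar T Y" and i: "i \<in> {1..N}" and t: "t \<in> {0..T}"
    have T: "0 \<le> T" "T \<le> T0" using t \<open>T \<le> T0\<close> by auto
    have Y0: "Y i 0 = Ybar i" if "i \<in> {1..N}" for i using sol that by (auto simp: point_vortex_solution_def)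
    have Y: "(Y i has_vector_derivative (\<Sum>j\<in>{1..N} - {i}. a j *\<^sub>R K (Y i t - Y j t))) (at t within {0..T})"
      if "i \<in> {1..N}" "t \<in> {0..T}" for i t using sol that by (auto simp: point_vortex_solution_def)
    define f where "f t = (\<Sum>i\<in>{1..N}. norm (Y i t - Ybar i))" for t
    have le_f: "norm (Y i t - Ybar i) \<le> f t" if "i \<in> {1..N}" for i t
      unfolding f_def by (rule member_le_sum) (use that in auto)
    have "continuous_on {0..T} (Y i)" if "i \<in> {1..N}" for i
      using Y[OF that] has_vector_derivative_continuous by (fastforce simp: continuous_on_eq_continuous_within)
    then have "continuous_on {0..T} f" unfolding f_def by (intro continuous_intros) auto
    then have "f t < k'"
    proof (rule continuity_bootstrap)
      show "f 0 < k'" using Y0 k' by (simp add: f_def)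
    next
      fix t assume t: "0 \<le> t" "t \<le> T" and f: "\<And>s. 0 \<le> s \<Longrightarrow> s \<le> t \<Longrightarrow> f s \<le> k'"
      have far: "d / 2 \<le> norm (Y i s - Y j s)" if "i \<in> {1..N}" "j \<in> {1..N}" "i \<noteq> j" "s \<in> {0..t}" for i j s
        using half[of "Y i s" i "Y j s" j] le_f[of i s] le_f[of j s] f[of s] that by force
      have "norm (Y i t - Y i 0) \<le> S * t" if "i \<in> {1..N}" for i
      proof (rule displacement_le)
        show "(Y i has_vector_derivative (\<Sum>j\<in>{1..N} - {i}. a j *\<^sub>R K (Y i s - Y j s))) (at s within {0..T})"
          if "s \<in> {0..t}" for s using Y \<open>i \<in> _\<close> t that by auto
        show "norm (\<Sum>j\<in>{1..N} - {i}. a j *\<^sub>R K (Y i s - Y j s)) \<le> S" if "s \<in> {0..t}" for s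
        proof (rule speed)
          fix j assume "j \<in> {1..N} - {i}"
          then have "d / 2 \<le> norm (Y i s - Y j s)" using far that \<open>i \<in> _\<close> by auto
          then have "1 / (2 * pi * norm (Y i s - Y j s)) \<le> 1 / (2 * pi * (d / 2))"
            using d by (intro divide_left_mono mult_left_mono mult_pos_pos) auto
          then show "norm (K (Y i s - Y j s)) \<le> 1 / (pi * d)" by (simp add: norm_K)
        qed
      qed (use t in auto)
      then have "f t \<le> (\<Sum>i\<in>{1..N}. S * t)" unfolding f_def using Y0 by (intro sum_mono) auto
      also have "\<dots> \<le> real (Suc N) * (S * t)" using S t by simp (simp add: algebra_simps)
      also have "\<dots> \<le> real (Suc N) * (S * T)" using S t by (intro mult_left_mono) auto
      also have "\<dots> < k'" by (rule NST[OF T])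
      finally show "f t < k'" .
    qed (use t in auto)
    then show "norm (Y i t - Ybar i) \<le> \<kappa>" using le_f[OF i, of t] k' by linarith
  qed
qed

section \<open>Velocities induced by diffuse clouds\<close>

text \<open>An \<open>L\<^sup>p\<close> bound with \<open>p > 2\<close> enters only through the property below. It survives transport by a measure
  preserving flow, and it makes sense for the laws of the particles.\<close>

locale diffuse_cloud = prob_space \<nu> for \<nu> :: "(real^2) measure" +
  fixes \<eta> \<kappa> :: real
  assumes sets_eq [measurable_cong, simp]: "sets \<nu> = sets borel"
    and eta_pos: "\<eta> > 0" and kappa_nonneg: "\<kappa> \<ge> 0"
    and near: "\<And>y. (\<integral>\<^sup>+z. ennreal (near_inverse \<eta> (y - z)) \<partial>\<nu>) \<le> ennreal \<kappa>"
begin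

lemma space_eq [simp]: "space \<nu> = UNIV"
  using sets_eq_imp_space_eq[OF sets_eq] by simp

lemma prob_UNIV [simp]: "prob UNIV = 1"
  using prob_space by simp

lemma nn_integral_inverse_dist_le:
  assumes A [measurable]: "A \<in> sets borel"
  shows "(\<integral>\<^sup>+z. ennreal (indicator A z * (1 / norm (y - z))) \<partial>\<nu>) \<le> ennreal (prob A / \<eta> + \<kappa>)"
proof -
  have "indicator A z * (1 / norm (y - z))
      \<le> 1 / \<eta> * indicator A z + near_inverse \<eta> (y - z)" for z
  proof (cases "norm (y - z) < \<eta>")
    case False
    then have "1 / norm (y - z) \<le> 1 / \<eta>" using eta_pos by (intro divide_left_mono mult_pos_pos) auto
    then show ?thesis using False by (auto simp: near_inverse_def indicator_def)
  qed (use eta_pos in \<open>auto simp: near_inverse_def indicator_def\<close>)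
  then have "(\<integral>\<^sup>+z. ennreal (indicator A z * (1 / norm (y - z))) \<partial>\<nu>)
    \<le> (\<integral>\<^sup>+z. ennreal (1 / \<eta>) * indicator A z + ennreal (near_inverse \<eta> (y - z)) \<partial>\<nu>)"
    using eta_pos by (intro nn_integral_mono)
      (simp add: near_inverse_def ennreal_plus[symmetric] ennreal_mult'[symmetric] ennreal_indicator[symmetric] ennreal_leI del: ennreal_plus times_divide_eq_right)
  also have "\<dots> = ennreal (1 / \<eta>) * emeasure \<nu> A + (\<integral>\<^sup>+z. ennreal (near_inverse \<eta> (y - z)) \<partial>\<nu>)"
    by (subst nn_integral_add) (auto simp: nn_integral_cmult_indicator simp del: times_divide_eq_right)
  also have "\<dots> \<le> ennreal (1 / \<eta>) * ennreal (prob A) + ennreal \<kappa>"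
    by (intro add_mono near) (simp add: emeasure_eq_measure)
  also have "\<dots> = ennreal (prob A / \<eta> + \<kappa>)"
    using eta_pos kappa_nonneg by (simp add: ennreal_mult'[symmetric])
  finally show ?thesis .
qed

lemma integrable_indicator_inverse_dist:
  assumes [measurable]: "A \<in> sets borel"
  shows "integrable \<nu> (\<lambda>z. indicator A z * (1 / norm (y - z)))"
proof (rule integrableI_bounded)
  have "(\<integral>\<^sup>+z. ennreal (norm (indicator A z * (1 / norm (y - z)))) \<partial>\<nu>) \<le> ennreal (prob A / \<eta> + \<kappa>)"
    using nn_integral_inverse_dist_le[OF assms, of y] by simp
  then show "(\<integral>\<^sup>+z. ennreal (norm (indicator A z * (1 / norm (y - z)))) \<partial>\<nu>) < \<infinity>"
    by (rule le_less_trans) simp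
qed measurable

lemma integral_indicator_inverse_dist_le:
  assumes A: "A \<in> sets borel"
  shows "(\<integral>z. indicator A z * (1 / norm (y - z)) \<partial>\<nu>) \<le> prob A / \<eta> + \<kappa>"
proof -
  have "ennreal (\<integral>z. indicator A z * (1 / norm (y - z)) \<partial>\<nu>) = (\<integral>\<^sup>+z. ennreal (indicator A z * (1 / norm (y - z))) \<partial>\<nu>)"
    by (intro nn_integral_eq_integral[symmetric] integrable_indicator_inverse_dist A) auto
  also note nn_integral_inverse_dist_le[OF A]
  finally show ?thesis
    using eta_pos kappa_nonneg by (subst (asm) ennreal_le_iff) auto
qed

lemma integrable_inverse_dist: "integrable \<nu> (\<lambda>z. 1 / norm (y - z))"
  using integrable_indicator_inverse_dist[of UNIV y] by simp

lemma integral_inverse_dist_le: "(\<integral>z. 1 / norm (y - z) \<partial>\<nu>) \<le> 1 / \<eta> + \<kappa>"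
  using integral_indicator_inverse_dist_le[of UNIV y] prob_space by simp

lemma integrable_K: "integrable \<nu> (\<lambda>z. K (y - z))"
  using integrable_inverse_dist[of y] by (rule Bochner_Integration.integrable_bound) (auto simp: norm_K_le)

lemma norm_velocity_le: "norm (\<integral>z. K (y - z) \<partial>\<nu>) \<le> 1 / \<eta> + \<kappa>"
proof -
  have "norm (\<integral>z. K (y - z) \<partial>\<nu>) \<le> (\<integral>z. norm (K (y - z)) \<partial>\<nu>)" by (rule integral_norm_bound)
  also have "\<dots> \<le> (\<integral>z. 1 / norm (y - z) \<partial>\<nu>)"
    using norm_K_le by (intro integral_mono integrable_norm integrable_K integrable_inverse_dist) auto
  also have "\<dots> \<le> 1 / \<eta> + \<kappa>" by (rule integral_inverse_dist_le)
  finally show ?thesis .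
qed

lemma measurable_velocity [measurable]: "(\<lambda>y. \<integral>z. K (y - z) \<partial>\<nu>) \<in> borel_measurable borel"
  by (rule borel_measurable_lebesgue_integral) measurable

text \<open>Newton's third law: exchanging the two particles, the self-interaction of a cloud tested with
  a radial field \<open>w(x)(x - c)\<close> only sees differences of \<open>w\<close>. For constant \<open>w\<close> it vanishes.\<close>

lemma self_interaction:
  fixes w :: "real^2 \<Rightarrow> real"
  assumes [measurable]: "w \<in> borel_measurable borel" and int: "integrable \<nu> (\<lambda>x. w x * norm (x - c))"
  shows "integrable (\<nu> \<Otimes>\<^sub>M \<nu>) (\<lambda>(x, y). (w x - w y) * ((x - c) \<bullet> K (x - y)))"
    and "(\<integral>x. w x * ((x - c) \<bullet> (\<integral>y. K (x - y) \<partial>\<nu>)) \<partial>\<nu>)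
      = (\<integral>(x, y). (w x - w y) * ((x - c) \<bullet> K (x - y)) \<partial>(\<nu> \<Otimes>\<^sub>M \<nu>)) / 2"
proof -
  interpret P: pair_sigma_finite \<nu> \<nu> by unfold_locales
  define f where "f = (\<lambda>(x, y). w x * ((x - c) \<bullet> K (x - y)))"
  have [measurable]: "f \<in> borel_measurable (\<nu> \<Otimes>\<^sub>M \<nu>)" unfolding f_def by measurable
  have inner: "integrable \<nu> (\<lambda>y. f (x, y))" for x
    unfolding f_def by (simp add: integrable_K)
  have f: "integrable (\<nu> \<Otimes>\<^sub>M \<nu>) f"
  proof (rule P.Fubini_integrable)
    show "integrable \<nu> (\<lambda>x. \<integral>y. norm (f (x, y)) \<partial>\<nu>)"
    proof (rule Bochner_Integration.integrable_bound)
      show "integrable \<nu> (\<lambda>x. (1 / \<eta> + \<kappa>) * norm (w x * norm (x - c)))"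
        using int by (intro integrable_mult_right integrable_norm)
      show "(\<lambda>x. \<integral>y. norm (f (x, y)) \<partial>\<nu>) \<in> borel_measurable \<nu>"
        by measurable
      show "AE x in \<nu>. norm (\<integral>y. norm (f (x, y)) \<partial>\<nu>) \<le> norm ((1 / \<eta> + \<kappa>) * norm (w x * norm (x - c)))"
      proof (rule AE_I2)
        fix x
        have "norm (f (x, y)) \<le> norm (w x * norm (x - c)) * (1 / norm (x - y))" for y
        proof -
          have "\<bar>(x - c) \<bullet> K (x - y)\<bar> \<le> norm (x - c) * (1 / norm (x - y))"
            by (rule order.trans[OF Cauchy_Schwarz_ineq2 mult_left_mono[OF norm_K_le]]) simp
          from mult_left_mono[OF this, of "\<bar>w x\<bar>"] show ?thesis
            by (simp add: f_def abs_mult mult.assoc)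
        qed
        then have "(\<integral>y. norm (f (x, y)) \<partial>\<nu>) \<le> (\<integral>y. norm (w x * norm (x - c)) * (1 / norm (x - y)) \<partial>\<nu>)"
          by (intro integral_mono integrable_norm inner integrable_mult_right integrable_inverse_dist)
        also have "\<dots> \<le> norm (w x * norm (x - c)) * (1 / \<eta> + \<kappa>)"
          using integral_inverse_dist_le[of x] by (simp del: times_divide_eq_right add: mult_left_mono)
        finally show "norm (\<integral>y. norm (f (x, y)) \<partial>\<nu>) \<le> norm ((1 / \<eta> + \<kappa>) * norm (w x * norm (x - c)))"
          using eta_pos kappa_nonneg by (simp add: mult.commute)
      qed
    qed
  qed (use inner in auto)
  have g: "integrable (\<nu> \<Otimes>\<^sub>M \<nu>) (\<lambda>(x, y). f (y, x))"
    using f by (rule P.integrable_product_swap)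
  have fg: "(\<lambda>(x, y). (w x - w y) * ((x - c) \<bullet> K (x - y))) = (\<lambda>z. f z + (\<lambda>(x, y). f (y, x)) z)"
  proof (rule ext)
    fix z :: "(real^2) \<times> (real^2)"
    obtain x y where z: "z = (x, y)" by (cases z)
    have "(y - c) \<bullet> K (y - x) = - ((x - c) \<bullet> K (x - y))"
      using inner_K_diff[of "x - c" "y - c"] K_minus[of "x - y"] by simp
    then show "(case z of (x, y) \<Rightarrow> (w x - w y) * ((x - c) \<bullet> K (x - y))) = f z + (\<lambda>(x, y). f (y, x)) z"
      by (simp add: f_def left_diff_distrib z)
  qed
  show "integrable (\<nu> \<Otimes>\<^sub>M \<nu>) (\<lambda>(x, y). (w x - w y) * ((x - c) \<bullet> K (x - y)))"
    unfolding fg by (intro Bochner_Integration.integrable_add f g)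
  have "(\<integral>x. w x * ((x - c) \<bullet> (\<integral>y. K (x - y) \<partial>\<nu>)) \<partial>\<nu>) = (\<integral>x. (\<integral>y. f (x, y) \<partial>\<nu>) \<partial>\<nu>)"
    unfolding f_def by (simp add: integrable_K)
  also have "\<dots> = integral\<^sup>L (\<nu> \<Otimes>\<^sub>M \<nu>) f" by (rule P.integral_fst'[OF f])
  finally have I: "(\<integral>x. w x * ((x - c) \<bullet> (\<integral>y. K (x - y) \<partial>\<nu>)) \<partial>\<nu>) = integral\<^sup>L (\<nu> \<Otimes>\<^sub>M \<nu>) f" .
  have "(\<integral>(x, y). (w x - w y) * ((x - c) \<bullet> K (x - y)) \<partial>(\<nu> \<Otimes>\<^sub>M \<nu>))
      = integral\<^sup>L (\<nu> \<Otimes>\<^sub>M \<nu>) f + (\<integral>(x, y). f (y, x) \<partial>(\<nu> \<Otimes>\<^sub>M \<nu>))"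
    unfolding fg by (rule Bochner_Integration.integral_add[OF f g])
  also have "(\<integral>(x, y). f (y, x) \<partial>(\<nu> \<Otimes>\<^sub>M \<nu>)) = integral\<^sup>L (\<nu> \<Otimes>\<^sub>M \<nu>) f"
    by (rule P.integral_product_swap) measurable
  finally show "(\<integral>x. w x * ((x - c) \<bullet> (\<integral>y. K (x - y) \<partial>\<nu>)) \<partial>\<nu>)
      = (\<integral>(x, y). (w x - w y) * ((x - c) \<bullet> K (x - y)) \<partial>(\<nu> \<Otimes>\<^sub>M \<nu>)) / 2"
    by (simp add: I)
qed

end

text \<open>The weight \<open>\<psi>\<close> equals \<open>1\<close> outside the disc of radius \<open>b\<close> about \<open>c\<close> and is as small as
  \<open>exp (-\<beta>)\<close> at its centre, so that its mean bounds the mass outside the disc, and it is tiny as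
  long as the cloud sits well inside. Its gradient is \<open>outer_slope c b \<beta> x *\<^sub>R (x - c)\<close>.\<close>

definition depth :: "real^2 \<Rightarrow> real \<Rightarrow> real^2 \<Rightarrow> real" where
  "depth c b x = max 0 (1 - (norm (x - c))\<^sup>2 / b\<^sup>2)"

definition outer_weight :: "real^2 \<Rightarrow> real \<Rightarrow> real \<Rightarrow> real^2 \<Rightarrow> real" where
  "outer_weight c b \<beta> x = exp (- \<beta> * (depth c b x)\<^sup>2)"

definition outer_slope :: "real^2 \<Rightarrow> real \<Rightarrow> real \<Rightarrow> real^2 \<Rightarrow> real" where
  "outer_slope c b \<beta> x = 4 * \<beta> / b\<^sup>2 * depth c b x * outer_weight c b \<beta> x"

lemma depth_bounds: "0 \<le> depth c b x" "depth c b x \<le> 1"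
  by (simp_all add: depth_def)

lemma outer_weight_bounds: "0 < outer_weight c b \<beta> x" "0 \<le> \<beta> \<Longrightarrow> outer_weight c b \<beta> x \<le> 1"
  by (simp_all add: outer_weight_def)

lemma measurable_outer [measurable]:
  "depth c b \<in> borel_measurable borel" "outer_weight c b \<beta> \<in> borel_measurable borel"
  "outer_slope c b \<beta> \<in> borel_measurable borel"
  unfolding depth_def[abs_def] outer_weight_def[abs_def] outer_slope_def[abs_def] by measurable

lemma depth_pos_iff: "b > 0 \<Longrightarrow> depth c b x > 0 \<longleftrightarrow> norm (x - c) < b"
  using power_mono_iff[of b "norm (x - c)" 2]
  by (auto simp: depth_def less_max_iff_disj divide_less_eq simp flip: not_le)

lemma depth_eq_0: "b > 0 \<Longrightarrow> b \<le> norm (x - c) \<Longrightarrow> depth c b x = 0"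
  using depth_pos_iff[of b c x] depth_bounds(1)[of c b x] by auto

lemma depth_diff_le:
  assumes "b > 0"
  shows "\<bar>depth c b x - depth c b y\<bar> \<le> norm (x - y) * (norm (x - c) + norm (y - c)) / b\<^sup>2"
proof -
  have "\<bar>depth c b x - depth c b y\<bar> \<le> \<bar>(norm (x - c))\<^sup>2 / b\<^sup>2 - (norm (y - c))\<^sup>2 / b\<^sup>2\<bar>"
    unfolding depth_def by linarith
  also have "\<dots> = \<bar>(norm (x - c) - norm (y - c)) * (norm (x - c) + norm (y - c)) / b\<^sup>2\<bar>"
    by (simp add: diff_divide_distrib[symmetric] power2_eq_square algebra_simps)
  also have "\<dots> = \<bar>norm (x - c) - norm (y - c)\<bar> * (norm (x - c) + norm (y - c)) / b\<^sup>2"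
    by (simp add: abs_mult)
  also have "\<dots> \<le> norm (x - y) * (norm (x - c) + norm (y - c)) / b\<^sup>2"
    using norm_triangle_ineq3[of "x - c" "y - c"] by (intro divide_right_mono mult_right_mono) auto
  finally show ?thesis .
qed

lemma outer_weight_difference:
  fixes q r \<beta> :: real
  assumes l: "\<beta> \<ge> 1" and q: "0 \<le> q" "q \<le> 1" and r: "0 \<le> r" "r \<le> 1"
  shows "\<bar>q * exp (- \<beta> * q\<^sup>2) - r * exp (- \<beta> * r\<^sup>2)\<bar>
    \<le> 2 * \<beta> * \<bar>q - r\<bar> * (of_bool (q > 0) * exp (- \<beta> * q\<^sup>2) + of_bool (r > 0) * exp (- \<beta> * r\<^sup>2))"
    (is "?L q r \<le> ?R q r")
proof -
  have main: "?L q r \<le> ?R q r" if rq: "0 \<le> r" "r < q" "q \<le> 1" for q r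
  proof -
    define e where "e s = exp (- \<beta> * s\<^sup>2)" for s :: real
    have e: "e q \<le> e r" "e q > 0" "e r > 0" using l rq by (auto simp: e_def power_mono)
    have "q * e q - r * e r \<le> (q - r) * e q"
      using mult_left_mono[OF e(1), of r] rq by (simp add: algebra_simps)
    also have "\<dots> \<le> 2 * \<beta> * (q - r) * e q"
      using l rq e by (simp add: mult_right_mono)
    finally have 1: "q * e q - r * e r \<le> 2 * \<beta> * (q - r) * e q" .
    have "e q = e r * exp (- \<beta> * (q\<^sup>2 - r\<^sup>2))"
      by (simp add: e_def exp_add[symmetric] algebra_simps)
    moreover have "1 + (- \<beta> * (q\<^sup>2 - r\<^sup>2)) \<le> exp (- \<beta> * (q\<^sup>2 - r\<^sup>2))" by (rule exp_ge_add_one_self)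
    ultimately have "e r * (1 + (- \<beta> * (q\<^sup>2 - r\<^sup>2))) \<le> e q" using e(3) by (metis mult_left_mono less_imp_le)
    then have "e r - e q \<le> e r * (\<beta> * ((q - r) * (q + r)))"
      by (simp add: algebra_simps power2_eq_square)
    also have "\<dots> \<le> e r * (\<beta> * ((q - r) * 2))"
      using l rq e by (intro mult_left_mono) auto
    finally have d: "e r - e q \<le> e r * (\<beta> * ((q - r) * 2))" .
    have "r * e r - q * e q \<le> r * (e r - e q)" using rq e by (simp add: algebra_simps)
    also have "\<dots> \<le> r * (e r * (\<beta> * ((q - r) * 2)))" using d rq by (intro mult_left_mono) auto
    also have "\<dots> \<le> of_bool (r > 0) * (e r * (\<beta> * ((q - r) * 2)))"
      using rq l e by (cases "r = 0") (auto intro!: mult_left_le_one_le mult_nonneg_nonneg)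
    finally have 2: "r * e r - q * e q \<le> 2 * \<beta> * (q - r) * (of_bool (r > 0) * e r)" by (simp add: mult_ac)
    have "2 * \<beta> * (q - r) * e q \<ge> 0" "2 * \<beta> * (q - r) * (of_bool (r > 0) * e r) \<ge> 0"
      using l rq e by auto
    then have "\<bar>q * e q - r * e r\<bar> \<le> 2 * \<beta> * (q - r) * e q + 2 * \<beta> * (q - r) * (of_bool (r > 0) * e r)"
      using 1 2 by linarith
    then show ?thesis using rq by (simp add: e_def distrib_left)
  qed
  consider "q = r" | "q < r" | "r < q" by linarith
  then show ?thesis
  proof cases
    case 2 then show ?thesis using main[of q r] q r by (simp add: abs_minus_commute add.commute)
  qed (use main[of r q] q r in auto)
qed

text \<open>Near the diagonal, the Lipschitz bound for the slope beats the singularity of the kernel; that the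
  force is orthogonal to \<open>x - y\<close> gains the second factor \<open>min |x| |y|\<close>, which makes the bound
  proportional to the (small) spread of the cloud.\<close>

lemma outer_slope_interaction_le:
  assumes b: "b > 0" and l: "\<beta> \<ge> 1"
  shows "\<bar>(outer_slope c b \<beta> x - outer_slope c b \<beta> y) * ((x - c) \<bullet> K (x - y))\<bar>
    \<le> 16 * \<beta>\<^sup>2 / b ^ 3 * (norm (y - c) * outer_weight c b \<beta> x + norm (x - c) * outer_weight c b \<beta> y)"
proof (cases "x = y")
  case False
  define r where "r = norm (x - c)"
  define s where "s = norm (y - c)"
  define d where "d = norm (x - y)"
  define e where "e = outer_weight c b \<beta>"
  define q where "q = depth c b"
  have pos: "r \<ge> 0" "s \<ge> 0" "d > 0" "e x > 0" "e y > 0"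
    using False by (auto simp: r_def s_def d_def e_def outer_weight_bounds)
  define W where "W = of_bool (r < b) * e x + of_bool (s < b) * e y"
  have W: "W \<ge> 0" using pos by (auto simp: W_def)
  have "\<bar>q x * e x - q y * e y\<bar> \<le> 2 * \<beta> * \<bar>q x - q y\<bar> * W"
    using outer_weight_difference[OF l, of "q x" "q y"] depth_bounds[of c b] b
    unfolding W_def r_def s_def e_def q_def outer_weight_def by (simp add: depth_pos_iff)
  also have "\<dots> \<le> 2 * \<beta> * (d * (r + s) / b\<^sup>2) * W"
    using depth_diff_le[OF b, of c x y] l W unfolding q_def d_def r_def s_def
    by (intro mult_right_mono mult_left_mono) auto
  finally have q: "\<bar>q x * e x - q y * e y\<bar> \<le> 2 * \<beta> * (d * (r + s) / b\<^sup>2) * W" .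
  have "outer_slope c b \<beta> x - outer_slope c b \<beta> y = 4 * \<beta> / b\<^sup>2 * (q x * e x - q y * e y)"
    by (simp add: outer_slope_def q_def e_def algebra_simps)
  then have "\<bar>outer_slope c b \<beta> x - outer_slope c b \<beta> y\<bar> = 4 * \<beta> / b\<^sup>2 * \<bar>q x * e x - q y * e y\<bar>"
    using l by (simp add: abs_mult)
  also have "\<dots> \<le> 4 * \<beta> / b\<^sup>2 * (2 * \<beta> * (d * (r + s) / b\<^sup>2) * W)"
    using q l by (intro mult_left_mono) auto
  finally have slope: "\<bar>outer_slope c b \<beta> x - outer_slope c b \<beta> y\<bar> \<le> 8 * \<beta>\<^sup>2 / b ^ 4 * d * (r + s) * W"
    using b by (simp add: power2_eq_square power4_eq_xxxx field_simps)
  have "\<bar>(x - c) \<bullet> K (x - y)\<bar> \<le> r * (1 / d)"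
    unfolding r_def d_def by (rule order.trans[OF Cauchy_Schwarz_ineq2 mult_left_mono[OF norm_K_le]]) simp
  moreover have "\<bar>(x - c) \<bullet> K (x - y)\<bar> \<le> s * (1 / d)"
    using inner_K_diff[of "x - c" "y - c"] order.trans[OF Cauchy_Schwarz_ineq2 mult_left_mono[OF norm_K_le], of "y - c" "x - y"]
    unfolding s_def d_def by simp
  ultimately have force: "\<bar>(x - c) \<bullet> K (x - y)\<bar> \<le> min r s * (1 / d)" by (simp add: min_def)
  have "\<bar>(outer_slope c b \<beta> x - outer_slope c b \<beta> y) * ((x - c) \<bullet> K (x - y))\<bar>
      \<le> (8 * \<beta>\<^sup>2 / b ^ 4 * d * (r + s) * W) * (min r s * (1 / d))"
    unfolding abs_mult using W pos b by (intro mult_mono slope force mult_nonneg_nonneg) auto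
  also have "\<dots> = 8 * \<beta>\<^sup>2 / b ^ 4 * W * ((r + s) * min r s)" using pos by simp
  also have "\<dots> \<le> 8 * \<beta>\<^sup>2 / b ^ 4 * W * (2 * (r * s))"
  proof (intro mult_left_mono)
    show "(r + s) * min r s \<le> 2 * (r * s)"
      using pos mult_left_mono[of r s r] mult_left_mono[of s r s] by (auto simp: min_def algebra_simps)
  qed (use W b in auto)
  also have "\<dots> = 16 * \<beta>\<^sup>2 / b ^ 4 * (W * (r * s))" by simp
  also have "\<dots> \<le> 16 * \<beta>\<^sup>2 / b ^ 4 * (b * (s * e x + r * e y))"
  proof (intro mult_left_mono)
    have "of_bool (r < b) * e x * (r * s) \<le> b * (s * e x)"
      using pos b mult_right_mono[of r b "s * e x"] by (auto simp: mult_ac)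
    moreover have "of_bool (s < b) * e y * (r * s) \<le> b * (r * e y)"
      using pos b mult_right_mono[of s b "r * e y"] by (auto simp: mult_ac)
    ultimately show "W * (r * s) \<le> b * (s * e x + r * e y)" unfolding W_def distrib_left distrib_right by linarith
  qed auto
  also have "\<dots> = 16 * \<beta>\<^sup>2 / b ^ 3 * (s * e x + r * e y)" using b by (simp add: power4_eq_xxxx power3_eq_cube field_simps)
  finally show ?thesis unfolding r_def s_def e_def .
qed (use b in \<open>auto intro!: mult_nonneg_nonneg add_nonneg_nonneg simp: less_imp_le[OF outer_weight_bounds(1)]\<close>)

section \<open>Differential inequalities for a configuration of clouds\<close>

definition induced_velocity :: "nat \<Rightarrow> (nat \<Rightarrow> real) \<Rightarrow> (nat \<Rightarrow> (real^2) measure) \<Rightarrow> real^2 \<Rightarrow> real^2" where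
  "induced_velocity N a \<nu> x = (\<Sum>j\<in>{1..N}. a j *\<^sub>R (\<integral>y. K (x - y) \<partial>\<nu> j))"

definition vortex_velocity :: "nat \<Rightarrow> (nat \<Rightarrow> real) \<Rightarrow> (nat \<Rightarrow> real^2) \<Rightarrow> nat \<Rightarrow> real^2" where
  "vortex_velocity N a Y i = (\<Sum>j\<in>{1..N} - {i}. a j *\<^sub>R K (Y i - Y j))"

locale vortex_clouds =
  fixes N :: nat and a :: "nat \<Rightarrow> real" and \<nu> :: "nat \<Rightarrow> (real^2) measure" and Y :: "nat \<Rightarrow> real^2"
    and b \<eta> \<kappa> :: real
  assumes cloud: "i \<in> {1..N} \<Longrightarrow> diffuse_cloud (\<nu> i) \<eta> \<kappa>"
    and b_pos: "b > 0"
    and separated: "i \<in> {1..N} \<Longrightarrow> j \<in> {1..N} \<Longrightarrow> i \<noteq> j \<Longrightarrow> 4 * b \<le> norm (Y i - Y j)"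
    and moment: "i \<in> {1..N} \<Longrightarrow> integrable (\<nu> i) (\<lambda>x. (norm (x - Y i))\<^sup>2)"
begin

abbreviation "energy i \<equiv> \<integral>x. (norm (x - Y i))\<^sup>2 \<partial>\<nu> i"
abbreviation "spread i \<equiv> \<integral>x. norm (x - Y i) \<partial>\<nu> i"
abbreviation "tail i \<equiv> measure (\<nu> i) {x. b \<le> norm (x - Y i)}"

lemma tail_set [measurable]: "{x. b \<le> norm (x - c)} \<in> sets borel" for c :: "real^2"
  by measurable

lemma integrable_spread:
  assumes i: "i \<in> {1..N}" shows "integrable (\<nu> i) (\<lambda>x. norm (x - Y i))"
proof -
  interpret diffuse_cloud "\<nu> i" \<eta> \<kappa> using i by (rule cloud)
  show ?thesis
  proof (rule Bochner_Integration.integrable_bound)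
    show "integrable (\<nu> i) (\<lambda>x. 1 + (norm (x - Y i))\<^sup>2)" using moment[OF i] by simp
    show "AE x in \<nu> i. norm (norm (x - Y i)) \<le> norm (1 + (norm (x - Y i))\<^sup>2)"
    proof (rule AE_I2)
      fix x
      have "2 * norm (x - Y i) \<le> 1 + (norm (x - Y i))\<^sup>2"
        using zero_le_power2[of "norm (x - Y i) - 1"] by (simp add: power2_eq_square algebra_simps)
      then have "norm (x - Y i) \<le> 1 + (norm (x - Y i))\<^sup>2"
        using norm_ge_zero[of "x - Y i"] by linarith
      then show "norm (norm (x - Y i)) \<le> norm (1 + (norm (x - Y i))\<^sup>2)" by simp
    qed
  qed measurable
qed

lemma spread_square_le:
  assumes i: "i \<in> {1..N}" shows "(spread i)\<^sup>2 \<le> energy i"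
proof -
  interpret diffuse_cloud "\<nu> i" \<eta> \<kappa> using i by (rule cloud)
  have "0 \<le> (\<integral>x. (norm (x - Y i) - spread i)\<^sup>2 \<partial>\<nu> i)" by simp
  also have "\<dots> = (\<integral>x. (norm (x - Y i))\<^sup>2 + (- (2 * spread i)) * norm (x - Y i) + (spread i)\<^sup>2 \<partial>\<nu> i)"
    by (intro Bochner_Integration.integral_cong refl) (simp add: power2_diff)
  also have "\<dots> = energy i + (- (2 * spread i)) * spread i + (spread i)\<^sup>2"
    using integrable_spread[OF i] moment[OF i]
    by (subst Bochner_Integration.integral_add, simp, simp, subst Bochner_Integration.integral_add) (auto simp: prob_space)
  finally show ?thesis by (simp add: power2_eq_square)
qed

text \<open>Seen from the inner disc of its own cluster, the main part of another cloud is far away, and its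
  tail is too light to matter even if it comes close.\<close>

lemma cross_velocity_le:
  assumes i: "i \<in> {1..N}" and j: "j \<in> {1..N}" and ij: "i \<noteq> j" and x: "norm (x - Y i) < b"
  shows "norm (\<integral>y. K (x - y) \<partial>\<nu> j) \<le> 1 / b + (tail j / \<eta> + \<kappa>)"
proof -
  interpret diffuse_cloud "\<nu> j" \<eta> \<kappa> using j by (rule cloud)
  have "norm (K (x - y)) \<le> 1 / b + indicator {y. b \<le> norm (y - Y j)} y * (1 / norm (x - y))" for y
  proof (cases "b \<le> norm (y - Y j)")
    case False
    have "b \<le> norm (x - y)"
      using norm_diff_detour[of "Y i" "Y j" x y] separated[OF i j ij] x False b_pos by linarith
    then show ?thesis using norm_K_le_inverse[OF b_pos] False by simp
  next
    case True then show ?thesis using norm_K_le[of "x - y"] b_pos by (simp add: add_increasing)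
  qed
  note pw = this
  have "norm (\<integral>y. K (x - y) \<partial>\<nu> j) \<le> (\<integral>y. norm (K (x - y)) \<partial>\<nu> j)" by (rule integral_norm_bound)
  also have "\<dots> \<le> (\<integral>y. 1 / b + indicator {y. b \<le> norm (y - Y j)} y * (1 / norm (x - y)) \<partial>\<nu> j)"
    using pw by (intro integral_mono integrable_norm integrable_K Bochner_Integration.integrable_add
        integrable_indicator_inverse_dist) auto
  also have "\<dots> = 1 / b + (\<integral>y. indicator {y. b \<le> norm (y - Y j)} y * (1 / norm (x - y)) \<partial>\<nu> j)"
    by (subst Bochner_Integration.integral_add[OF _ integrable_indicator_inverse_dist[OF tail_set]]) (simp_all add: prob_space)
  also have "\<dots> \<le> 1 / b + (tail j / \<eta> + \<kappa>)"
    using integral_indicator_inverse_dist_le[OF tail_set] by simp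
  finally show ?thesis .
qed

definition force_error :: "nat \<Rightarrow> nat \<Rightarrow> real^2 \<Rightarrow> real^2" where
  "force_error i j x = (\<integral>y. K (x - y) \<partial>\<nu> j) - K (Y i - Y j)"

lemma force_error_le:
  assumes i: "i \<in> {1..N}" and j: "j \<in> {1..N}" and ij: "i \<noteq> j"
  shows "norm (force_error i j x)
    \<le> (norm (x - Y i) + 2 * spread j) / b\<^sup>2 + (tail j / \<eta> + \<kappa>)
      + of_bool (b \<le> norm (x - Y i)) * (1 / \<eta> + \<kappa> + 1 / b)"
proof -
  interpret diffuse_cloud "\<nu> j" \<eta> \<kappa> using j by (rule cloud)
  have sep: "4 * b \<le> norm (Y i - Y j)" by (rule separated[OF i j ij])
  have Kij: "norm (K (Y i - Y j)) \<le> 1 / b"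
    using sep b_pos by (intro norm_K_le_inverse) auto
  have nn: "0 \<le> (norm (x - Y i) + 2 * spread j) / b\<^sup>2" "0 \<le> tail j / \<eta> + \<kappa>"
    using eta_pos kappa_nonneg by auto
  show ?thesis
  proof (cases "b \<le> norm (x - Y i)")
    case True
    have "norm (force_error i j x) \<le> (1 / \<eta> + \<kappa>) + 1 / b"
      unfolding force_error_def by (rule order.trans[OF norm_triangle_ineq4 add_mono[OF norm_velocity_le Kij]])
    moreover have ob: "of_bool (b \<le> norm (x - Y i)) = (1 :: real)" using True by simp
    ultimately show ?thesis using nn unfolding ob mult_1 by linarith
  next
    case False
    have pw: "norm (K (x - y) - K (Y i - Y j)) \<le> (norm (x - Y i) + 2 * norm (y - Y j)) / b\<^sup>2
        + indicator {y. b \<le> norm (y - Y j)} y * (1 / norm (x - y))" for y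
    proof (cases "b \<le> norm (y - Y j)")
      case far: False
      have xy: "b \<le> norm (x - y)"
        using norm_diff_detour[of "Y i" "Y j" x y] sep far False b_pos by linarith
      have "norm (K (x - y) - K (Y i - Y j)) \<le> norm ((x - y) - (Y i - Y j)) / (2 * pi * norm (x - y) * norm (Y i - Y j))"
        using xy sep b_pos by (intro norm_K_diff_le) auto
      also have "\<dots> \<le> (norm (x - Y i) + 2 * norm (y - Y j)) / b\<^sup>2"
      proof (rule frac_le)
        have "norm ((x - Y i) - (y - Y j)) \<le> norm (x - Y i) + norm (y - Y j)" by (rule norm_triangle_ineq4)
        also have "\<dots> \<le> norm (x - Y i) + 2 * norm (y - Y j)" by simp
        finally show "norm ((x - y) - (Y i - Y j)) \<le> norm (x - Y i) + 2 * norm (y - Y j)" by (simp add: algebra_simps)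
        have "1 * (b * b) \<le> (2 * pi) * (norm (x - y) * norm (Y i - Y j))"
          using xy sep b_pos pi_gt3 by (intro mult_mono) auto
        then show "b\<^sup>2 \<le> 2 * pi * norm (x - y) * norm (Y i - Y j)" by (simp add: power2_eq_square mult.assoc)
      qed (use b_pos in auto)
      finally show ?thesis using far by simp
    next
      case far: True
      have "1 / b \<le> norm (y - Y j) / b\<^sup>2" using far b_pos by (simp add: field_simps power2_eq_square)
      also have "\<dots> \<le> (norm (x - Y i) + 2 * norm (y - Y j)) / b\<^sup>2" by (intro divide_right_mono) auto
      finally have "1 / b \<le> (norm (x - Y i) + 2 * norm (y - Y j)) / b\<^sup>2" .
      moreover have "norm (K (x - y) - K (Y i - Y j)) \<le> 1 / norm (x - y) + 1 / b"
        by (rule order.trans[OF norm_triangle_ineq4 add_mono[OF norm_K_le Kij]])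
      ultimately show ?thesis using far by simp
    qed
    have "force_error i j x = (\<integral>y. K (x - y) - K (Y i - Y j) \<partial>\<nu> j)"
      unfolding force_error_def by (subst Bochner_Integration.integral_diff) (auto simp: prob_space integrable_K)
    also have "norm \<dots> \<le> (\<integral>y. norm (K (x - y) - K (Y i - Y j)) \<partial>\<nu> j)" by (rule integral_norm_bound)
    also have "\<dots> \<le> (\<integral>y. (norm (x - Y i) + 2 * norm (y - Y j)) / b\<^sup>2
        + indicator {y. b \<le> norm (y - Y j)} y * (1 / norm (x - y)) \<partial>\<nu> j)"
      using pw by (intro integral_mono integrable_norm Bochner_Integration.integrable_diff integrable_K
          Bochner_Integration.integrable_add integrable_indicator_inverse_dist integrable_divide_zero integrable_mult_right
          integrable_spread[OF j]) auto
    also have "\<dots> = (\<integral>y. (norm (x - Y i) + 2 * norm (y - Y j)) / b\<^sup>2 \<partial>\<nu> j)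
        + (\<integral>y. indicator {y. b \<le> norm (y - Y j)} y * (1 / norm (x - y)) \<partial>\<nu> j)"
      using integrable_spread[OF j]
      by (intro Bochner_Integration.integral_add integrable_indicator_inverse_dist tail_set) auto
    also have "(\<integral>y. (norm (x - Y i) + 2 * norm (y - Y j)) / b\<^sup>2 \<partial>\<nu> j) = (norm (x - Y i) + 2 * spread j) / b\<^sup>2"
      using integrable_spread[OF j] by (simp add: prob_space)
    also have "(\<integral>y. indicator {y. b \<le> norm (y - Y j)} y * (1 / norm (x - y)) \<partial>\<nu> j) \<le> tail j / \<eta> + \<kappa>"
      by (rule integral_indicator_inverse_dist_le[OF tail_set])
    finally show ?thesis using False by simp
  qed
qed

definition cross_velocity :: "nat \<Rightarrow> real^2 \<Rightarrow> real^2" where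
  "cross_velocity i x = (\<Sum>j\<in>{1..N} - {i}. a j *\<^sub>R force_error i j x)"

lemma velocity_split:
  assumes "i \<in> {1..N}"
  shows "induced_velocity N a \<nu> x - vortex_velocity N a Y i
    = a i *\<^sub>R (\<integral>y. K (x - y) \<partial>\<nu> i) + cross_velocity i x"
  using assms unfolding induced_velocity_def vortex_velocity_def cross_velocity_def force_error_def
  by (subst sum.remove[of "{1..N}" i]) (auto simp: scaleR_diff_right sum_subtractf)

lemma measurable_cross [measurable]: "cross_velocity i \<in> borel_measurable borel"
proof -
  have "(\<lambda>x. \<integral>y. K (x - y) \<partial>\<nu> j) \<in> borel_measurable borel" if "j \<in> {1..N} - {i}" for j
    using that diffuse_cloud.measurable_velocity[OF cloud] by blast
  then show ?thesis unfolding cross_velocity_def[abs_def] force_error_def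
    by (intro borel_measurable_sum borel_measurable_scaleR borel_measurable_diff borel_measurable_const) auto
qed

lemma integrable_inner_bounded:
  assumes i: "i \<in> {1..N}" and [measurable]: "w \<in> borel_measurable borel" "f \<in> borel_measurable borel"
    and w: "\<And>x. \<bar>w x\<bar> \<le> c" and f: "\<And>x. norm (f x) \<le> B"
  shows "integrable (\<nu> i) (\<lambda>x. w x * ((x - Y i) \<bullet> f x))"
proof -
  interpret diffuse_cloud "\<nu> i" \<eta> \<kappa> using i by (rule cloud)
  show ?thesis
  proof (rule Bochner_Integration.integrable_bound)
    show "integrable (\<nu> i) (\<lambda>x. c * (norm (x - Y i) * B))" using integrable_spread[OF i] by simp
    have "0 \<le> c" "0 \<le> B" using order.trans[OF abs_ge_zero w] order.trans[OF norm_ge_zero f] by auto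
    then have "\<bar>w x * ((x - Y i) \<bullet> f x)\<bar> \<le> c * (norm (x - Y i) * B)" for x
      unfolding abs_mult
      by (intro mult_mono w order.trans[OF Cauchy_Schwarz_ineq2 mult_left_mono[OF f]]) auto
    then show "AE x in \<nu> i. norm (w x * ((x - Y i) \<bullet> f x)) \<le> norm (c * (norm (x - Y i) * B))"
      using \<open>0 \<le> c\<close> \<open>0 \<le> B\<close> by (simp add: abs_mult)
  qed measurable
qed

lemma cross_bounded: "\<exists>B. \<forall>x. norm (cross_velocity i x) \<le> B"
proof (intro exI allI)
  fix x
  show "norm (cross_velocity i x) \<le> (\<Sum>j\<in>{1..N} - {i}. \<bar>a j\<bar> * ((1 / \<eta> + \<kappa>) + norm (K (Y i - Y j))))"
    unfolding cross_velocity_def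
  proof (rule sum_norm_le)
    fix j assume "j \<in> {1..N} - {i}"
    then interpret diffuse_cloud "\<nu> j" \<eta> \<kappa> by (intro cloud) auto
    show "norm (a j *\<^sub>R force_error i j x) \<le> \<bar>a j\<bar> * ((1 / \<eta> + \<kappa>) + norm (K (Y i - Y j)))"
      unfolding norm_scaleR force_error_def
      by (intro mult_left_mono order.trans[OF norm_triangle_ineq4 add_mono] norm_velocity_le order.refl) auto
  qed
qed

text \<open>This is the rate of change of \<open>\<integral>\<psi> d\<nu> i\<close> for a radial \<open>\<psi>\<close> with \<open>\<nabla>\<psi> = w(x)(x - Y i)\<close>. It covers both the
  energy, with \<open>w = 2\<close>, and the mean of the exponential weight.\<close>

lemma weighted_split:
  assumes i: "i \<in> {1..N}" and [measurable]: "w \<in> borel_measurable borel" and w: "\<And>x. \<bar>w x\<bar> \<le> c"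
  shows "(\<integral>x. w x * ((x - Y i) \<bullet> (induced_velocity N a \<nu> x - vortex_velocity N a Y i)) \<partial>\<nu> i)
    = a i * ((\<integral>(x, y). (w x - w y) * ((x - Y i) \<bullet> K (x - y)) \<partial>(\<nu> i \<Otimes>\<^sub>M \<nu> i)) / 2)
      + (\<integral>x. w x * ((x - Y i) \<bullet> cross_velocity i x) \<partial>\<nu> i)"
proof -
  interpret diffuse_cloud "\<nu> i" \<eta> \<kappa> using i by (rule cloud)
  obtain B where B: "\<And>x. norm (cross_velocity i x) \<le> B" using cross_bounded by blast
  have 1: "integrable (\<nu> i) (\<lambda>x. w x * ((x - Y i) \<bullet> (\<integral>y. K (x - y) \<partial>\<nu> i)))"
    by (rule integrable_inner_bounded[OF i _ _ w norm_velocity_le]) measurable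
  have 2: "integrable (\<nu> i) (\<lambda>x. w x * ((x - Y i) \<bullet> cross_velocity i x))"
    by (rule integrable_inner_bounded[OF i _ _ w B]) measurable
  have 3: "integrable (\<nu> i) (\<lambda>x. w x * norm (x - Y i))"
  proof (rule Bochner_Integration.integrable_bound)
    show "integrable (\<nu> i) (\<lambda>x. c * norm (x - Y i))" using integrable_spread[OF i] by simp
    show "AE x in \<nu> i. norm (w x * norm (x - Y i)) \<le> norm (c * norm (x - Y i))"
      using w by (auto simp: abs_mult intro!: mult_right_mono order.trans[OF w])
  qed measurable
  have "(\<integral>x. w x * ((x - Y i) \<bullet> (induced_velocity N a \<nu> x - vortex_velocity N a Y i)) \<partial>\<nu> i)
    = (\<integral>x. a i * (w x * ((x - Y i) \<bullet> (\<integral>y. K (x - y) \<partial>\<nu> i))) + w x * ((x - Y i) \<bullet> cross_velocity i x) \<partial>\<nu> i)"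
    unfolding velocity_split[OF i] by (intro Bochner_Integration.integral_cong refl) (simp add: inner_add_right algebra_simps)
  also have "\<dots> = a i * (\<integral>x. w x * ((x - Y i) \<bullet> (\<integral>y. K (x - y) \<partial>\<nu> i)) \<partial>\<nu> i)
      + (\<integral>x. w x * ((x - Y i) \<bullet> cross_velocity i x) \<partial>\<nu> i)"
    using 1 2 by (subst Bochner_Integration.integral_add) auto
  finally show ?thesis using self_interaction(2)[OF _ 3] by simp
qed

lemma sum_abs_intensities:
  assumes "i \<in> {1..N}"
  shows "\<bar>a i\<bar> + (\<Sum>j\<in>{1..N} - {i}. \<bar>a j\<bar>) = (\<Sum>j\<in>{1..N}. \<bar>a j\<bar>)"
  using assms by (subst sum.remove[of "{1..N}" i "\<lambda>j. \<bar>a j\<bar>"]) auto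

text \<open>The self-interaction drops out, and a cross interaction compares the force between two particles
  with that between their vortices, which is a Lipschitz error unless a particle lies in a tail.\<close>

lemma energy_growth:
  assumes i: "i \<in> {1..N}" and tau: "\<And>j. j \<in> {1..N} \<Longrightarrow> tail j / \<eta> + \<kappa> \<le> \<tau>"
    and tail: "(1 / \<eta> + \<kappa> + 1 / b)\<^sup>2 * tail i \<le> \<tau>\<^sup>2"
  shows "(\<integral>x. 2 * ((x - Y i) \<bullet> (induced_velocity N a \<nu> x - vortex_velocity N a Y i)) \<partial>\<nu> i)
    \<le> (\<Sum>j\<in>{1..N}. \<bar>a j\<bar>) * ((6 / b\<^sup>2 + 2) * (\<Sum>j\<in>{1..N}. energy j) + 2 * \<tau>\<^sup>2)"
proof -
  interpret diffuse_cloud "\<nu> i" \<eta> \<kappa> using i by (rule cloud)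
  define V where "V = 1 / \<eta> + \<kappa> + 1 / b"
  define En where "En = (\<Sum>j\<in>{1..N}. energy j)"
  define S where "S j = spread j" for j
  have V: "V \<ge> 0" using eta_pos kappa_nonneg b_pos by (simp add: V_def)
  have tau0: "\<tau> \<ge> 0" using tau[OF i] eta_pos kappa_nonneg by (smt (verit) divide_nonneg_pos measure_nonneg)
  have En: "energy j \<le> En" if "j \<in> {1..N}" for j
    unfolding En_def by (rule member_le_sum) (use that in auto)
  have "0 \<le> En" unfolding En_def by (intro sum_nonneg) auto
  obtain B where B: "\<And>x. norm (cross_velocity i x) \<le> B" using cross_bounded by blast
  have one: "(\<integral>x. 2 * ((x - Y i) \<bullet> force_error i j x) \<partial>\<nu> i) * a j
      \<le> \<bar>a j\<bar> * ((6 / b\<^sup>2 + 2) * En + 2 * \<tau>\<^sup>2)" if j: "j \<in> {1..N} - {i}" for j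
  proof -
    interpret J: diffuse_cloud "\<nu> j" \<eta> \<kappa> using j by (intro cloud) auto
    let ?f = "\<lambda>x. 2 * ((x - Y i) \<bullet> force_error i j x)"
    have [measurable]: "force_error i j \<in> borel_measurable borel" unfolding force_error_def[abs_def] by measurable
    let ?g = "\<lambda>x. (4 / b\<^sup>2 + 2) * (norm (x - Y i))\<^sup>2 + (2 * (S j)\<^sup>2 / b\<^sup>2 + \<tau>\<^sup>2) + V\<^sup>2 * indicator {x. b \<le> norm (x - Y i)} x"
    have pw: "\<bar>?f x\<bar> \<le> ?g x" for x
    proof -
      define r where "r = norm (x - Y i)"
      define t where "t = (of_bool (b \<le> r) :: real)"
      have t: "t * t = t" by (simp add: t_def)
      have r: "0 \<le> r" by (simp add: r_def)
      have "norm (force_error i j x) \<le> (r + 2 * S j) / b\<^sup>2 + (tail j / \<eta> + \<kappa>) + t * V"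
        using force_error_le[OF i, of j x] j unfolding r_def t_def V_def S_def by auto
      also have "\<dots> \<le> (r + 2 * S j) / b\<^sup>2 + \<tau> + t * V" using tau[of j] j by simp
      finally have "\<bar>(x - Y i) \<bullet> force_error i j x\<bar> \<le> r * ((r + 2 * S j) / b\<^sup>2 + \<tau> + t * V)"
        unfolding r_def by (intro order.trans[OF Cauchy_Schwarz_ineq2 mult_left_mono]) auto
      then have "\<bar>?f x\<bar> \<le> 2 * (r * ((r + 2 * S j) / b\<^sup>2 + \<tau> + t * V))" by (simp add: abs_mult)
      also have "\<dots> = (2 * r\<^sup>2 + 4 * (r * S j)) / b\<^sup>2 + 2 * (r * \<tau>) + 2 * (r * (t * V))"
        by (simp add: algebra_simps power2_eq_square add_divide_distrib)
      also have "\<dots> \<le> (2 * r\<^sup>2 + 2 * (r\<^sup>2 + (S j)\<^sup>2)) / b\<^sup>2 + (r\<^sup>2 + \<tau>\<^sup>2) + (r\<^sup>2 + (t * V)\<^sup>2)"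
        using zero_le_power2[of "r - S j"] zero_le_power2[of "r - \<tau>"] zero_le_power2[of "r - t * V"]
        unfolding power2_diff by (intro add_mono divide_right_mono) auto
      also have "\<dots> = (4 / b\<^sup>2 + 2) * r\<^sup>2 + (2 * (S j)\<^sup>2 / b\<^sup>2 + \<tau>\<^sup>2) + V\<^sup>2 * t"
        using t by (simp add: algebra_simps power2_eq_square add_divide_distrib)
      finally show ?thesis by (simp add: r_def t_def indicator_def of_bool_def)
    qed
    have intg: "integrable (\<nu> i) ?g"
      using moment[OF i] by (intro Bochner_Integration.integrable_add integrable_mult_right integrable_const) 
         (auto simp: emeasure_eq_measure)
    have intf: "integrable (\<nu> i) ?f"
      using intg
    proof (rule Bochner_Integration.integrable_bound)
      show "AE x in \<nu> i. norm (?f x) \<le> norm (?g x)"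
        using pw by (intro AE_I2) (auto intro: order.trans[OF _ abs_ge_self])
    qed measurable
    have "\<bar>\<integral>x. ?f x \<partial>\<nu> i\<bar> \<le> (\<integral>x. \<bar>?f x\<bar> \<partial>\<nu> i)" by (rule integral_abs_bound)
    also have "\<dots> \<le> (\<integral>x. ?g x \<partial>\<nu> i)" using pw intf intg by (intro integral_mono integrable_abs) auto
    also have "\<dots> = (4 / b\<^sup>2 + 2) * energy i + (2 * (S j)\<^sup>2 / b\<^sup>2 + \<tau>\<^sup>2) + V\<^sup>2 * tail i"
      using moment[OF i] by (subst Bochner_Integration.integral_add, simp, simp add: emeasure_eq_measure,
          subst Bochner_Integration.integral_add) (auto simp: prob_space)
    also have "\<dots> \<le> (4 / b\<^sup>2 + 2) * En + (2 * En / b\<^sup>2 + \<tau>\<^sup>2) + \<tau>\<^sup>2"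
      using En[OF i] tail order.trans[OF spread_square_le[of j] En[of j]] j
      unfolding S_def V_def by (intro add_mono mult_left_mono divide_right_mono) auto
    also have "\<dots> = (6 / b\<^sup>2 + 2) * En + 2 * \<tau>\<^sup>2" by (simp add: algebra_simps)
    finally have "\<bar>\<integral>x. ?f x \<partial>\<nu> i\<bar> \<le> (6 / b\<^sup>2 + 2) * En + 2 * \<tau>\<^sup>2" .
    from mult_left_mono[OF this, of "\<bar>a j\<bar>"] show ?thesis
      using abs_ge_self[of "(\<integral>x. ?f x \<partial>\<nu> i) * a j"] by (simp add: abs_mult mult.commute)
  qed
  have intj: "integrable (\<nu> i) (\<lambda>x. 2 * ((x - Y i) \<bullet> force_error i j x))"
    if j: "j \<in> {1..N} - {i}" for j
  proof -
    interpret J: diffuse_cloud "\<nu> j" \<eta> \<kappa> using j by (intro cloud) auto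
    show ?thesis
      by (rule integrable_inner_bounded[OF i, where c=2 and B="(1 / \<eta> + \<kappa>) + norm (K (Y i - Y j))"])
        (auto simp: force_error_def intro!: order.trans[OF norm_triangle_ineq4 add_mono] J.norm_velocity_le)
  qed
  have "(\<integral>x. 2 * ((x - Y i) \<bullet> (induced_velocity N a \<nu> x - vortex_velocity N a Y i)) \<partial>\<nu> i)
    = (\<integral>x. 2 * ((x - Y i) \<bullet> cross_velocity i x) \<partial>\<nu> i)"
    by (subst weighted_split[OF i, where c=2]) (auto simp: split_beta')
  also have "\<dots> = (\<integral>x. (\<Sum>j\<in>{1..N} - {i}. 2 * ((x - Y i) \<bullet> force_error i j x) * a j) \<partial>\<nu> i)"
    unfolding cross_velocity_def by (simp add: inner_sum_right sum_distrib_left mult_ac)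
  also have "\<dots> = (\<Sum>j\<in>{1..N} - {i}. (\<integral>x. 2 * ((x - Y i) \<bullet> force_error i j x) \<partial>\<nu> i) * a j)"
    using intj by (subst Bochner_Integration.integral_sum) (auto intro!: integrable_mult_left simp del: mult_2)
  also have "\<dots> \<le> (\<Sum>j\<in>{1..N} - {i}. \<bar>a j\<bar> * ((6 / b\<^sup>2 + 2) * En + 2 * \<tau>\<^sup>2))"
    by (intro sum_mono one)
  also have "\<dots> = (\<Sum>j\<in>{1..N} - {i}. \<bar>a j\<bar>) * ((6 / b\<^sup>2 + 2) * En + 2 * \<tau>\<^sup>2)" by (rule sum_distrib_right[symmetric])
  also have "\<dots> \<le> (\<Sum>j\<in>{1..N}. \<bar>a j\<bar>) * ((6 / b\<^sup>2 + 2) * En + 2 * \<tau>\<^sup>2)"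
    using sum_abs_intensities[OF i] \<open>0 \<le> En\<close> by (intro mult_right_mono) auto
  finally show ?thesis by (simp add: En_def)
qed

text \<open>The exponential weight turns every contribution into a multiple of its own mean, so that the mass
  outside the disc stays exponentially small in \<open>\<beta>\<close> for a time independent of \<open>\<beta>\<close>.\<close>

lemma outer_growth:
  assumes i: "i \<in> {1..N}" and l: "\<beta> \<ge> 1" and tail: "\<And>j. j \<in> {1..N} \<Longrightarrow> tail j / \<eta> + \<kappa> \<le> 1"
  shows "(\<integral>x. outer_slope (Y i) b \<beta> x * ((x - Y i) \<bullet> (induced_velocity N a \<nu> x - vortex_velocity N a Y i)) \<partial>\<nu> i)
    \<le> (\<Sum>j\<in>{1..N}. \<bar>a j\<bar>) * (16 * \<beta>\<^sup>2 / b ^ 3 * spread i + 4 * \<beta> / b * (2 / b + 1))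
      * (\<integral>x. outer_weight (Y i) b \<beta> x \<partial>\<nu> i)"
proof -
  interpret diffuse_cloud "\<nu> i" \<eta> \<kappa> using i by (rule cloud)
  interpret P: pair_sigma_finite "\<nu> i" "\<nu> i" by unfold_locales
  define e where "e = outer_weight (Y i) b \<beta>"
  define w where "w = outer_slope (Y i) b \<beta>"
  define \<Phi> where "\<Phi> = (\<integral>x. e x \<partial>\<nu> i)"
  have [measurable]: "e \<in> borel_measurable borel" "w \<in> borel_measurable borel" by (simp_all add: e_def w_def)
  have e: "0 < e x" "e x \<le> 1" for x using outer_weight_bounds[where \<beta>=\<beta>] l by (auto simp: e_def)
  have inte: "integrable (\<nu> i) e"
    by (rule integrable_const_bound[of _ 1]) (use e in \<open>auto simp: less_imp_le\<close>)
  have Phi: "\<Phi> \<ge> 0" unfolding \<Phi>_def using e by (intro Bochner_Integration.integral_nonneg) (auto simp: less_imp_le)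
  have w: "0 \<le> w x" "w x \<le> 4 * \<beta> / b\<^sup>2" for x
  proof -
    show "0 \<le> w x" using l depth_bounds e unfolding w_def outer_slope_def e_def[symmetric]
      by (intro mult_nonneg_nonneg divide_nonneg_nonneg less_imp_le[OF e(1)]) auto
    have "depth (Y i) b x * e x \<le> 1 * 1" using depth_bounds e by (intro mult_mono) (auto simp: less_imp_le)
    then have "4 * \<beta> / b\<^sup>2 * (depth (Y i) b x * e x) \<le> 4 * \<beta> / b\<^sup>2 * 1" using l by (intro mult_left_mono) auto
    then show "w x \<le> 4 * \<beta> / b\<^sup>2" by (simp add: w_def outer_slope_def e_def mult.assoc)
  qed
  have wabs: "\<bar>w x\<bar> \<le> 4 * \<beta> / b\<^sup>2" for x using w[of x] by simp
  obtain B where B: "\<And>x. norm (cross_velocity i x) \<le> B" using cross_bounded by blast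
  \<comment> \<open>The bound for the symmetrized self-interaction is a sum of two products of a function of \<open>x\<close> and a function
    of \<open>y\<close>, each of which integrates to \<open>spread i * \<Phi>\<close>.\<close>
  let ?F = "\<lambda>(x, y). (w x - w y) * ((x - Y i) \<bullet> K (x - y))"
  let ?G = "\<lambda>(x, y). 16 * \<beta>\<^sup>2 / b ^ 3 * (norm (y - Y i) * e x + norm (x - Y i) * e y)"
  have g1: "integrable (\<nu> i \<Otimes>\<^sub>M \<nu> i) (\<lambda>(x, y). e x * norm (y - Y i))"
    using inte integrable_spread[OF i] e
    by (intro P.Fubini_integrable) (auto simp: abs_mult less_imp_le split_beta')
  have g2: "integrable (\<nu> i \<Otimes>\<^sub>M \<nu> i) (\<lambda>(x, y). norm (x - Y i) * e y)"
    using inte integrable_spread[OF i] e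
    by (intro P.Fubini_integrable) (auto simp: abs_mult less_imp_le split_beta')
  have G: "?G = (\<lambda>z. 16 * \<beta>\<^sup>2 / b ^ 3 * ((\<lambda>(x, y). e x * norm (y - Y i)) z + (\<lambda>(x, y). norm (x - Y i) * e y) z))"
    by (auto simp: mult.commute)
  have intG: "integrable (\<nu> i \<Otimes>\<^sub>M \<nu> i) ?G"
    unfolding G by (intro integrable_mult_right Bochner_Integration.integrable_add g1 g2)
  have "integral\<^sup>L (\<nu> i \<Otimes>\<^sub>M \<nu> i) ?G = 16 * \<beta>\<^sup>2 / b ^ 3 *
     (integral\<^sup>L (\<nu> i \<Otimes>\<^sub>M \<nu> i) (\<lambda>(x, y). e x * norm (y - Y i)) + integral\<^sup>L (\<nu> i \<Otimes>\<^sub>M \<nu> i) (\<lambda>(x, y). norm (x - Y i) * e y))"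
    unfolding G using g1 g2 by (subst integral_mult_right_zero, subst Bochner_Integration.integral_add) auto
  also have "\<dots> = 16 * \<beta>\<^sup>2 / b ^ 3 * (2 * (spread i * \<Phi>))"
    using P.integral_fst'[OF g1] P.integral_fst'[OF g2] by (simp add: \<Phi>_def mult.commute)
  finally have IG: "integral\<^sup>L (\<nu> i \<Otimes>\<^sub>M \<nu> i) ?G = 16 * \<beta>\<^sup>2 / b ^ 3 * (2 * (spread i * \<Phi>))" .
  have 3: "integrable (\<nu> i) (\<lambda>x. w x * norm (x - Y i))"
  proof (rule Bochner_Integration.integrable_bound)
    show "integrable (\<nu> i) (\<lambda>x. 4 * \<beta> / b\<^sup>2 * norm (x - Y i))" using integrable_spread[OF i] by simp
    show "AE x in \<nu> i. norm (w x * norm (x - Y i)) \<le> norm (4 * \<beta> / b\<^sup>2 * norm (x - Y i))"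
      using wabs l by (auto simp: abs_mult intro!: mult_right_mono simp del: times_divide_eq_left)
  qed measurable
  have "\<bar>integral\<^sup>L (\<nu> i \<Otimes>\<^sub>M \<nu> i) ?F\<bar> \<le> (\<integral>z. \<bar>?F z\<bar> \<partial>(\<nu> i \<Otimes>\<^sub>M \<nu> i))" by (rule integral_abs_bound)
  also have "\<dots> \<le> integral\<^sup>L (\<nu> i \<Otimes>\<^sub>M \<nu> i) ?G"
    using outer_slope_interaction_le[OF b_pos l, of "Y i"] unfolding w_def[symmetric] e_def[symmetric]
    by (intro integral_mono integrable_abs self_interaction(1) 3 intG) auto
  finally have "\<bar>integral\<^sup>L (\<nu> i \<Otimes>\<^sub>M \<nu> i) ?F / 2\<bar> \<le> 16 * \<beta>\<^sup>2 / b ^ 3 * spread i * \<Phi>" unfolding IG by simp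
  from mult_left_mono[OF this, of "\<bar>a i\<bar>"]
  have self: "a i * (integral\<^sup>L (\<nu> i \<Otimes>\<^sub>M \<nu> i) ?F / 2) \<le> \<bar>a i\<bar> * (16 * \<beta>\<^sup>2 / b ^ 3 * spread i * \<Phi>)"
    using abs_ge_self[of "a i * (integral\<^sup>L (\<nu> i \<Otimes>\<^sub>M \<nu> i) ?F / 2)"] by (simp add: abs_mult)
  \<comment> \<open>The slope vanishes outside the disc, and inside it the other clouds induce a bounded velocity.\<close>
  define A' where "A' = (\<Sum>j\<in>{1..N} - {i}. \<bar>a j\<bar>)"
  have A': "A' \<ge> 0" unfolding A'_def by (intro sum_nonneg) auto
  have pw: "w x * ((x - Y i) \<bullet> cross_velocity i x) \<le> A' * (4 * \<beta> / b * (2 / b + 1)) * e x" for x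
  proof (cases "norm (x - Y i) < b")
    case True
    have "norm (cross_velocity i x) \<le> (\<Sum>j\<in>{1..N} - {i}. \<bar>a j\<bar> * (2 / b + 1))"
      unfolding cross_velocity_def
    proof (rule sum_norm_le)
      fix j assume j: "j \<in> {1..N} - {i}"
      have "norm (\<integral>y. K (x - y) \<partial>\<nu> j) \<le> 1 / b + 1"
        using cross_velocity_le[OF i _ _ True, of j] tail[of j] j by force
      moreover have "norm (K (Y i - Y j)) \<le> 1 / b"
        using separated[OF i, of j] j b_pos by (intro norm_K_le_inverse) auto
      ultimately have "norm (force_error i j x) \<le> 2 / b + 1"
        using norm_triangle_ineq4[of "\<integral>y. K (x - y) \<partial>\<nu> j" "K (Y i - Y j)"] by (simp add: force_error_def field_simps)
      then show "norm (a j *\<^sub>R force_error i j x) \<le> \<bar>a j\<bar> * (2 / b + 1)"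
        unfolding norm_scaleR by (intro mult_left_mono) auto
    qed
    then have c: "norm (cross_velocity i x) \<le> A' * (2 / b + 1)" by (simp add: A'_def sum_distrib_right)
    have "(x - Y i) \<bullet> cross_velocity i x \<le> norm (x - Y i) * norm (cross_velocity i x)" by (rule norm_cauchy_schwarz)
    also have "\<dots> \<le> b * (A' * (2 / b + 1))" using True c b_pos by (intro mult_mono) auto
    finally have "(x - Y i) \<bullet> cross_velocity i x \<le> b * (A' * (2 / b + 1))" .
    then have "w x * ((x - Y i) \<bullet> cross_velocity i x) \<le> w x * (b * (A' * (2 / b + 1)))" using w by (intro mult_left_mono)
    also have "\<dots> \<le> (4 * \<beta> / b\<^sup>2 * e x) * (b * (A' * (2 / b + 1)))"
    proof (rule mult_right_mono)
      have "w x = 4 * \<beta> / b\<^sup>2 * e x * depth (Y i) b x" by (simp add: w_def outer_slope_def e_def)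
      also have "\<dots> \<le> 4 * \<beta> / b\<^sup>2 * e x * 1" using l e[of x] depth_bounds by (intro mult_left_mono) (auto simp: less_imp_le)
      finally show "w x \<le> 4 * \<beta> / b\<^sup>2 * e x" by simp
    qed (use b_pos A' in auto)
    also have "\<dots> = A' * (4 * \<beta> / b * (2 / b + 1)) * e x" using b_pos by (simp add: power2_eq_square mult_ac)
    finally show ?thesis .
  next
    case False
    then have "w x = 0" using depth_eq_0[OF b_pos, of x "Y i"] by (simp add: w_def outer_slope_def)
    then show ?thesis using A' l b_pos e[of x] by (auto intro!: mult_nonneg_nonneg less_imp_le[OF e(1)])
  qed
  have "(\<integral>x. w x * ((x - Y i) \<bullet> cross_velocity i x) \<partial>\<nu> i) \<le> (\<integral>x. A' * (4 * \<beta> / b * (2 / b + 1)) * e x \<partial>\<nu> i)"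
    by (intro integral_mono integrable_inner_bounded[OF i _ _ wabs B] integrable_mult_right inte pw) measurable
  also have "\<dots> = A' * (4 * \<beta> / b * (2 / b + 1) * \<Phi>)" by (simp add: \<Phi>_def)
  finally have cross: "(\<integral>x. w x * ((x - Y i) \<bullet> cross_velocity i x) \<partial>\<nu> i) \<le> A' * (4 * \<beta> / b * (2 / b + 1) * \<Phi>)" .
  have "(\<integral>x. w x * ((x - Y i) \<bullet> (induced_velocity N a \<nu> x - vortex_velocity N a Y i)) \<partial>\<nu> i)
      \<le> \<bar>a i\<bar> * (16 * \<beta>\<^sup>2 / b ^ 3 * spread i * \<Phi>) + A' * (4 * \<beta> / b * (2 / b + 1) * \<Phi>)"
    using self cross by (subst weighted_split[OF i _ wabs]) auto
  also have "\<dots> \<le> (\<bar>a i\<bar> + A') * (16 * \<beta>\<^sup>2 / b ^ 3 * spread i * \<Phi>) + (\<bar>a i\<bar> + A') * (4 * \<beta> / b * (2 / b + 1) * \<Phi>)"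
    using A' l b_pos Phi by (intro add_mono mult_right_mono mult_nonneg_nonneg) auto
  also have "\<dots> = (\<Sum>j\<in>{1..N}. \<bar>a j\<bar>) * (16 * \<beta>\<^sup>2 / b ^ 3 * spread i + 4 * \<beta> / b * (2 / b + 1)) * \<Phi>"
    using sum_abs_intensities[OF i] by (simp add: A'_def algebra_simps)
  finally show ?thesis by (simp add: w_def e_def \<Phi>_def)
qed

end

section \<open>Densities in \<open>L\<^sup>p\<close> with \<open>p > 2\<close> are diffuse\<close>

lemma dyadic_scale:
  fixes \<eta> r :: real
  assumes "0 < r" "r \<le> \<eta>"
  obtains k :: nat where "\<eta> / 2 ^ Suc k \<le> r" "r \<le> \<eta> / 2 ^ k"
proof -
  define k where "k = nat \<lfloor>log 2 (\<eta> / r)\<rfloor>"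
  have x: "\<eta> / r \<ge> 1" using assms by simp
  then have "log 2 (\<eta> / r) \<ge> 0" by simp
  then have k: "real k \<le> log 2 (\<eta> / r)" "log 2 (\<eta> / r) < real (Suc k)"
    unfolding k_def by linarith+
  have "2 powr real k \<le> \<eta> / r" using k(1) x by (simp add: le_log_iff)
  moreover have "\<eta> / r < 2 powr real (Suc k)" using k(2) x by (subst (asm) log_less_iff) auto
  ultimately show thesis using assms by (intro that[of k]) (simp_all add: powr_realpow field_simps del: of_nat_Suc)
qed

text \<open>Dyadic discs suffice to see that \<open>|z|\<^sup>-\<^sup>q\<close> is locally integrable in the plane for \<open>q < 2\<close>.\<close>

lemma nn_integral_inverse_dist_powr_le:
  fixes y :: "real^2"
  assumes q: "0 < q" "q < 2" and h: "\<eta> > 0"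
  shows "(\<integral>\<^sup>+z. ennreal (near_inverse \<eta> (y - z) powr q) \<partial>lborel)
    \<le> ennreal (pi * 2 powr q / (1 - 2 powr (q - 2)) * \<eta> powr (2 - q))"
proof -
  define c where "c k = (2 ^ Suc k / \<eta>) powr q" for k :: nat
  define r where "r = (2 :: real) powr (q - 2)"
  define C where "C = pi * 2 powr q * \<eta> powr (2 - q)"
  have r: "0 < r" "r < 1" using q powr_less_mono[of "q - 2" 0 2] by (auto simp: r_def)
  have pw: "ennreal (near_inverse \<eta> (y - z) powr q)
      \<le> (\<Sum>k. ennreal (c k) * indicator (cball y (\<eta> / 2 ^ k)) z)" for z
  proof (cases "y - z \<in> ball 0 \<eta> \<and> y \<noteq> z")
    case True
    then obtain k :: nat where k: "\<eta> / 2 ^ Suc k \<le> norm (y - z)" "norm (y - z) \<le> \<eta> / 2 ^ k"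
      using dyadic_scale[of "norm (y - z)" \<eta>] by auto
    have "1 / norm (y - z) \<le> 1 / (\<eta> / 2 ^ Suc k)"
      using True h by (intro divide_left_mono k mult_pos_pos) auto
    then have "(1 / norm (y - z)) powr q \<le> c k" unfolding c_def using q True h by (intro powr_mono2) auto
    then have "ennreal (near_inverse \<eta> (y - z) powr q)
        \<le> ennreal (c k) * indicator (cball y (\<eta> / 2 ^ k)) z"
      using True k by (simp add: near_inverse_def dist_norm ennreal_leI)
    also have "\<dots> \<le> (\<Sum>k. ennreal (c k) * indicator (cball y (\<eta> / 2 ^ k)) z)"
    proof -
      have "g k \<le> suminf g" for g :: "nat \<Rightarrow> ennreal"
        using sum_le_suminf[of g "{k}"] by (simp add: summableI)
      then show ?thesis .
    qed
    finally show ?thesis .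
  next
    case False
    then show ?thesis by (auto simp: near_inverse_def)
  qed
  have "(\<integral>\<^sup>+z. ennreal (near_inverse \<eta> (y - z) powr q) \<partial>lborel)
      \<le> (\<integral>\<^sup>+z. (\<Sum>k. ennreal (c k) * indicator (cball y (\<eta> / 2 ^ k)) z) \<partial>lborel)"
    by (intro nn_integral_mono pw)
  also have "\<dots> = (\<Sum>k. \<integral>\<^sup>+z. ennreal (c k) * indicator (cball y (\<eta> / 2 ^ k)) z \<partial>lborel)"
    by (intro nn_integral_suminf borel_measurable_times_ennreal borel_measurable_const
        borel_measurable_indicator) simp
  also have "\<dots> = (\<Sum>k. ennreal (C * r ^ k))"
  proof (intro arg_cong[where f=suminf] ext)
    fix k
    have "(\<integral>\<^sup>+z. ennreal (c k) * indicator (cball y (\<eta> / 2 ^ k)) z \<partial>lborel) = ennreal (c k) * ennreal (pi * (\<eta> / 2 ^ k)\<^sup>2)"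
      using h by (simp add: nn_integral_cmult_indicator emeasure_cball eval_unit_ball_vol)
    also have "\<dots> = ennreal (c k * (pi * (\<eta> / 2 ^ k)\<^sup>2))"
      by (simp add: ennreal_mult' c_def)
    also have "c k * (pi * (\<eta> / 2 ^ k)\<^sup>2) = C * r ^ k"
    proof -
      have 1: "c k = 2 powr q * (2 powr q) ^ k * \<eta> powr (- q)"
        unfolding c_def using h
        by (simp add: powr_divide powr_mult powr_minus_divide powr_power powr_realpow[symmetric] powr_powr mult_ac)
      have 2: "r ^ k = (2 powr q) ^ k / (2 ^ k)\<^sup>2"
      proof -
        have "(4 :: real) ^ k = (2 ^ k)\<^sup>2" by (simp add: power2_eq_square flip: power_mult_distrib)
        then show ?thesis by (simp add: r_def powr_diff power_divide)
      qed
      have 3: "\<eta> powr (2 - q) = \<eta>\<^sup>2 * \<eta> powr (- q)"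
        using h by (simp add: powr_diff powr_minus_divide)
      show ?thesis unfolding C_def 1 2 3 by (simp add: power_divide)
    qed
    finally show "(\<integral>\<^sup>+z. ennreal (c k) * indicator (cball y (\<eta> / 2 ^ k)) z \<partial>lborel) = ennreal (C * r ^ k)" .
  qed
  also have "\<dots> = ennreal (C * (1 / (1 - r)))"
  proof (rule suminf_ennreal_eq)
    show "0 \<le> C * r ^ k" for k using r by (simp add: C_def)
    show "(\<lambda>k. C * r ^ k) sums (C * (1 / (1 - r)))"
      using r by (intro sums_mult geometric_sums) auto
  qed
  finally show ?thesis by (simp add: C_def r_def)
qed

text \<open>Young's inequality is applied pointwise, to \<open>\<tau> f\<close> and \<open>near_inverse / \<tau>\<close>; the map \<open>S\<close> disappears from
  the second integral because it preserves Lebesgue measure.\<close>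

lemma near_potential_le:
  fixes f :: "real^2 \<Rightarrow> real" and S :: "real^2 \<Rightarrow> real^2"
  assumes p: "p > 2" and q: "q = p / (p - 1)" and h: "\<eta> > 0" and t: "\<tau> > 0" and P: "P \<ge> 0"
    and [measurable]: "f \<in> borel_measurable lborel" "S \<in> borel_measurable lborel"
    and f: "AE x in lborel. f x \<ge> 0"
    and fp: "(\<integral>\<^sup>+x. ennreal (f x powr p) \<partial>lborel) \<le> ennreal P"
    and S: "distr lborel lborel S = lborel"
  shows "(\<integral>\<^sup>+z. ennreal (f z) * ennreal (near_inverse \<eta> (y - S z)) \<partial>lborel)
    \<le> ennreal (\<tau> powr p * P + \<tau> powr (- q) * (pi * 2 powr q / (1 - 2 powr (q - 2)) * \<eta> powr (2 - q)))"
proof -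
  have q12: "1 < q" "q < 2" "1 / p + 1 / q = 1"
    using p by (auto simp: q divide_simps)
  define k where "k z = near_inverse \<eta> (y - z)" for z :: "real^2"
  have k: "k z \<ge> 0" for z by (simp add: k_def near_inverse_def)
  have [measurable]: "k \<in> borel_measurable borel" unfolding k_def[abs_def] by measurable
  define I where "I = pi * 2 powr q / (1 - 2 powr (q - 2)) * \<eta> powr (2 - q)"
  have I: "I \<ge> 0" unfolding I_def using powr_mono[of "q - 2" 0 2] q12 by (intro mult_nonneg_nonneg divide_nonneg_nonneg) auto
  have "AE z in lborel. ennreal (f z) * ennreal (k (S z))
      \<le> ennreal (\<tau> powr p) * ennreal (f z powr p) + ennreal (\<tau> powr (- q)) * ennreal (k (S z) powr q)"
    using f
  proof eventually_elim
    case (elim z)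
    have "(\<tau> * f z) * (k (S z) / \<tau>) \<le> (\<tau> * f z) powr p / p + (k (S z) / \<tau>) powr q / q"
      using p q12 t elim k by (intro Youngs_inequality) auto
    also have "\<dots> \<le> (\<tau> * f z) powr p / 1 + (k (S z) / \<tau>) powr q / 1"
      using p q12 by (intro add_mono divide_left_mono) auto
    also have "\<dots> = \<tau> powr p * f z powr p + \<tau> powr (- q) * k (S z) powr q"
      using t elim k by (simp add: powr_mult powr_divide powr_minus_divide)
    finally have "f z * k (S z) \<le> \<tau> powr p * f z powr p + \<tau> powr (- q) * k (S z) powr q" using t by simp
    then show ?case using elim k
      by (simp add: ennreal_mult'[symmetric] ennreal_plus[symmetric] ennreal_leI del: ennreal_plus)
  qed
  then have "(\<integral>\<^sup>+z. ennreal (f z) * ennreal (k (S z)) \<partial>lborel)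
      \<le> (\<integral>\<^sup>+z. ennreal (\<tau> powr p) * ennreal (f z powr p) + ennreal (\<tau> powr (- q)) * ennreal (k (S z) powr q) \<partial>lborel)"
    by (rule nn_integral_mono_AE)
  also have "\<dots> = ennreal (\<tau> powr p) * (\<integral>\<^sup>+z. ennreal (f z powr p) \<partial>lborel)
      + ennreal (\<tau> powr (- q)) * (\<integral>\<^sup>+z. ennreal (k (S z) powr q) \<partial>lborel)"
    by (simp add: nn_integral_add nn_integral_cmult)
  also have "(\<integral>\<^sup>+z. ennreal (k (S z) powr q) \<partial>lborel) = (\<integral>\<^sup>+z. ennreal (k z powr q) \<partial>distr lborel lborel S)"
    by (subst nn_integral_distr) auto
  also have "\<dots> \<le> ennreal I"
    unfolding S k_def I_def using q12 h by (intro nn_integral_inverse_dist_powr_le) auto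
  also have "ennreal (\<tau> powr p) * (\<integral>\<^sup>+z. ennreal (f z powr p) \<partial>lborel) \<le> ennreal (\<tau> powr p) * ennreal P"
    by (intro mult_left_mono fp) auto
  also have "ennreal (\<tau> powr p) * ennreal P + ennreal (\<tau> powr (- q)) * ennreal I = ennreal (\<tau> powr p * P + \<tau> powr (- q) * I)"
    using P I by (simp add: ennreal_mult'[symmetric])
  finally show ?thesis by (simp add: k_def I_def add_left_mono mult_left_mono)
qed

text \<open>With \<open>\<parallel>f\<parallel>\<^sub>p \<le> M\<epsilon>\<^sup>-\<^sup>\<gamma>\<close>, interactions below the scale \<open>\<epsilon>\<^sup>\<alpha>\<close> are of order \<open>\<epsilon>\<close> if \<open>\<alpha>\<close> is large.\<close>

lemma transported_density_diffuse:
  fixes p \<gamma> M :: real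
  assumes p: "p > 2" and g: "\<gamma> > 0" and M: "M > 0"
  obtains \<alpha> C where "\<alpha> > 0" "C > 0"
    "\<And>\<epsilon> (f :: real^2 \<Rightarrow> real) (S :: real^2 \<Rightarrow> real^2). 0 < \<epsilon> \<Longrightarrow> \<epsilon> \<le> 1 \<Longrightarrow> f \<in> borel_measurable lborel \<Longrightarrow> AE x in lborel. f x \<ge> 0 \<Longrightarrow>
       (\<integral>\<^sup>+x. ennreal (f x) \<partial>lborel) = 1 \<Longrightarrow>
       (\<integral>\<^sup>+x. ennreal (f x powr p) \<partial>lborel) \<le> ennreal ((M * \<epsilon> powr - \<gamma>) powr p) \<Longrightarrow>
       S \<in> borel_measurable lborel \<Longrightarrow> distr lborel lborel S = lborel \<Longrightarrow>
       diffuse_cloud (distr (density lborel (\<lambda>x. ennreal (f x))) borel S) (\<epsilon> powr \<alpha>) (C * \<epsilon>)"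
proof -
  define q where "q = p / (p - 1)"
  have q12: "1 < q" "q < 2" using p by (auto simp: q_def divide_simps)
  define I where "I = pi * 2 powr q / (1 - 2 powr (q - 2))"
  have I: "I > 0" unfolding I_def using powr_less_mono[of "q - 2" 0 2] q12 by (intro mult_pos_pos divide_pos_pos) auto
  \<comment> \<open>With \<open>\<tau> = \<epsilon>\<^sup>\<gamma>\<^sup>+\<^sup>1\<close> in Young's inequality, this makes \<open>\<tau>\<^sup>-\<^sup>q \<epsilon>\<^sup>\<alpha>\<^sup>(\<^sup>2\<^sup>-\<^sup>q\<^sup>)\<close> equal to \<open>\<epsilon>\<close>.\<close>
  define \<alpha> where "\<alpha> = (1 + q * (\<gamma> + 1)) / (2 - q)"
  have al: "\<alpha> > 0" "\<alpha> * (2 - q) = 1 + q * (\<gamma> + 1)" using q12 g by (auto simp: \<alpha>_def intro!: divide_pos_pos add_pos_pos)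
  define C where "C = M powr p + I"
  show thesis
  proof (rule that[OF al(1), of C])
    show "C > 0" using I M by (simp add: C_def add_pos_pos)
    fix \<epsilon> :: real and f :: "real^2 \<Rightarrow> real" and S :: "real^2 \<Rightarrow> real^2"
    assume e: "0 < \<epsilon>" "\<epsilon> \<le> 1" and [measurable]: "f \<in> borel_measurable lborel" and f0: "AE x in lborel. f x \<ge> 0"
      and f1: "(\<integral>\<^sup>+x. ennreal (f x) \<partial>lborel) = 1"
      and fp: "(\<integral>\<^sup>+x. ennreal (f x powr p) \<partial>lborel) \<le> ennreal ((M * \<epsilon> powr - \<gamma>) powr p)"
      and [measurable]: "S \<in> borel_measurable lborel" and S: "distr lborel lborel S = lborel"
    let ?\<mu> = "density lborel (\<lambda>x. ennreal (f x))"
    have "prob_space ?\<mu>" by (rule prob_spaceI) (simp add: emeasure_density f1)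
    then interpret prob_space ?\<mu> .
    have "prob_space (distr ?\<mu> borel S)" by (rule prob_space_distr) simp
    moreover have "(\<integral>\<^sup>+z. ennreal (near_inverse (\<epsilon> powr \<alpha>) (y - z)) \<partial>distr ?\<mu> borel S) \<le> ennreal (C * \<epsilon>)" for y
    proof -
      have "(\<integral>\<^sup>+z. ennreal (near_inverse (\<epsilon> powr \<alpha>) (y - z)) \<partial>distr ?\<mu> borel S)
        = (\<integral>\<^sup>+z. ennreal (near_inverse (\<epsilon> powr \<alpha>) (y - S z)) \<partial>?\<mu>)"
        by (subst nn_integral_distr) simp_all
      also have "\<dots> = (\<integral>\<^sup>+z. ennreal (f z) * ennreal (near_inverse (\<epsilon> powr \<alpha>) (y - S z)) \<partial>lborel)"
        by (subst nn_integral_density) simp_all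
      also have "\<dots> \<le> ennreal ((\<epsilon> powr (\<gamma> + 1)) powr p * (M * \<epsilon> powr - \<gamma>) powr p
          + (\<epsilon> powr (\<gamma> + 1)) powr (- q) * (I * (\<epsilon> powr \<alpha>) powr (2 - q)))"
        unfolding I_def by (rule near_potential_le[OF p q_def]) (use e f0 fp S in auto)
      also have "(\<epsilon> powr (\<gamma> + 1)) powr p * (M * \<epsilon> powr - \<gamma>) powr p = M powr p * \<epsilon> powr p"
        using e M by (simp add: powr_mult[symmetric] powr_add powr_minus) (simp add: field_simps)
      also have "(\<epsilon> powr (\<gamma> + 1)) powr (- q) * (I * (\<epsilon> powr \<alpha>) powr (2 - q)) = I * \<epsilon>"
      proof -
        have "(\<epsilon> powr (\<gamma> + 1)) powr (- q) * (\<epsilon> powr \<alpha>) powr (2 - q) = \<epsilon> powr ((\<gamma> + 1) * (- q) + \<alpha> * (2 - q))"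
          by (simp only: powr_powr powr_add[of \<epsilon> "(\<gamma> + 1) * (- q)"])
        also have "(\<gamma> + 1) * (- q) + \<alpha> * (2 - q) = 1" unfolding al(2) by (simp add: algebra_simps)
        finally show ?thesis using e by (simp add: mult_ac)
      qed
      also have "ennreal (M powr p * \<epsilon> powr p + I * \<epsilon>) \<le> ennreal (C * \<epsilon>)"
      proof (rule ennreal_leI)
        have "\<epsilon> powr p \<le> \<epsilon> powr 1" using e p by (intro powr_mono') auto
        then have "M powr p * \<epsilon> powr p \<le> M powr p * \<epsilon>" using e by (intro mult_left_mono) auto
        then show "M powr p * \<epsilon> powr p + I * \<epsilon> \<le> C * \<epsilon>" by (simp add: C_def distrib_right)
      qed
      finally show ?thesis .
    qed
    ultimately show "diffuse_cloud (distr ?\<mu> borel S) (\<epsilon> powr \<alpha>) (C * \<epsilon>)"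
      using e I M by (intro diffuse_cloud.intro diffuse_cloud_axioms.intro) (auto simp: C_def)
  qed
qed

section \<open>Clouds transported by their own flow\<close>

lemma (in diffuse_cloud) norm_velocity_reg_diff_le:
  "norm ((\<integral>z. K (y - z) \<partial>\<nu>) - (\<integral>z. K_reg \<eta> (y - z) \<partial>\<nu>)) \<le> \<kappa>"
proof -
  have [measurable]: "K_reg \<eta> \<in> borel_measurable borel" using eta_pos by (rule measurable_K_reg)
  have reg: "integrable \<nu> (\<lambda>z. K_reg \<eta> (y - z))"
    by (rule integrable_const_bound[of _ "1 / (2 * pi * \<eta>)"]) (auto intro!: norm_K_reg_le eta_pos)
  have ind: "integrable \<nu> (\<lambda>z. near_inverse \<eta> (y - z))"
    using integrable_inverse_dist[of y]
    by (rule Bochner_Integration.integrable_bound) (auto simp: near_inverse_def indicator_def)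
  have "norm ((\<integral>z. K (y - z) \<partial>\<nu>) - (\<integral>z. K_reg \<eta> (y - z) \<partial>\<nu>)) = norm (\<integral>z. K (y - z) - K_reg \<eta> (y - z) \<partial>\<nu>)"
    using reg integrable_K by (subst Bochner_Integration.integral_diff) auto
  also have "\<dots> \<le> (\<integral>z. norm (K (y - z) - K_reg \<eta> (y - z)) \<partial>\<nu>)" by (rule integral_norm_bound)
  also have "\<dots> \<le> (\<integral>z. near_inverse \<eta> (y - z) \<partial>\<nu>)"
    using norm_K_diff_K_reg_le[OF eta_pos]
    by (intro integral_mono integrable_norm Bochner_Integration.integrable_diff reg integrable_K ind) auto
  also have "\<dots> \<le> \<kappa>" using kappa_nonneg near by (rule integral_real_bounded)
  finally show ?thesis .
qed

lemma has_real_derivative_integral: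
  fixes H :: "real \<Rightarrow> 'a \<Rightarrow> real"
  assumes "prob_space M"
    and [measurable]: "\<And>t. t \<in> {0..T} \<Longrightarrow> H t \<in> borel_measurable M" "\<And>t. t \<in> {0..T} \<Longrightarrow> H' t \<in> borel_measurable M"
    and der: "AE x in M. \<forall>t\<in>{0..T}. ((\<lambda>t. H t x) has_real_derivative H' t x) (at t within {0..T})"
    and bound: "AE x in M. \<forall>t\<in>{0..T}. \<bar>H' t x\<bar> \<le> B"
    and init: "AE x in M. \<forall>t\<in>{0..T}. \<bar>H t x\<bar> \<le> B0"
    and t: "t \<in> {0..T}"
  shows "((\<lambda>t. \<integral>x. H t x \<partial>M) has_real_derivative (\<integral>x. H' t x \<partial>M)) (at t within {0..T})"
proof -
  interpret prob_space M by fact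
  have int: "integrable M (H s)" if "s \<in> {0..T}" for s
    by (rule integrable_const_bound[of _ B0]) (use init that in \<open>auto elim!: eventually_mono\<close>)
  show ?thesis
    unfolding has_field_derivative_iff tendsto_at_iff_sequentially
  proof (intro allI impI)
    fix S assume S: "\<forall>n. S n \<in> {0..T} - {t}" "S \<longlonglongrightarrow> t"
    then have Sn: "S n \<in> {0..T}" "S n \<noteq> t" for n by auto
    have "(\<lambda>n. \<integral>x. (H (S n) x - H t x) / (S n - t) \<partial>M) \<longlonglongrightarrow> (\<integral>x. H' t x \<partial>M)"
    proof (rule integral_dominated_convergence[where w="\<lambda>_. B"])
      show "AE x in M. (\<lambda>n. (H (S n) x - H t x) / (S n - t)) \<longlonglongrightarrow> H' t x"
        using der
      proof eventually_elim
        case (elim x)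
        then have "((\<lambda>y. (H y x - H t x) / (y - t)) \<longlongrightarrow> H' t x) (at t within {0..T})"
          using t unfolding has_field_derivative_iff by blast
        then show ?case using S unfolding tendsto_at_iff_sequentially comp_def by blast
      qed
      show "AE x in M. norm ((H (S n) x - H t x) / (S n - t)) \<le> B" for n
        using der bound
      proof eventually_elim
        case (elim x)
        have "norm (H (S n) x - H t x) \<le> B * norm (S n - t)"
          by (rule field_differentiable_bound[of "{0..T}" "\<lambda>t. H t x" "\<lambda>t. H' t x"]) (use elim t Sn in auto)
        then show ?case using Sn[of n] by (simp add: divide_le_eq)
      qed
    qed (use Sn t in auto)
    moreover have "(\<integral>x. (H (S n) x - H t x) / (S n - t) \<partial>M) = ((\<integral>x. H (S n) x \<partial>M) - (\<integral>x. H t x \<partial>M)) / (S n - t)" for n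
      using int t Sn by simp
    ultimately show "((\<lambda>s. ((\<integral>x. H s x \<partial>M) - (\<integral>x. H t x \<partial>M)) / (s - t)) \<circ> S) \<longlonglongrightarrow> (\<integral>x. H' t x \<partial>M)"
      by (simp only: comp_def)
  qed
qed

locale lagrangian_clouds =
  fixes N :: nat and a :: "nat \<Rightarrow> real" and \<mu> :: "nat \<Rightarrow> (real^2) measure" and X :: "real \<Rightarrow> real^2 \<Rightarrow> real^2"
  assumes prob: "i \<in> {1..N} \<Longrightarrow> prob_space (\<mu> i)"
    and sets_mu: "i \<in> {1..N} \<Longrightarrow> sets (\<mu> i) = sets borel"
    and X_measurable: "t \<ge> 0 \<Longrightarrow> X t \<in> borel_measurable borel"
    and small_scales: "\<kappa> > 0 \<Longrightarrow> \<exists>\<eta>. \<forall>i\<in>{1..N}. \<forall>t\<ge>0. diffuse_cloud (distr (\<mu> i) borel (X t)) \<eta> \<kappa>"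
    and trajectories: "i \<in> {1..N} \<Longrightarrow> AE x in \<mu> i. \<forall>t\<ge>0.
      (\<lambda>s. induced_velocity N a (\<lambda>j. distr (\<mu> j) borel (X s)) (X s x)) absolutely_integrable_on {0..t} \<and>
      X t x = x + integral {0..t} (\<lambda>s. induced_velocity N a (\<lambda>j. distr (\<mu> j) borel (X s)) (X s x))"
begin

abbreviation law :: "real \<Rightarrow> nat \<Rightarrow> (real^2) measure" where
  "law t j \<equiv> distr (\<mu> j) borel (X t)"

abbreviation velocity :: "real \<Rightarrow> real^2 \<Rightarrow> real^2" where
  "velocity t \<equiv> induced_velocity N a (law t)"

definition trajectory :: "real^2 \<Rightarrow> bool" where
  "trajectory x \<longleftrightarrow> (\<forall>t\<ge>0. (\<lambda>s. velocity s (X s x)) absolutely_integrable_on {0..t} \<and>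
      X t x = x + integral {0..t} (\<lambda>s. velocity s (X s x)))"

lemma AE_trajectory: "i \<in> {1..N} \<Longrightarrow> AE x in \<mu> i. trajectory x"
  unfolding trajectory_def by (rule trajectories)

lemma X_measurable_mu: "i \<in> {1..N} \<Longrightarrow> t \<ge> 0 \<Longrightarrow> X t \<in> \<mu> i \<rightarrow>\<^sub>M borel"
  using X_measurable measurable_cong_sets[OF sets_mu refl] by blast

lemma trajectory_start: "trajectory x \<Longrightarrow> X 0 x = x"
  unfolding trajectory_def by force

lemma trajectory_continuous:
  assumes "trajectory x"
  shows "continuous_on {0..T} (\<lambda>t. X t x)"
proof (cases "T \<ge> 0")
  case True
  have "continuous_on {0..T} (\<lambda>t. x + integral {0..t} (\<lambda>s. velocity s (X s x)))"
    using assms True unfolding trajectory_def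
    by (intro continuous_intros indefinite_integral_continuous_1 set_lebesgue_integral_eq_integral(1)) auto
  then show ?thesis
    by (rule continuous_on_eq) (use assms in \<open>auto simp: trajectory_def\<close>)
qed simp

text \<open>Particles passing close to the trajectory contribute little, uniformly in time, so the velocity
  along the trajectory is a uniform limit of velocities induced by regularized kernels. Continuity makes
  the trajectory continuously differentiable, although the velocity field itself need not be
  Lipschitz.\<close>

lemma velocity_continuous:
  assumes x: "trajectory x"
  shows "continuous_on {0..T} (\<lambda>s. velocity s (X s x))"
proof -
  have "\<forall>n. \<exists>\<eta>. \<forall>i\<in>{1..N}. \<forall>t\<ge>0. diffuse_cloud (law t i) \<eta> (1 / real (Suc n))"
    using small_scales by simp
  then obtain h where h: "\<And>n i t. i \<in> {1..N} \<Longrightarrow> t \<ge> 0 \<Longrightarrow> diffuse_cloud (law t i) (h n) (1 / real (Suc n))"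
    by metis
  have "continuous_on {0..T} (\<lambda>s. \<integral>z. K (X s x - z) \<partial>law s j)" if j: "j \<in> {1..N}" for j
  proof (rule uniform_limit_theorem[where f="\<lambda>n s. \<integral>z. K_reg (h n) (X s x - z) \<partial>law s j" and F=sequentially])
    interpret M: prob_space "\<mu> j" using j by (rule prob)
    have hpos: "h n > 0" for n using h[of j 0 n] j by (simp add: diffuse_cloud_def diffuse_cloud_axioms_def)
    show "\<forall>\<^sub>F n in sequentially. continuous_on {0..T} (\<lambda>s. \<integral>z. K_reg (h n) (X s x - z) \<partial>law s j)"
    proof (rule always_eventually, rule allI)
      fix n
      have [measurable]: "K_reg (h n) \<in> borel_measurable borel" using hpos by (rule measurable_K_reg)
      have eq: "(\<integral>z. K_reg (h n) (X s x - z) \<partial>law s j) = (\<integral>z. K_reg (h n) (X s x - X s z) \<partial>\<mu> j)" if "s \<ge> 0" for s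
        using X_measurable_mu[OF j that] by (subst integral_distr) auto
      have "continuous_on {0..T} (\<lambda>s. \<integral>z. K_reg (h n) (X s x - X s z) \<partial>\<mu> j)"
        unfolding continuous_on_sequentially
      proof (intro allI ballI impI, elim conjE)
        fix S s assume s: "s \<in> {0..T}" and S: "\<forall>n. S n \<in> {0..T}" "S \<longlonglongrightarrow> s"
        have [measurable]: "X s \<in> \<mu> j \<rightarrow>\<^sub>M borel" "\<And>m. X (S m) \<in> \<mu> j \<rightarrow>\<^sub>M borel"
          using s S by (auto intro!: X_measurable_mu j)
        have conv: "(\<lambda>m. X (S m) z) \<longlonglongrightarrow> X s z" if "trajectory z" for z
          using trajectory_continuous[OF that, of T] s S unfolding continuous_on_sequentially comp_def by blast
        have "(\<lambda>m. \<integral>z. K_reg (h n) (X (S m) x - X (S m) z) \<partial>\<mu> j) \<longlonglongrightarrow> (\<integral>z. K_reg (h n) (X s x - X s z) \<partial>\<mu> j)"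
        proof (rule integral_dominated_convergence[where w="\<lambda>_. 1 / (2 * pi * h n)"])
          show "AE z in \<mu> j. (\<lambda>m. K_reg (h n) (X (S m) x - X (S m) z)) \<longlonglongrightarrow> K_reg (h n) (X s x - X s z)"
            using AE_trajectory[OF j]
          proof eventually_elim
            case (elim z)
            have "continuous_on UNIV (K_reg (h n))" using continuous_on_K_reg[OF hpos continuous_on_id] by simp
            then show ?case
              by (rule continuous_on_tendsto_compose) (auto intro!: tendsto_diff conv x elim)
          qed
          show "AE z in \<mu> j. norm (K_reg (h n) (X (S m) x - X (S m) z)) \<le> 1 / (2 * pi * h n)" for m
            using norm_K_reg_le[OF hpos] by auto
        qed (auto simp: M.emeasure_space_1)
        then show "((\<lambda>s. \<integral>z. K_reg (h n) (X s x - X s z) \<partial>\<mu> j) \<circ> S) \<longlonglongrightarrow> (\<integral>z. K_reg (h n) (X s x - X s z) \<partial>\<mu> j)"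
          by (simp add: comp_def)
      qed
      then show "continuous_on {0..T} (\<lambda>s. \<integral>z. K_reg (h n) (X s x - z) \<partial>law s j)"
        by (rule continuous_on_eq) (use eq in auto)
    qed
    show "uniform_limit {0..T} (\<lambda>n s. \<integral>z. K_reg (h n) (X s x - z) \<partial>law s j) (\<lambda>s. \<integral>z. K (X s x - z) \<partial>law s j) sequentially"
    proof (rule uniform_limitI)
      fix e :: real assume "e > 0"
      have "(\<lambda>n. 1 / real (Suc n)) \<longlonglongrightarrow> 0" by (rule LIMSEQ_Suc[OF lim_1_over_n])
      then have "\<forall>\<^sub>F n in sequentially. 1 / real (Suc n) < e" using \<open>e > 0\<close> by (rule order_tendstoD)
      then show "\<forall>\<^sub>F n in sequentially. \<forall>s\<in>{0..T}.
          dist (\<integral>z. K_reg (h n) (X s x - z) \<partial>law s j) (\<integral>z. K (X s x - z) \<partial>law s j) < e"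
      proof eventually_elim
        case (elim n)
        show ?case
        proof
          fix s assume "s \<in> {0..T}"
          then show "dist (\<integral>z. K_reg (h n) (X s x - z) \<partial>law s j) (\<integral>z. K (X s x - z) \<partial>law s j) < e"
            using diffuse_cloud.norm_velocity_reg_diff_le[OF h[OF j, of s n], of "X s x"] elim
            by (simp add: dist_norm norm_minus_commute)
        qed
      qed
    qed
  qed simp
  then show ?thesis unfolding induced_velocity_def by (intro continuous_intros) auto
qed

lemma trajectory_derivative:
  assumes x: "trajectory x" and t: "t \<in> {0..T}"
  shows "((\<lambda>t. X t x) has_vector_derivative velocity t (X t x)) (at t within {0..T})"
proof -
  have "((\<lambda>t. integral {0..t} (\<lambda>s. velocity s (X s x))) has_vector_derivative velocity t (X t x)) (at t within {0..T})"
    by (rule integral_has_vector_derivative[OF velocity_continuous[OF x] t])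
  then have "((\<lambda>t. x + integral {0..t} (\<lambda>s. velocity s (X s x))) has_vector_derivative velocity t (X t x)) (at t within {0..T})"
    by (auto intro!: derivative_eq_intros)
  then show ?thesis
    by (rule has_vector_derivative_transform[rotated 2]) (use x t in \<open>auto simp: trajectory_def\<close>)
qed

lemma measurable_flow_velocity: "t \<ge> 0 \<Longrightarrow> velocity t \<in> borel_measurable borel"
proof -
  assume t: "t \<ge> 0"
  obtain \<eta> where h: "\<forall>i\<in>{1..N}. \<forall>t\<ge>0. diffuse_cloud (law t i) \<eta> 1" using small_scales[of 1] by auto
  show ?thesis
    unfolding induced_velocity_def[abs_def] using h t
    by (intro borel_measurable_sum borel_measurable_scaleR borel_measurable_const diffuse_cloud.measurable_velocity) auto
qed

lemma velocity_bounded: obtains B where "\<And>t y. t \<ge> 0 \<Longrightarrow> norm (velocity t y) \<le> B"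
proof -
  obtain \<eta> where h: "\<forall>i\<in>{1..N}. \<forall>t\<ge>0. diffuse_cloud (law t i) \<eta> 1" using small_scales[of 1] by auto
  show thesis
  proof (rule that[of "\<Sum>j\<in>{1..N}. \<bar>a j\<bar> * (1 / \<eta> + 1)"])
    fix t :: real and y assume t: "t \<ge> 0"
    show "norm (velocity t y) \<le> (\<Sum>j\<in>{1..N}. \<bar>a j\<bar> * (1 / \<eta> + 1))"
      unfolding induced_velocity_def
    proof (rule sum_norm_le)
      fix j assume "j \<in> {1..N}"
      then have "norm (\<integral>z. K (y - z) \<partial>law t j) \<le> 1 / \<eta> + 1"
        using h t by (intro diffuse_cloud.norm_velocity_le) auto
      then show "norm (a j *\<^sub>R (\<integral>z. K (y - z) \<partial>law t j)) \<le> \<bar>a j\<bar> * (1 / \<eta> + 1)"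
        unfolding norm_scaleR by (intro mult_left_mono) auto
    qed
  qed
qed

end

text \<open>The clouds are now compared with a point vortex solution whose vortices stay \<open>4 b\<close> apart.\<close>

locale clouds_near_vortices = lagrangian_clouds +
  fixes Ybar :: "nat \<Rightarrow> real^2" and Y :: "nat \<Rightarrow> real \<Rightarrow> real^2" and T b R0 :: real
  assumes sol: "point_vortex_solution N a Ybar T Y" and T: "T \<ge> 0" and b_pos: "b > 0"
    and sep: "t \<in> {0..T} \<Longrightarrow> i \<in> {1..N} \<Longrightarrow> j \<in> {1..N} \<Longrightarrow> i \<noteq> j \<Longrightarrow> 4 * b \<le> norm (Y i t - Y j t)"
    and start: "i \<in> {1..N} \<Longrightarrow> AE x in \<mu> i. norm (x - Ybar i) \<le> R0"
begin

abbreviation vortex_speed :: "real \<Rightarrow> nat \<Rightarrow> real^2" where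
  "vortex_speed t i \<equiv> vortex_velocity N a (\<lambda>j. Y j t) i"

lemma vortex_derivative:
  assumes "i \<in> {1..N}" "t \<in> {0..T}"
  shows "(Y i has_vector_derivative vortex_speed t i) (at t within {0..T})"
  using sol assms by (simp add: point_vortex_solution_def vortex_velocity_def)

lemma vortex_start: "i \<in> {1..N} \<Longrightarrow> Y i 0 = Ybar i"
  using sol by (simp add: point_vortex_solution_def)

lemma vortex_speed_le:
  assumes "i \<in> {1..N}" "t \<in> {0..T}"
  shows "norm (vortex_speed t i) \<le> (\<Sum>j\<in>{1..N} - {i}. \<bar>a j\<bar> * (1 / b))"
  unfolding vortex_velocity_def
proof (rule sum_norm_le)
  fix j assume j: "j \<in> {1..N} - {i}"
  have "norm (K (Y i t - Y j t)) \<le> 1 / b"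
    using sep[of t i j] assms j b_pos by (intro norm_K_le_inverse) auto
  then show "norm (a j *\<^sub>R K (Y i t - Y j t)) \<le> \<bar>a j\<bar> * (1 / b)"
    unfolding norm_scaleR by (intro mult_left_mono) auto
qed

lemma relative_motion_bounded:
  assumes i: "i \<in> {1..N}"
  obtains M W where "AE x in \<mu> i. \<forall>t\<in>{0..T}. norm (X t x - Y i t) \<le> M"
    "\<And>t x. t \<in> {0..T} \<Longrightarrow> norm (velocity t (X t x) - vortex_speed t i) \<le> W"
proof -
  obtain B where B: "\<And>t y. t \<ge> 0 \<Longrightarrow> norm (velocity t y) \<le> B" by (rule velocity_bounded) blast
  define W where "W = B + (\<Sum>j\<in>{1..N} - {i}. \<bar>a j\<bar> * (1 / b))"
  have W: "norm (velocity t y - vortex_speed t i) \<le> W" if "t \<in> {0..T}" for t y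
    using norm_triangle_ineq4[of "velocity t y" "vortex_speed t i"] B[of t y] vortex_speed_le[OF i that] that
    unfolding W_def by auto
  have W0: "W \<ge> 0" using order.trans[OF norm_ge_zero W[of 0]] T by auto
  have "AE x in \<mu> i. \<forall>t\<in>{0..T}. norm (X t x - Y i t) \<le> R0 + W * T"
    using AE_trajectory[OF i] start[OF i]
  proof eventually_elim
    case (elim x)
    show ?case
    proof
      fix t assume t: "t \<in> {0..T}"
      have "norm ((X t x - Y i t) - (X 0 x - Y i 0)) \<le> W * t"
      proof (rule displacement_le)
        show "((\<lambda>t. X t x - Y i t) has_vector_derivative velocity s (X s x) - vortex_speed s i) (at s within {0..T})"
          if "s \<in> {0..t}" for s
          using that t by (intro has_vector_derivative_diff trajectory_derivative vortex_derivative elim i) auto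
      qed (use t W in auto)
      also have "W * t \<le> W * T" using t W0 by (intro mult_left_mono) auto
      finally have "norm ((X t x - Y i t) - (x - Ybar i)) \<le> W * T"
        using trajectory_start[OF elim(1)] vortex_start[OF i] by simp
      then show "norm (X t x - Y i t) \<le> R0 + W * T"
        using elim(2) norm_triangle_sub[of "X t x - Y i t" "x - Ybar i"] by linarith
    qed
  qed
  then show thesis using W by (rule that)
qed

lemma radial_mean_derivative:
  assumes i: "i \<in> {1..N}" and t: "t \<in> {0..T}"
    and G: "\<And>s. (G has_real_derivative G' s) (at s)" and G': "continuous_on UNIV G'"
  shows "((\<lambda>t. \<integral>x. G ((norm (x - Y i t))\<^sup>2) \<partial>law t i) has_real_derivative
    (\<integral>x. 2 * G' ((norm (x - Y i t))\<^sup>2) * ((x - Y i t) \<bullet> (velocity t x - vortex_speed t i)) \<partial>law t i)) (at t within {0..T})"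
proof -
  have contG: "continuous_on UNIV G"
    using G by (intro continuous_at_imp_continuous_on) (auto intro: DERIV_isCont)
  have [measurable]: "G \<in> borel_measurable borel" "G' \<in> borel_measurable borel"
    using contG G' by (auto intro: borel_measurable_continuous_onI)
  obtain M W where M: "AE x in \<mu> i. \<forall>t\<in>{0..T}. norm (X t x - Y i t) \<le> M"
    and W: "\<And>t x. t \<in> {0..T} \<Longrightarrow> norm (velocity t (X t x) - vortex_speed t i) \<le> W"
    by (rule relative_motion_bounded[OF i]) blast
  define M' where "M' = max M 0"
  have bdd: "\<exists>c. \<forall>s\<in>{0..M'\<^sup>2}. \<bar>f s\<bar> \<le> c" if "continuous_on UNIV f" for f :: "real \<Rightarrow> real"
    using compact_imp_bounded[OF compact_continuous_image[OF continuous_on_subset[OF that] compact_Icc, of 0 "M'\<^sup>2"]]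
    unfolding bounded_iff by auto
  obtain c where c: "\<And>s. s \<in> {0..M'\<^sup>2} \<Longrightarrow> \<bar>G s\<bar> \<le> c" using bdd[OF contG] by blast
  obtain c' where c': "\<And>s. s \<in> {0..M'\<^sup>2} \<Longrightarrow> \<bar>G' s\<bar> \<le> c'" using bdd[OF G'] by blast
  define H where "H t x = G ((norm (X t x - Y i t))\<^sup>2)" for t x
  define H' where "H' t x = 2 * G' ((norm (X t x - Y i t))\<^sup>2) * ((X t x - Y i t) \<bullet> (velocity t (X t x) - vortex_speed t i))" for t x
  have Xm [measurable]: "X t \<in> \<mu> i \<rightarrow>\<^sub>M borel" if "t \<in> {0..T}" for t using that by (intro X_measurable_mu i) auto
  have vm [measurable]: "velocity t \<in> borel_measurable borel" if "t \<in> {0..T}" for t using that by (intro measurable_flow_velocity) auto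
  have "((\<lambda>t. \<integral>x. H t x \<partial>\<mu> i) has_real_derivative (\<integral>x. H' t x \<partial>\<mu> i)) (at t within {0..T})"
  proof (rule has_real_derivative_integral[OF prob[OF i] _ _ _ _ _ t])
    show "H t \<in> borel_measurable (\<mu> i)" if t: "t \<in> {0..T}" for t
      unfolding H_def[abs_def] using Xm[OF t] by measurable
    show "H' t \<in> borel_measurable (\<mu> i)" if t: "t \<in> {0..T}" for t
      unfolding H'_def[abs_def] using Xm[OF t] vm[OF t] by measurable
    show "AE x in \<mu> i. \<forall>t\<in>{0..T}. ((\<lambda>t. H t x) has_real_derivative H' t x) (at t within {0..T})"
      using AE_trajectory[OF i]
    proof eventually_elim
      case (elim x)
      show ?case
      proof
        fix t assume t: "t \<in> {0..T}"
        let ?Z = "\<lambda>t. X t x - Y i t" and ?V = "velocity t (X t x) - vortex_speed t i"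
        have Z: "(?Z has_vector_derivative ?V) (at t within {0..T})"
          by (intro has_vector_derivative_diff trajectory_derivative vortex_derivative elim i t)
        have "((\<lambda>t. ?Z t \<bullet> ?Z t) has_vector_derivative (?Z t \<bullet> ?V + ?V \<bullet> ?Z t)) (at t within {0..T})"
          by (rule bounded_bilinear.has_vector_derivative[OF bounded_bilinear_inner Z Z])
        then have "((\<lambda>t. (norm (?Z t))\<^sup>2) has_real_derivative 2 * (?Z t \<bullet> ?V)) (at t within {0..T})"
          by (simp add: power2_norm_eq_inner has_real_derivative_iff_has_vector_derivative inner_commute)
        from DERIV_chain2[OF G this]
        show "((\<lambda>t. H t x) has_real_derivative H' t x) (at t within {0..T})"
          unfolding H_def H'_def by (simp add: mult_ac)
      qed
    qed
    have sq: "(norm (X t x - Y i t))\<^sup>2 \<in> {0..M'\<^sup>2}" if "norm (X t x - Y i t) \<le> M" for t x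
      using that by (auto simp: M'_def intro!: power_mono)
    show "AE x in \<mu> i. \<forall>t\<in>{0..T}. \<bar>H t x\<bar> \<le> c"
      using M
    proof eventually_elim
      case (elim x) then show ?case using c sq by (auto simp: H_def)
    qed
    show "AE x in \<mu> i. \<forall>t\<in>{0..T}. \<bar>H' t x\<bar> \<le> 2 * c' * (M' * W)"
      using M
    proof eventually_elim
      case (elim x)
      show ?case
      proof
        fix t assume t: "t \<in> {0..T}"
        have "\<bar>(X t x - Y i t) \<bullet> (velocity t (X t x) - vortex_speed t i)\<bar> \<le> M' * W"
          using elim t W[OF t, of x]
          by (intro order.trans[OF Cauchy_Schwarz_ineq2] mult_mono) (auto simp: M'_def intro: max.coboundedI1)
        moreover have "\<bar>2 * G' ((norm (X t x - Y i t))\<^sup>2)\<bar> \<le> 2 * c'"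
          unfolding abs_mult using c'[OF sq, of t x] elim t by simp
        ultimately show "\<bar>H' t x\<bar> \<le> 2 * c' * (M' * W)"
          unfolding H'_def abs_mult[of "2 * _"] by (intro mult_mono) (auto intro: order.trans[OF abs_ge_zero])
      qed
    qed
  qed
  then have "((\<lambda>t. \<integral>x. G ((norm (x - Y i t))\<^sup>2) \<partial>law t i) has_real_derivative (\<integral>x. H' t x \<partial>\<mu> i)) (at t within {0..T})"
  proof (rule has_field_derivative_transform_within[OF _ zero_less_one t])
    fix s assume "s \<in> {0..T}"
    then show "(\<integral>x. H s x \<partial>\<mu> i) = (\<integral>x. G ((norm (x - Y i s))\<^sup>2) \<partial>law s i)"
      unfolding H_def using Xm by (subst integral_distr) auto
  qed
  also have "(\<integral>x. H' t x \<partial>\<mu> i) = (\<integral>x. 2 * G' ((norm (x - Y i t))\<^sup>2) * ((x - Y i t) \<bullet> (velocity t x - vortex_speed t i)) \<partial>law t i)"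
  proof -
    have [measurable]: "velocity t \<in> borel_measurable borel" using vm[OF t] .
    show ?thesis unfolding H'_def using Xm[OF t] by (subst integral_distr) auto
  qed
  finally show ?thesis .
qed

lemma energy_derivative:
  assumes "i \<in> {1..N}" "t \<in> {0..T}"
  shows "((\<lambda>t. \<integral>x. (norm (x - Y i t))\<^sup>2 \<partial>law t i) has_real_derivative
    (\<integral>x. 2 * ((x - Y i t) \<bullet> (velocity t x - vortex_speed t i)) \<partial>law t i)) (at t within {0..T})"
  using radial_mean_derivative[OF assms, of "\<lambda>s. s" "\<lambda>_. 1"] by simp

lemma DERIV_max_0_square: "((\<lambda>u. (max 0 u)\<^sup>2) has_real_derivative 2 * max 0 u) (at u)" for u :: real
proof -
  consider "u > 0" | "u < 0" | "u = 0" by linarith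
  then show ?thesis
  proof cases
    case 1
    have "((\<lambda>u. u\<^sup>2) has_real_derivative 2 * max 0 u) (at u)" using 1 by (auto intro!: derivative_eq_intros)
    then show ?thesis
      by (rule has_field_derivative_transform_within_open[where S="{0<..}"]) (use 1 in auto)
  next
    case 2
    have "((\<lambda>u. 0) has_real_derivative 2 * max 0 u) (at u)" using 2 by (auto intro!: derivative_eq_intros)
    then show ?thesis
      by (rule has_field_derivative_transform_within_open[where S="{..<0}"]) (use 2 in auto)
  next
    case 3
    have "((\<lambda>h. (max 0 h)\<^sup>2 / h) \<longlongrightarrow> 0) (at (0 :: real))"
    proof (rule Lim_null_comparison)
      show "\<forall>\<^sub>F h in at (0 :: real). norm ((max 0 h)\<^sup>2 / h) \<le> \<bar>h\<bar>"
        by (auto simp: max_def power2_eq_square intro!: always_eventually)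
      show "((\<lambda>h. \<bar>h\<bar>) \<longlongrightarrow> 0) (at (0 :: real))" by (auto intro!: tendsto_eq_intros)
    qed
    then show ?thesis using 3 by (simp add: has_field_derivative_iff)
  qed
qed

lemma outer_derivative:
  assumes "i \<in> {1..N}" "t \<in> {0..T}"
  shows "((\<lambda>t. \<integral>x. outer_weight (Y i t) b \<beta> x \<partial>law t i) has_real_derivative
    (\<integral>x. outer_slope (Y i t) b \<beta> x * ((x - Y i t) \<bullet> (velocity t x - vortex_speed t i)) \<partial>law t i)) (at t within {0..T})"
proof -
  define G where "G s = exp (- \<beta> * (max 0 (1 - s / b\<^sup>2))\<^sup>2)" for s
  define G' where "G' s = exp (- \<beta> * (max 0 (1 - s / b\<^sup>2))\<^sup>2) * (- \<beta> * (2 * max 0 (1 - s / b\<^sup>2) * (- 1 / b\<^sup>2)))" for s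
  have "(G has_real_derivative G' s) (at s)" for s
  proof -
    have "((\<lambda>s. 1 - s / b\<^sup>2) has_real_derivative (- 1 / b\<^sup>2)) (at s)"
      using DERIV_diff[OF DERIV_const DERIV_cdivide[OF DERIV_ident, of "b\<^sup>2"], of 1 s UNIV] by simp
    from DERIV_chain2[OF DERIV_max_0_square this]
    show ?thesis unfolding G_def G'_def by (intro DERIV_chain2[OF DERIV_exp] DERIV_cmult)
  qed
  moreover have "continuous_on UNIV G'" unfolding G'_def by (intro continuous_intros)
     (use b_pos in auto)
  ultimately have "((\<lambda>t. \<integral>x. G ((norm (x - Y i t))\<^sup>2) \<partial>law t i) has_real_derivative
    (\<integral>x. 2 * G' ((norm (x - Y i t))\<^sup>2) * ((x - Y i t) \<bullet> (velocity t x - vortex_speed t i)) \<partial>law t i)) (at t within {0..T})"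
    by (rule radial_mean_derivative[OF assms])
  moreover have "G ((norm (x - c))\<^sup>2) = outer_weight c b \<beta> x" "2 * G' ((norm (x - c))\<^sup>2) = outer_slope c b \<beta> x" for x c
    by (simp_all add: G_def G'_def outer_slope_def outer_weight_def depth_def)
  ultimately show ?thesis by simp
qed

lemma snapshot:
  assumes clouds: "\<And>i. i \<in> {1..N} \<Longrightarrow> diffuse_cloud (law t i) \<eta> \<kappa>" and t: "t \<in> {0..T}"
  shows "vortex_clouds N (law t) (\<lambda>j. Y j t) b \<eta> \<kappa>"
proof (rule vortex_clouds.intro)
  fix i assume i: "i \<in> {1..N}"
  show "diffuse_cloud (law t i) \<eta> \<kappa>" by (rule clouds[OF i])
  then interpret diffuse_cloud "law t i" \<eta> \<kappa> .
  obtain M W where M: "AE x in \<mu> i. \<forall>t\<in>{0..T}. norm (X t x - Y i t) \<le> M"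
    and "\<And>t x. t \<in> {0..T} \<Longrightarrow> norm (velocity t (X t x) - vortex_speed t i) \<le> W"
    by (rule relative_motion_bounded[OF i]) blast
  have "AE x in law t i. norm (x - Y i t) \<le> M"
    using M t X_measurable_mu[OF i, of t] by (subst AE_distr_iff) (auto elim!: eventually_mono)
  then have "AE x in law t i. norm ((norm (x - Y i t))\<^sup>2) \<le> M\<^sup>2"
    by eventually_elim (auto intro!: power_mono)
  then show "integrable (law t i) (\<lambda>x. (norm (x - Y i t))\<^sup>2)"
    by (rule integrable_const_bound) measurable
qed (use t sep b_pos in auto)

end

section \<open>Concentration by continuation\<close>

lemma (in vortex_clouds) tail_le_outer:
  assumes i: "i \<in> {1..N}" and "\<beta> \<ge> 0"
  shows "tail i \<le> (\<integral>x. outer_weight (Y i) b \<beta> x \<partial>\<nu> i)"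
proof -
  interpret diffuse_cloud "\<nu> i" \<eta> \<kappa> using i by (rule cloud)
  have "tail i = (\<integral>x. indicator {x. b \<le> norm (x - Y i)} x \<partial>\<nu> i)" by simp
  also have "\<dots> \<le> (\<integral>x. outer_weight (Y i) b \<beta> x \<partial>\<nu> i)"
  proof (rule integral_mono)
    show "integrable (\<nu> i) (\<lambda>x. outer_weight (Y i) b \<beta> x)"
      by (rule integrable_const_bound[of _ 1]) (use outer_weight_bounds[where \<beta>=\<beta>] assms in \<open>auto simp: less_imp_le\<close>)
    show "indicator {x. b \<le> norm (x - Y i)} x \<le> outer_weight (Y i) b \<beta> x" for x
      using depth_eq_0[OF b_pos, of x "Y i"] outer_weight_bounds(1)[of "Y i" b \<beta> x]
      by (auto simp: indicator_def outer_weight_def less_imp_le)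
  qed (auto simp: emeasure_eq_measure)
  finally show ?thesis .
qed

lemma ennsqrt_le_iff:
  assumes "\<epsilon> \<ge> 0" shows "ennsqrt x \<le> ennreal \<epsilon> \<longleftrightarrow> x \<le> ennreal (\<epsilon>\<^sup>2)"
proof (cases x)
  case (real r)
  then show ?thesis using assms real_sqrt_le_iff[of r "\<epsilon>\<^sup>2"]
    by (simp add: ennsqrt_def enn2real_ennreal)
qed (simp_all add: ennsqrt_def top_unique)

lemma second_moment_le_iff:
  fixes \<mu> :: "(real^2) measure"
  assumes "prob_space \<mu>" "sets \<mu> = sets borel" "\<epsilon> \<ge> 0"
  shows "W2 \<mu> (return borel Y) \<le> ennreal \<epsilon> \<longleftrightarrow>
    integrable \<mu> (\<lambda>x. (norm (x - Y))\<^sup>2) \<and> (\<integral>x. (norm (x - Y))\<^sup>2 \<partial>\<mu>) \<le> \<epsilon>\<^sup>2"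
proof -
  have [measurable_cong]: "sets \<mu> = sets borel" by fact
  have "W2 \<mu> (return borel Y) \<le> ennreal \<epsilon> \<longleftrightarrow> (\<integral>\<^sup>+x. ennreal ((norm (x - Y))\<^sup>2) \<partial>\<mu>) \<le> ennreal (\<epsilon>\<^sup>2)"
    using assms by (simp add: W2_return ennsqrt_le_iff dist_norm)
  also have "\<dots> \<longleftrightarrow> integrable \<mu> (\<lambda>x. (norm (x - Y))\<^sup>2) \<and> (\<integral>x. (norm (x - Y))\<^sup>2 \<partial>\<mu>) \<le> \<epsilon>\<^sup>2"
  proof
    assume *: "(\<integral>\<^sup>+x. ennreal ((norm (x - Y))\<^sup>2) \<partial>\<mu>) \<le> ennreal (\<epsilon>\<^sup>2)"
    then have "(\<integral>\<^sup>+x. ennreal (norm ((norm (x - Y))\<^sup>2)) \<partial>\<mu>) < \<infinity>" by (simp add: le_less_trans)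
    then have "integrable \<mu> (\<lambda>x. (norm (x - Y))\<^sup>2)" by (intro integrableI_bounded) measurable
    then show "integrable \<mu> (\<lambda>x. (norm (x - Y))\<^sup>2) \<and> (\<integral>x. (norm (x - Y))\<^sup>2 \<partial>\<mu>) \<le> \<epsilon>\<^sup>2"
      using * by (auto intro: integral_real_bounded)
  next
    assume *: "integrable \<mu> (\<lambda>x. (norm (x - Y))\<^sup>2) \<and> (\<integral>x. (norm (x - Y))\<^sup>2 \<partial>\<mu>) \<le> \<epsilon>\<^sup>2"
    then have "(\<integral>\<^sup>+x. ennreal ((norm (x - Y))\<^sup>2) \<partial>\<mu>) = ennreal (\<integral>x. (norm (x - Y))\<^sup>2 \<partial>\<mu>)"
      by (intro nn_integral_eq_integral) auto
    then show "(\<integral>\<^sup>+x. ennreal ((norm (x - Y))\<^sup>2) \<partial>\<mu>) \<le> ennreal (\<epsilon>\<^sup>2)" using * by (simp add: ennreal_leI)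
  qed
  finally show ?thesis .
qed

locale concentrating_clouds = clouds_near_vortices +
  fixes \<epsilon> \<alpha> Cd :: real
  assumes eps_pos: "\<epsilon> > 0" and inside: "R0 \<le> b / 2"
    and diffuse: "i \<in> {1..N} \<Longrightarrow> t \<ge> 0 \<Longrightarrow> diffuse_cloud (law t i) (\<epsilon> powr \<alpha>) (Cd * \<epsilon>)"
    and variance: "i \<in> {1..N} \<Longrightarrow> (\<integral>x. (norm (x - Ybar i))\<^sup>2 \<partial>\<mu> i) \<le> \<epsilon>\<^sup>2"

text \<open>If the tails are of size \<open>\<epsilon>\<^sup>m\<close> up to some time, the energy is of order \<open>\<epsilon>\<^sup>2\<close> by Gronwall's
  inequality, and then the exponential weights show that the tails are even of size
  \<open>\<epsilon>\<^sup>m\<^sup>+\<^sup>1\<close>. The rate is \<open>\<beta> = L ln(1/\<epsilon>)\<close>; as \<open>\<beta>\<epsilon>\<close> is bounded, the weights grow at most like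
  \<open>exp (C\<beta>t)\<close>, whereas they start below \<open>exp (-\<beta>/2)\<close>. Hence the time of validity does not
  depend on \<open>\<epsilon>\<close>.\<close>

lemma concentration:
  fixes a :: "nat \<Rightarrow> real" and b \<alpha> Cd :: real
  assumes b: "b > 0" and al: "\<alpha> > 0" and Cd: "Cd > 0"
  obtains T1 \<epsilon>1 C where "T1 > 0" "0 < \<epsilon>1" "\<epsilon>1 \<le> 1" "C > 0"
    "\<And>\<mu> X Ybar Y T R0 \<epsilon> i t. concentrating_clouds N a \<mu> X Ybar Y T b R0 \<epsilon> \<alpha> Cd \<Longrightarrow> T \<le> T1 \<Longrightarrow> \<epsilon> \<le> \<epsilon>1 \<Longrightarrow>
      i \<in> {1..N} \<Longrightarrow> t \<in> {0..T} \<Longrightarrow>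
      W2 (distr (\<mu> i) borel (X t)) (return borel (Y i t)) \<le> ennreal (C * \<epsilon>)"
proof -
  define A where "A = (\<Sum>j\<in>{1..N}. \<bar>a j\<bar>)"
  \<comment> \<open>The rate \<open>\<beta> = L ln(1/\<epsilon>)\<close> is chosen such that \<open>exp(-\<beta>/4) = \<epsilon>\<^sup>m\<^sup>+\<^sup>1\<close>.\<close>
  define m where "m = 2 * \<alpha> + 2"
  define L where "L = 4 * (m + 1)"
  define c1 where "c1 = 1 + Cd + 1 / b"
  define CE where "CE = real N * (A * (6 / b\<^sup>2 + 2 + 2 * c1\<^sup>2))"
  define c2 where "c2 = sqrt ((real N + 1) * exp CE)"
  define C3 where "C3 = A * (16 * L * c2 / b ^ 3 + 4 / b * (2 / b + 1))"
  define T1 where "T1 = min 1 (1 / (4 * (C3 + 1)))"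
  define \<epsilon>1 where "\<epsilon>1 = min (exp (- 1)) (min (1 / c1) (1 / (real N + 1)))"
  have A: "A \<ge> 0" unfolding A_def by (intro sum_nonneg) auto
  have m: "m > 0" "L > 0" "L \<ge> 4" using al by (auto simp: m_def L_def)
  have c1: "c1 > 0" using Cd b by (auto simp: c1_def intro!: add_pos_pos)
  have CE: "CE \<ge> 0" using A by (simp add: CE_def)
  have c2: "c2 > 0" "c2\<^sup>2 = (real N + 1) * exp CE" unfolding c2_def by (auto intro!: mult_pos_pos)
  have C3: "C3 \<ge> 0" using A m b c2 by (auto simp: C3_def less_imp_le intro!: mult_nonneg_nonneg add_nonneg_nonneg divide_nonneg_nonneg)
  show thesis
  proof (rule that[of T1 \<epsilon>1 c2])
    show "T1 > 0" using C3 by (simp add: T1_def)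
    show "0 < \<epsilon>1" "\<epsilon>1 \<le> 1" using c1 by (auto simp: \<epsilon>1_def min_le_iff_disj)
    show "c2 > 0" by (rule c2)
    fix \<mu> X Ybar Y T R0 \<epsilon> i0 t0
    assume loc: "concentrating_clouds N a \<mu> X Ybar Y T b R0 \<epsilon> \<alpha> Cd" and TT: "T \<le> T1" and e1': "\<epsilon> \<le> \<epsilon>1"
      and i0: "i0 \<in> {1..N}" and t0: "t0 \<in> {0..T}"
    interpret concentrating_clouds N a \<mu> X Ybar Y T b R0 \<epsilon> \<alpha> Cd by (rule loc)
    have e: "0 < \<epsilon>" "\<epsilon> \<le> \<epsilon>1" using eps_pos e1' by auto
    define \<eta> where "\<eta> = \<epsilon> powr \<alpha>"
    define \<kappa> where "\<kappa> = Cd * \<epsilon>"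
    define \<beta> where "\<beta> = L * ln (1 / \<epsilon>)"
    have e1: "\<epsilon> \<le> exp (- 1)" "c1 * \<epsilon> \<le> 1" "(real N + 1) * \<epsilon> \<le> 1"
    proof -
      have "\<epsilon> \<le> 1 / c1" "\<epsilon> \<le> 1 / (real N + 1)" using e by (auto simp: \<epsilon>1_def)
      then show "c1 * \<epsilon> \<le> 1" "(real N + 1) * \<epsilon> \<le> 1" using c1 by (simp_all add: field_simps)
    qed (use e in \<open>simp add: \<epsilon>1_def\<close>)
    have "exp (- 1 :: real) < 1" by simp
    then have e_less: "\<epsilon> < 1" using e1(1) by (rule order.strict_trans1[rotated])
    have eta: "\<eta> > 0" "\<eta> \<le> 1" using e e_less al by (auto simp: \<eta>_def powr_le1)
    have "ln \<epsilon> \<le> ln (exp (- 1))" using e e1 by (subst ln_le_cancel_iff) auto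
    then have ln1: "ln (1 / \<epsilon>) \<ge> 1" using e by (simp add: ln_div)
    have beta: "\<beta> \<ge> 1" unfolding \<beta>_def using mult_mono[of 1 L 1 "ln (1 / \<epsilon>)"] m ln1 by simp
    have beta_e: "\<beta> * \<epsilon> \<le> L"
    proof -
      have "ln (1 / \<epsilon>) \<le> 1 / \<epsilon> - 1" using e by (intro ln_le_minus_one) simp
      then have "ln (1 / \<epsilon>) * \<epsilon> \<le> (1 / \<epsilon>) * \<epsilon>" using e by (intro mult_right_mono) auto
      then have "L * (ln (1 / \<epsilon>) * \<epsilon>) \<le> L * 1" using e m by (intro mult_left_mono) auto
      then show ?thesis by (simp add: \<beta>_def mult.assoc)
    qed
    have expb: "exp (- \<beta> / 4) = \<epsilon> powr (m + 1)"
      using e by (simp add: \<beta>_def L_def powr_def ln_div)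
    have Nexp: "real N * exp (- \<beta> / 4) < \<epsilon> powr m"
    proof -
      have "real N * exp (- \<beta> / 4) = (real N * \<epsilon>) * \<epsilon> powr m" unfolding expb using e by (simp add: powr_add)
      also have "\<dots> < 1 * \<epsilon> powr m" using e e1(3) by (intro mult_strict_right_mono) (auto simp: algebra_simps)
      finally show ?thesis by simp
    qed
    have snap: "vortex_clouds N (law t) (\<lambda>j. Y j t) b \<eta> \<kappa>" if "t \<in> {0..T}" for t
      using diffuse that unfolding \<eta>_def \<kappa>_def by (intro snapshot) auto
    define E where "E i t = (\<integral>x. (norm (x - Y i t))\<^sup>2 \<partial>law t i)" for i t
    define \<Phi> where "\<Phi> i t = (\<integral>x. outer_weight (Y i t) b \<beta> x \<partial>law t i)" for i t
    define tail where "tail i t = measure (law t i) {x. b \<le> norm (x - Y i t)}" for i t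
    have tail_le: "tail i t \<le> \<Phi> i t" if "i \<in> {1..N}" "t \<in> {0..T}" for i t
      unfolding tail_def \<Phi>_def using beta that by (intro vortex_clouds.tail_le_outer[OF snap]) auto
    have tail_small: "tail i t / \<eta> + \<kappa> \<le> c1 * \<epsilon>"
      if i: "i \<in> {1..N}" and t: "t \<in> {0..T}" and small: "\<Phi> i t \<le> \<epsilon> powr m" for i t
    proof -
      have "tail i t / \<eta> \<le> \<epsilon> powr m / \<eta>" using tail_le[OF i t] small eta by (intro divide_right_mono) auto
      also have "\<dots> = \<epsilon> powr (\<alpha> + 2)" unfolding \<eta>_def by (simp add: powr_diff[symmetric] m_def)
      also have "\<dots> \<le> \<epsilon> powr 1" using e e_less al by (intro powr_mono') auto
      finally have "tail i t / \<eta> \<le> \<epsilon>" using e by simp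
      moreover have "0 \<le> 1 / b * \<epsilon>" using b e by simp
      ultimately show ?thesis unfolding \<kappa>_def c1_def distrib_right by linarith
    qed
    have Phi_nonneg: "\<Phi> i t \<ge> 0" for i t
      unfolding \<Phi>_def by (intro Bochner_Integration.integral_nonneg) (simp add: outer_weight_bounds less_imp_le)
    have start_law: "(\<integral>x. f (x - Y i 0) \<partial>law 0 i) = (\<integral>x. f (x - Ybar i) \<partial>\<mu> i)"
      if i: "i \<in> {1..N}" and [measurable]: "f \<in> borel_measurable borel" for f :: "real^2 \<Rightarrow> real" and i
    proof -
      note [measurable] = X_measurable_mu[OF i order.refl]
      have sm [measurable_cong]: "sets (\<mu> i) = sets borel" by (rule sets_mu[OF i])
      have "(\<integral>x. f (x - Y i 0) \<partial>law 0 i) = (\<integral>x. f (X 0 x - Y i 0) \<partial>\<mu> i)" by (subst integral_distr) auto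
      also have "\<dots> = (\<integral>x. f (x - Ybar i) \<partial>\<mu> i)"
        by (rule integral_cong_AE) (measurable, use AE_trajectory[OF i] in eventually_elim, simp add: trajectory_start vortex_start[OF i])
      finally show ?thesis .
    qed
    have Phi0: "\<Phi> i 0 \<le> exp (- \<beta> / 2)" if i: "i \<in> {1..N}" for i
    proof -
      interpret M: prob_space "\<mu> i" using i by (rule prob)
      have sm [measurable_cong]: "sets (\<mu> i) = sets borel" by (rule sets_mu[OF i])
      have ow: "outer_weight c b \<beta> x = outer_weight 0 b \<beta> (x - c)" for c x by (simp add: outer_weight_def depth_def)
      have "\<Phi> i 0 = (\<integral>x. outer_weight 0 b \<beta> (x - Ybar i) \<partial>\<mu> i)"
        unfolding \<Phi>_def ow[of "Y i 0"] by (rule start_law[OF i]) measurable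
      also have "\<dots> \<le> (\<integral>x. exp (- \<beta> / 2) \<partial>\<mu> i)"
      proof (rule integral_mono_AE)
        show "integrable (\<mu> i) (\<lambda>x. outer_weight 0 b \<beta> (x - Ybar i))"
          by (rule M.integrable_const_bound[of _ 1]) (use outer_weight_bounds[where \<beta>=\<beta>] beta in \<open>auto simp: less_imp_le\<close>)
        show "AE x in \<mu> i. outer_weight 0 b \<beta> (x - Ybar i) \<le> exp (- \<beta> / 2)"
          using start[OF i]
        proof eventually_elim
          case (elim x)
          have "(norm (x - Ybar i))\<^sup>2 \<le> (b / 2)\<^sup>2" using elim inside by (intro power_mono) auto
          then have "(norm (x - Ybar i))\<^sup>2 / b\<^sup>2 \<le> (b / 2)\<^sup>2 / b\<^sup>2" by (intro divide_right_mono) auto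
          also have "\<dots> = 1 / 4" using b by (simp add: power_divide)
          finally have "(norm (x - Ybar i))\<^sup>2 / b\<^sup>2 \<le> 1 / 4" .
          moreover have "depth 0 b (x - Ybar i) = max 0 (1 - (norm (x - Ybar i))\<^sup>2 / b\<^sup>2)" by (simp add: depth_def)
          ultimately have "depth 0 b (x - Ybar i) \<ge> 3 / 4" by linarith
          then have "(depth 0 b (x - Ybar i))\<^sup>2 \<ge> (3 / 4)\<^sup>2" by (intro power_mono) auto
          then have "(depth 0 b (x - Ybar i))\<^sup>2 \<ge> 1 / 2" by (simp add: power2_eq_square)
          then have "\<beta> * (1 / 2) \<le> \<beta> * (depth 0 b (x - Ybar i))\<^sup>2" using beta by (intro mult_left_mono) auto
          then show ?case by (simp add: outer_weight_def)
        qed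
      qed simp
      also have "\<dots> = exp (- \<beta> / 2)" by (simp add: M.prob_space)
      finally show ?thesis .
    qed
    have E0: "E i 0 \<le> \<epsilon>\<^sup>2" if i: "i \<in> {1..N}" for i
      unfolding E_def using start_law[OF i, of "\<lambda>x. (norm x)\<^sup>2"] variance[OF i] by simp
    \<comment> \<open>As \<open>m = 2\<alpha> + 2\<close>, a tail of size \<open>\<epsilon>\<^sup>m\<close> outweighs the square of the velocity bound \<open>1/\<eta>\<close> and leaves
      the error \<open>\<epsilon>\<^sup>2\<close> in Gronwall's inequality.\<close>
    have energy: "E i t \<le> (c2 * \<epsilon>)\<^sup>2"
      if small: "\<And>i s. i \<in> {1..N} \<Longrightarrow> s \<in> {0..t} \<Longrightarrow> \<Phi> i s \<le> \<epsilon> powr m" and t: "t \<in> {0..T}" and i: "i \<in> {1..N}" for i t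
    proof -
      define D where "D i s = (\<integral>x. 2 * ((x - Y i s) \<bullet> (velocity s x - vortex_speed s i)) \<partial>law s i)" for i s
      have D: "D i s \<le> A * ((6 / b\<^sup>2 + 2) * (\<Sum>j\<in>{1..N}. E j s) + 2 * (c1 * \<epsilon>)\<^sup>2)" if s: "s \<in> {0..t}" and i: "i \<in> {1..N}" for i s
      proof -
        have sT: "s \<in> {0..T}" using s t by auto
        have tl: "tail j s \<le> \<epsilon> powr m" if "j \<in> {1..N}" for j using tail_le[OF that sT] small[OF that s] by simp
        have inv: "1 / \<eta> = \<epsilon> powr - \<alpha>" by (simp add: \<eta>_def powr_minus_divide)
        show ?thesis
          unfolding D_def E_def A_def
        proof (rule vortex_clouds.energy_growth[OF snap[OF sT] i])
          fix j assume j: "j \<in> {1..N}"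
          show "measure (law s j) {x. b \<le> norm (x - Y j s)} / \<eta> + \<kappa> \<le> c1 * \<epsilon>"
            using tail_small[OF j sT small[OF j s]] by (simp add: tail_def)
        next
          have "1 / \<eta> + \<kappa> + 1 / b \<le> \<epsilon> powr - \<alpha> * c1"
          proof -
            have "1 \<le> \<epsilon> powr - \<alpha>" using eta inv by (metis le_divide_eq_1_pos)
            moreover have "0 \<le> 1 / b" using b by simp
            moreover have "\<kappa> \<le> Cd" unfolding \<kappa>_def using Cd e_less by simp
            ultimately have "\<kappa> \<le> \<epsilon> powr - \<alpha> * Cd" "1 / b \<le> \<epsilon> powr - \<alpha> * (1 / b)"
              using Cd b mult_right_mono[of 1 "\<epsilon> powr - \<alpha>" Cd] mult_right_mono[of 1 "\<epsilon> powr - \<alpha>" "1 / b"]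
              by linarith+
            then show ?thesis unfolding inv c1_def distrib_left by linarith
          qed
          moreover have "0 \<le> 1 / \<eta> + \<kappa> + 1 / b" using eta Cd e b by (simp add: \<kappa>_def)
          ultimately have "(1 / \<eta> + \<kappa> + 1 / b)\<^sup>2 \<le> (\<epsilon> powr - \<alpha> * c1)\<^sup>2" by (intro power_mono) auto
          then have "(1 / \<eta> + \<kappa> + 1 / b)\<^sup>2 * tail i s \<le> (\<epsilon> powr - \<alpha> * c1)\<^sup>2 * \<epsilon> powr m"
            using tl[OF i] by (intro mult_mono) (auto simp: tail_def)
          also have "(\<epsilon> powr - \<alpha> * c1)\<^sup>2 * \<epsilon> powr m = (c1 * \<epsilon>)\<^sup>2"
          proof -
            have "\<epsilon> powr m = (\<epsilon> powr \<alpha>)\<^sup>2 * \<epsilon>\<^sup>2"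
              using e by (simp add: m_def powr_add powr_power mult.commute)
            then show ?thesis using e by (simp add: powr_minus power_mult_distrib field_simps)
          qed
          finally show "(1 / \<eta> + \<kappa> + 1 / b)\<^sup>2 * measure (law s i) {x. b \<le> norm (x - Y i s)} \<le> (c1 * \<epsilon>)\<^sup>2"
            by (simp add: tail_def)
        qed
      qed
      define F where "F s = (\<Sum>j\<in>{1..N}. E j s) + \<epsilon>\<^sup>2" for s
      have "F t \<le> F 0 * exp (CE * t)"
      proof (rule gronwall)
        fix s assume s: "s \<in> {0..t}"
        have "(F has_real_derivative (\<Sum>j\<in>{1..N}. D j s) + 0) (at s within {0..t})"
          unfolding F_def
        proof (intro DERIV_add DERIV_sum DERIV_const)
          fix j assume j: "j \<in> {1..N}"
          have "(E j has_real_derivative D j s) (at s within {0..T})"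
            unfolding E_def[abs_def] D_def using s t by (intro energy_derivative j) auto
          then show "(E j has_real_derivative D j s) (at s within {0..t})"
            by (rule has_field_derivative_subset) (use t in auto)
        qed
        then show "(F has_real_derivative (\<Sum>j\<in>{1..N}. D j s)) (at s within {0..t})" by simp
        define S where "S = (\<Sum>j\<in>{1..N}. E j s)"
        have S: "S \<ge> 0" unfolding S_def E_def by (intro sum_nonneg) auto
        have "(\<Sum>j\<in>{1..N}. D j s) \<le> (\<Sum>j\<in>{1..N}. A * ((6 / b\<^sup>2 + 2) * S + 2 * (c1 * \<epsilon>)\<^sup>2))"
          unfolding S_def by (intro sum_mono D s)
        also have "\<dots> = real N * (A * ((6 / b\<^sup>2 + 2) * S + 2 * c1\<^sup>2 * \<epsilon>\<^sup>2))" by (simp add: power_mult_distrib)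
        also have "\<dots> \<le> real N * (A * ((6 / b\<^sup>2 + 2 + 2 * c1\<^sup>2) * (S + \<epsilon>\<^sup>2)))"
        proof (intro mult_left_mono A)
          have "0 \<le> (6 / b\<^sup>2 + 2) * \<epsilon>\<^sup>2" "0 \<le> 2 * c1\<^sup>2 * S" using S by auto
          then show "(6 / b\<^sup>2 + 2) * S + 2 * c1\<^sup>2 * \<epsilon>\<^sup>2 \<le> (6 / b\<^sup>2 + 2 + 2 * c1\<^sup>2) * (S + \<epsilon>\<^sup>2)"
            unfolding distrib_left distrib_right by linarith
        qed auto
        finally show "(\<Sum>j\<in>{1..N}. D j s) \<le> CE * F s" by (simp add: CE_def F_def S_def mult_ac)
      qed (use t in auto)
      also have "\<dots> \<le> ((real N + 1) * \<epsilon>\<^sup>2) * exp CE"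
      proof (rule mult_mono)
        have "(\<Sum>j\<in>{1..N}. E j 0) \<le> (\<Sum>j\<in>{1..N}. \<epsilon>\<^sup>2)" by (intro sum_mono E0)
        then show "F 0 \<le> (real N + 1) * \<epsilon>\<^sup>2" by (simp add: F_def algebra_simps)
        have "CE * t \<le> CE * 1" using t TT CE by (intro mult_left_mono) (auto simp: T1_def)
        then show "exp (CE * t) \<le> exp CE" by simp
      qed auto
      also have "\<dots> = (c2 * \<epsilon>)\<^sup>2" by (simp add: power_mult_distrib c2)
      finally have "F t \<le> (c2 * \<epsilon>)\<^sup>2" .
      moreover have "E i t \<le> (\<Sum>j\<in>{1..N}. E j t)"
        by (rule member_le_sum) (use i in \<open>auto simp: E_def\<close>)
      ultimately show ?thesis unfolding F_def using zero_le_power2[of \<epsilon>] by linarith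
    qed
    have outer: "\<Phi> i t \<le> exp (- \<beta> / 4)"
      if small: "\<And>i s. i \<in> {1..N} \<Longrightarrow> s \<in> {0..t} \<Longrightarrow> \<Phi> i s \<le> \<epsilon> powr m" and t: "t \<in> {0..T}" and i: "i \<in> {1..N}" for i t
    proof -
      define D where "D s = (\<integral>x. outer_slope (Y i s) b \<beta> x * ((x - Y i s) \<bullet> (velocity s x - vortex_speed s i)) \<partial>law s i)" for s
      have "\<Phi> i t \<le> \<Phi> i 0 * exp ((C3 * \<beta>) * t)"
      proof (rule gronwall)
        fix s assume s: "s \<in> {0..t}"
        have sT: "s \<in> {0..T}" using s t by auto
        have "(\<Phi> i has_real_derivative D s) (at s within {0..T})"
          unfolding \<Phi>_def[abs_def] D_def by (rule outer_derivative[OF i sT])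
        then show "(\<Phi> i has_real_derivative D s) (at s within {0..t})"
          by (rule has_field_derivative_subset) (use t in auto)
        define sp where "sp = (\<integral>x. norm (x - Y i s) \<partial>law s i)"
        have tl: "tail j s / \<eta> + \<kappa> \<le> 1" if j: "j \<in> {1..N}" for j
          using tail_small[OF j sT small[OF j s]] e1(2) by simp
        have "sp\<^sup>2 \<le> E i s" unfolding sp_def E_def by (rule vortex_clouds.spread_square_le[OF snap[OF sT] i])
        also have "E i s \<le> (c2 * \<epsilon>)\<^sup>2"
          by (rule energy[OF _ sT i]) (use small s in auto)
        finally have sp: "sp \<le> c2 * \<epsilon>" by (rule power2_le_imp_le) (use c2 e in auto)
        have "D s \<le> A * (16 * \<beta>\<^sup>2 / b ^ 3 * sp + 4 * \<beta> / b * (2 / b + 1)) * \<Phi> i s"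
          unfolding D_def A_def sp_def \<Phi>_def
          using tl unfolding tail_def by (intro vortex_clouds.outer_growth[OF snap[OF sT] i beta]) auto
        also have "\<dots> \<le> C3 * \<beta> * \<Phi> i s"
        proof (rule mult_right_mono[OF _ Phi_nonneg])
          have "16 * \<beta>\<^sup>2 / b ^ 3 * sp \<le> 16 * \<beta>\<^sup>2 / b ^ 3 * (c2 * \<epsilon>)" using sp b by (intro mult_left_mono) auto
          also have "\<dots> = (16 * c2 / b ^ 3 * \<beta>) * (\<beta> * \<epsilon>)" by (simp add: power2_eq_square)
          also have "\<dots> \<le> (16 * c2 / b ^ 3 * \<beta>) * L" using beta_e c2 b beta by (intro mult_left_mono) auto
          finally have "16 * \<beta>\<^sup>2 / b ^ 3 * sp + 4 * \<beta> / b * (2 / b + 1)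
              \<le> (16 * L * c2 / b ^ 3 + 4 / b * (2 / b + 1)) * \<beta>" unfolding distrib_right[of _ _ \<beta>] by (simp add: mult_ac)
          from mult_left_mono[OF this A]
          show "A * (16 * \<beta>\<^sup>2 / b ^ 3 * sp + 4 * \<beta> / b * (2 / b + 1)) \<le> C3 * \<beta>" by (simp add: C3_def mult.assoc)
        qed
        finally show "D s \<le> C3 * \<beta> * \<Phi> i s" .
      qed (use t in auto)
      also have "\<dots> \<le> exp (- \<beta> / 2) * exp (\<beta> / 4)"
      proof (rule mult_mono[OF Phi0[OF i]])
        have "t \<le> 1 / (4 * (C3 + 1))" using t TT by (simp add: T1_def)
        then have "C3 * t \<le> C3 * (1 / (4 * (C3 + 1)))" using C3 by (intro mult_left_mono) auto
        also have "\<dots> \<le> 1 / 4" using C3 by (simp add: divide_simps)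
        finally have "(C3 * t) * \<beta> \<le> 1 / 4 * \<beta>" using beta by (intro mult_right_mono) auto
        then show "exp (C3 * \<beta> * t) \<le> exp (\<beta> / 4)" by (simp add: mult_ac)
      qed auto
      also have "\<dots> = exp (- \<beta> / 4)" by (simp add: exp_add[symmetric])
      finally show ?thesis .
    qed
    \<comment> \<open>The gain from \<open>\<epsilon>\<^sup>m\<close> to \<open>N \<epsilon>\<^sup>m\<^sup>+\<^sup>1 < \<epsilon>\<^sup>m\<close> keeps the sum of the means from ever reaching \<open>\<epsilon>\<^sup>m\<close>.\<close>
    define f where "f t = (\<Sum>i\<in>{1..N}. \<Phi> i t)" for t
    have Phi_le_f: "\<Phi> i t \<le> f t" if "i \<in> {1..N}" for i t
      unfolding f_def by (rule member_le_sum) (use that Phi_nonneg in auto)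
    have step: "f t < \<epsilon> powr m" if "t \<in> {0..T}" "\<And>s. s \<in> {0..t} \<Longrightarrow> f s \<le> \<epsilon> powr m" for t
    proof -
      have "f t \<le> (\<Sum>i\<in>{1..N}. exp (- \<beta> / 4))" unfolding f_def
        by (intro sum_mono outer that) (use that(2) Phi_le_f in \<open>blast intro: order.trans\<close>)
      also have "\<dots> = real N * exp (- \<beta> / 4)" by simp
      also note Nexp
      finally show ?thesis .
    qed
    have f_small: "f t < \<epsilon> powr m" if "t \<in> {0..T}" for t
    proof (rule continuity_bootstrap[of T f])
      have "continuous_on {0..T} (\<Phi> i)" if i: "i \<in> {1..N}" for i
        unfolding \<Phi>_def[abs_def] using outer_derivative[OF i, of _ \<beta>]
        by (intro DERIV_continuous_on) auto
      then show "continuous_on {0..T} f" unfolding f_def by (intro continuous_intros) auto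
      have "f 0 \<le> (\<Sum>i\<in>{1..N}. exp (- \<beta> / 4))" unfolding f_def
        using beta by (intro sum_mono order.trans[OF Phi0]) auto
      then show "f 0 < \<epsilon> powr m" using Nexp by simp
    qed (use step that in auto)
    have "E i0 t0 \<le> (c2 * \<epsilon>)\<^sup>2"
    proof (rule energy[OF _ t0 i0])
      fix i s assume "i \<in> {1..N}" "s \<in> {0..t0}"
      then show "\<Phi> i s \<le> \<epsilon> powr m" using Phi_le_f[of i s] f_small[of s] t0 by auto
    qed
    moreover have "diffuse_cloud (law t0 i0) \<eta> \<kappa>" using diffuse[OF i0] t0 by (simp add: \<eta>_def \<kappa>_def)
    ultimately show "W2 (law t0 i0) (return borel (Y i0 t0)) \<le> ennreal (c2 * \<epsilon>)"
      using vortex_clouds.moment[OF snap[OF t0] i0] c2 e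
      by (subst second_moment_le_iff) (auto simp: E_def diffuse_cloud_def)
  qed
qed

section \<open>Admissible solutions as transported clouds\<close>

lemma AE_zero_outside_spt: "AE x in lborel. x \<notin> spt f \<longrightarrow> f x = 0"
proof -
  define F where "F = {ball x r | x r. r > 0 \<and> (AE y in lborel. y \<in> ball x r \<longrightarrow> f y = 0)}"
  obtain F' where F': "F' \<subseteq> F" "countable F'" "\<Union>F' = \<Union>F"
    by (rule Lindelof[of F]) (auto simp: F_def)
  have "AE y in lborel. \<forall>B\<in>F'. y \<in> B \<longrightarrow> f y = 0"
    using F'(1) by (subst AE_ball_countable[OF F'(2)]) (auto simp: F_def)
  then show ?thesis
  proof eventually_elim
    case (elim x)
    show ?case
    proof
      assume "x \<notin> spt f"
      then obtain r where "r > 0" "AE y in lborel. y \<in> ball x r \<longrightarrow> f y = 0" by (auto simp: spt_def)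
      then have "x \<in> \<Union>F" by (force simp: F_def)
      then show "f x = 0" using elim F'(3) by auto
    qed
  qed
qed

text \<open>A single particle close to \<open>c\<close> suffices to locate a cloud whose support is small, and to bound the distance
  between the centres of two clouds from below.\<close>

lemma exists_near_center:
  fixes \<mu> :: "(real^2) measure"
  assumes "prob_space \<mu>" "\<epsilon> > 0" and int: "integrable \<mu> (\<lambda>x. (norm (x - c))\<^sup>2)"
    and le: "(\<integral>x. (norm (x - c))\<^sup>2 \<partial>\<mu>) \<le> \<epsilon>\<^sup>2" and P: "AE x in \<mu>. P x"
  shows "\<exists>x. P x \<and> norm (x - c) \<le> 2 * \<epsilon>"
proof (rule ccontr)
  assume "\<not> ?thesis"
  then have neg: "\<And>x. P x \<Longrightarrow> 2 * \<epsilon> \<le> norm (x - c)" by force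
  interpret prob_space \<mu> by fact
  have "(2 * \<epsilon>)\<^sup>2 = (\<integral>x. (2 * \<epsilon>)\<^sup>2 \<partial>\<mu>)" by (simp add: prob_space)
  also have "\<dots> \<le> (\<integral>x. (norm (x - c))\<^sup>2 \<partial>\<mu>)"
  proof (rule integral_mono_AE)
    show "AE x in \<mu>. (2 * \<epsilon>)\<^sup>2 \<le> (norm (x - c))\<^sup>2"
      using P
    proof eventually_elim
      case (elim x)
      show ?case using neg[OF elim] \<open>\<epsilon> > 0\<close> by (intro power_mono) auto
    qed
  qed (use int in auto)
  also note le
  finally show False using \<open>\<epsilon> > 0\<close> by (simp add: power_mult_distrib)
qed

lemma diffuse_cloud_mono:
  assumes "diffuse_cloud \<nu> \<eta> \<kappa>" "\<kappa> \<le> \<kappa>'"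
  shows "diffuse_cloud \<nu> \<eta> \<kappa>'"
  using assms unfolding diffuse_cloud_def diffuse_cloud_axioms_def
  by (meson ennreal_leI order.trans)

lemma one_sign_normalized:
  assumes "a \<noteq> 0" "f \<in> borel_measurable lborel" "(LINT x|lborel. f x) = a"
    and sgn: "(AE x in lborel. f x \<ge> 0) \<or> (AE x in lborel. f x \<le> 0)"
  shows "integrable lborel f" "AE x in lborel. f x / a \<ge> 0" "(\<integral>\<^sup>+x. ennreal (f x / a) \<partial>lborel) = 1"
proof -
  show int: "integrable lborel f" using assms(1,3) not_integrable_integral_eq by blast
  show nn: "AE x in lborel. f x / a \<ge> 0"
    using sgn
  proof
    assume *: "AE x in lborel. f x \<ge> 0"
    then have "a \<ge> 0" using integral_nonneg_AE[where M=lborel and f=f] assms(3) by simp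
    then show ?thesis using * by (auto simp: divide_nonneg_nonneg)
  next
    assume *: "AE x in lborel. f x \<le> 0"
    then have "a \<le> 0" using integral_nonneg_AE[where M=lborel and f="\<lambda>x. - f x"] assms(3) int by simp
    then show ?thesis using * by (auto simp: divide_nonpos_nonpos)
  qed
  have "(\<integral>\<^sup>+x. ennreal (f x / a) \<partial>lborel) = ennreal (LINT x|lborel. f x / a)"
    using nn int by (intro nn_integral_eq_integral) auto
  also have "\<dots> = 1" using assms by simp
  finally show "(\<integral>\<^sup>+x. ennreal (f x / a) \<partial>lborel) = 1" .
qed

text \<open>Since \<open>S\<close> preserves Lebesgue measure, \<open>(w' / a) dx\<close> is the push-forward of
  \<open>((w' \<circ> S) / a) dx\<close>.\<close>

lemma normalized_measure_transported:
  assumes tr: "AE x in lborel. w' (S x) = w x" and S: "distr lborel lborel S = lborel"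
    and [measurable]: "S \<in> borel_measurable lborel" "w \<in> borel_measurable lborel" "w' \<in> borel_measurable lborel"
  shows "normalized_measure a w' = distr (normalized_measure a w) borel S"
proof -
  have "normalized_measure a w' = density (distr lborel lborel S) (\<lambda>x. ennreal (w' x / a))"
    by (simp add: normalized_measure_def S)
  also have "\<dots> = distr (density lborel (\<lambda>x. ennreal (w' (S x) / a))) lborel S"
    by (rule density_distr) measurable
  also have "density lborel (\<lambda>x. ennreal (w' (S x) / a)) = density lborel (\<lambda>x. ennreal (w x / a))"
    by (rule density_cong) (measurable, use tr in eventually_elim, simp)
  finally show ?thesis unfolding normalized_measure_def by (simp cong: distr_cong)
qed

definition transported_clouds ::
  "nat \<Rightarrow> (nat \<Rightarrow> real) \<Rightarrow> real \<Rightarrow> real \<Rightarrow> real \<Rightarrow> real \<Rightarrow> (nat \<Rightarrow> real^2) \<Rightarrow> real \<Rightarrow> (nat \<Rightarrow> real \<Rightarrow> real^2 \<Rightarrow> real)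
   \<Rightarrow> (nat \<Rightarrow> (real^2) measure) \<Rightarrow> (real \<Rightarrow> real^2 \<Rightarrow> real^2) \<Rightarrow> bool" where
  "transported_clouds N a \<alpha> Cd \<delta> R Ybar \<epsilon> wi \<mu> X \<longleftrightarrow> lagrangian_clouds N a \<mu> X \<and>
     (\<forall>i\<in>{1..N}.
        (\<forall>t\<ge>0. diffuse_cloud (distr (\<mu> i) borel (X t)) (\<epsilon> powr \<alpha>) (Cd * \<epsilon>) \<and>
           normalized_measure (a i) (wi i t) = distr (\<mu> i) borel (X t)) \<and>
        (AE x in \<mu> i. norm (x - Ybar i) \<le> 2 * R + 2 * \<epsilon>) \<and>
        (\<integral>x. (norm (x - Ybar i))\<^sup>2 \<partial>\<mu> i) \<le> \<epsilon>\<^sup>2 \<and>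
        (\<forall>j\<in>{1..N}. i \<noteq> j \<longrightarrow> \<delta> - 4 * \<epsilon> \<le> norm (Ybar i - Ybar j)))"

text \<open>The field \<open>K * \<omega>(t)\<close> is the velocity induced by the laws of the particles, because \<open>\<omega>(t)\<close> is the
  push-forward of the initial vorticity under a flow that preserves Lebesgue measure. An \<open>L\<^sup>p\<close> bound
  \<open>\<Lambda>\<epsilon>\<^sup>-\<^sup>\<gamma>\<close> holds a fortiori with any smaller \<open>\<epsilon>'\<close> in place of \<open>\<epsilon>\<close>, which controls arbitrarily small
  scales.\<close>

lemma admissible_solution_clouds:
  fixes p \<gamma> \<Lambda> :: real and a :: "nat \<Rightarrow> real"
  assumes p: "2 < p" and g: "0 < \<gamma>" and La: "0 < \<Lambda>" and a: "\<And>i. i \<in> {1..N} \<Longrightarrow> a i \<noteq> 0"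
  obtains \<alpha> Cd where "\<alpha> > 0" "Cd > 0"
    "\<And>\<delta> R Ybar \<epsilon> w wi. \<delta> > 0 \<Longrightarrow> 0 < \<epsilon> \<Longrightarrow> \<epsilon> \<le> 1 \<Longrightarrow> admissible_solution N p \<gamma> \<Lambda> \<delta> R a Ybar \<epsilon> w wi \<Longrightarrow>
      \<exists>\<mu> X. transported_clouds N a \<alpha> Cd \<delta> R Ybar \<epsilon> wi \<mu> X"
proof -
  obtain a0 where a0: "a0 > 0" "\<And>i. i \<in> {1..N} \<Longrightarrow> a0 \<le> \<bar>a i\<bar>"
    by (rule finite_pos_lower_bound[of "{1..N}" "\<lambda>i. \<bar>a i\<bar>"]) (use a in auto)
  define M where "M = \<Lambda> / a0"
  have M: "M > 0" using La a0 by (simp add: M_def)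
  obtain \<alpha> Cd where al: "\<alpha> > 0" "Cd > 0"
    and diffuse: "\<And>\<epsilon> (f :: real^2 \<Rightarrow> real) (S :: real^2 \<Rightarrow> real^2). 0 < \<epsilon> \<Longrightarrow> \<epsilon> \<le> 1 \<Longrightarrow> f \<in> borel_measurable lborel \<Longrightarrow> AE x in lborel. f x \<ge> 0 \<Longrightarrow>
       (\<integral>\<^sup>+x. ennreal (f x) \<partial>lborel) = 1 \<Longrightarrow>
       (\<integral>\<^sup>+x. ennreal (f x powr p) \<partial>lborel) \<le> ennreal ((M * \<epsilon> powr - \<gamma>) powr p) \<Longrightarrow>
       S \<in> borel_measurable lborel \<Longrightarrow> distr lborel lborel S = lborel \<Longrightarrow>
       diffuse_cloud (distr (density lborel (\<lambda>x. ennreal (f x))) borel S) (\<epsilon> powr \<alpha>) (Cd * \<epsilon>)"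
    using transported_density_diffuse[OF p g M] by blast
  show thesis
  proof (rule that[OF al])
    fix \<delta> R Ybar \<epsilon> w wi
    assume delta: "\<delta> > 0" and e: "0 < \<epsilon>" "\<epsilon> \<le> 1" and adm: "admissible_solution N p \<gamma> \<Lambda> \<delta> R a Ybar \<epsilon> w wi"
    obtain wbar wibar X where
      wbar: "\<And>x. wbar x = (\<Sum>i\<in>{1..N}. wibar i x)"
      and Lp: "\<And>i. i \<in> {1..N} \<Longrightarrow> Lp p (wibar i)"
      and sgn: "\<And>i. i \<in> {1..N} \<Longrightarrow> (AE x in lborel. wibar i x \<ge> 0) \<or> (AE x in lborel. wibar i x \<le> 0)"
      and mass: "\<And>i. i \<in> {1..N} \<Longrightarrow> (LINT x|lborel. wibar i x) = a i"
      and dist: "\<And>i j. i \<in> {1..N} \<Longrightarrow> j \<in> {1..N} \<Longrightarrow> i \<noteq> j \<Longrightarrow> setdist (spt (wibar i)) (spt (wibar j)) \<ge> \<delta>"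
      and W2: "\<And>i. i \<in> {1..N} \<Longrightarrow> W2 (normalized_measure (a i) (wibar i)) (return borel (Ybar i)) \<le> ennreal \<epsilon>"
      and norm: "Lp_norm p wbar \<le> \<Lambda> * \<epsilon> powr (- \<gamma>)"
      and ball: "\<And>i. i \<in> {1..N} \<Longrightarrow> spt (wibar i) \<subseteq> ball (center (a i) (wibar i)) R"
      and w: "continuous_Lp p w" and w0: "AE x in lborel. w 0 x = wbar x"
      and wi: "\<And>i. i \<in> {1..N} \<Longrightarrow> continuous_Lp p (wi i)"
      and flow: "lagrangian_flow (\<lambda>t. biot_savart (w t)) X"
      and trw: "transported_by X wbar w" and tri: "\<And>i. i \<in> {1..N} \<Longrightarrow> transported_by X (wibar i) (wi i)"
      using adm unfolding admissible_solution_def admissible_data_def Let_def by (elim exE conjE) blast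
    have wm: "w t \<in> borel_measurable lborel" if "t \<ge> 0" for t
      using w that by (simp add: continuous_Lp_def Lp_def)
    have wim: "wi i t \<in> borel_measurable lborel" if "i \<in> {1..N}" "t \<ge> 0" for i t
      using wi that by (simp add: continuous_Lp_def Lp_def)
    have wibm: "wibar i \<in> borel_measurable lborel" if "i \<in> {1..N}" for i using Lp[OF that] by (simp add: Lp_def)
    have wbm [measurable]: "wbar \<in> borel_measurable lborel"
      unfolding wbar[abs_def] using wibm by (intro borel_measurable_sum) auto
    have Xm: "X t \<in> borel_measurable lborel" and Xd: "distr lborel lborel (X t) = lborel" if "t \<ge> 0" for t
      using flow that by (simp_all add: lagrangian_flow_def)
    define f where "f i x = wibar i x / a i" for i x
    define \<mu> where "\<mu> i = density lborel (\<lambda>x. ennreal (f i x))" for i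
    have mu: "\<mu> i = normalized_measure (a i) (wibar i)" for i by (simp add: \<mu>_def f_def normalized_measure_def)
    have fm: "f i \<in> borel_measurable lborel" if "i \<in> {1..N}" for i
      unfolding f_def[abs_def] using wibm[OF that] by measurable
    have f0: "AE x in lborel. f i x \<ge> 0" and f1: "(\<integral>\<^sup>+x. ennreal (f i x) \<partial>lborel) = 1" if i: "i \<in> {1..N}" for i
      using one_sign_normalized[OF a[OF i] wibm[OF i] mass[OF i] sgn[OF i]] unfolding f_def by auto
    have prob: "prob_space (\<mu> i)" if "i \<in> {1..N}" for i
      unfolding \<mu>_def by (rule prob_spaceI) (use fm[OF that] f1[OF that] in \<open>simp add: emeasure_density\<close>)
    have AE_mu: "AE x in \<mu> i. P x" if "AE x in lborel. f i x > 0 \<longrightarrow> P x" "i \<in> {1..N}" for P i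
      unfolding \<mu>_def using fm[OF that(2)] that(1) by (subst AE_density) (auto elim!: eventually_mono)
    have sets: "sets (\<mu> i) = sets borel" for i by (simp add: \<mu>_def)
    \<comment> \<open>The \<open>L\<^sup>p\<close> bound is given for the total vorticity only; it passes to the components because their supports
      are disjoint.\<close>
    have dom: "AE x in lborel. \<bar>wibar i x\<bar> \<le> \<bar>wbar x\<bar>" if i: "i \<in> {1..N}" for i
    proof -
      have "AE x in lborel. \<forall>j\<in>{1..N}. x \<notin> spt (wibar j) \<longrightarrow> wibar j x = 0"
        by (subst AE_ball_countable) (auto intro: AE_zero_outside_spt)
      then show ?thesis
      proof eventually_elim
        case (elim x)
        show ?case
        proof (cases "wibar i x = 0")
          case False
          then have xi: "x \<in> spt (wibar i)" using elim i by auto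
          have "wibar j x = 0" if j: "j \<in> {1..N} - {i}" for j
          proof -
            have "x \<notin> spt (wibar j)"
            proof
              assume "x \<in> spt (wibar j)"
              then have "setdist (spt (wibar i)) (spt (wibar j)) \<le> 0"
                using setdist_le_dist[OF xi, of x "spt (wibar j)"] by simp
              then show False using dist[OF i, of j] j delta by force
            qed
            then show ?thesis using elim j by auto
          qed
          then have "wbar x = wibar i x"
            unfolding wbar using i by (subst sum.remove[of _ i]) auto
          then show ?thesis by simp
        qed simp
      qed
    qed
    have Lpw: "(\<integral>\<^sup>+x. ennreal (\<bar>wbar x\<bar> powr p) \<partial>lborel) \<le> ennreal ((\<Lambda> * \<epsilon> powr (- \<gamma>)) powr p)"
    proof -
      have "integrable lborel (\<lambda>x. \<bar>w 0 x\<bar> powr p)" using w by (simp add: continuous_Lp_def Lp_def)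
      then have "integrable lborel (\<lambda>x. \<bar>wbar x\<bar> powr p)"
        by (rule Bochner_Integration.integrable_bound) (measurable, use w0 in eventually_elim, simp)
      then have "(\<integral>\<^sup>+x. ennreal (\<bar>wbar x\<bar> powr p) \<partial>lborel) = ennreal (LINT x|lborel. \<bar>wbar x\<bar> powr p)"
        by (intro nn_integral_eq_integral) auto
      also have "(LINT x|lborel. \<bar>wbar x\<bar> powr p) = Lp_norm p wbar powr p"
        using p by (simp add: Lp_norm_def powr_powr)
      also have "ennreal \<dots> \<le> ennreal ((\<Lambda> * \<epsilon> powr (- \<gamma>)) powr p)"
        using norm p by (intro ennreal_leI powr_mono2) (auto simp: Lp_norm_def)
      finally show ?thesis .
    qed
    have fp: "(\<integral>\<^sup>+x. ennreal (f i x powr p) \<partial>lborel) \<le> ennreal ((M * \<epsilon>' powr - \<gamma>) powr p)"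
      if i: "i \<in> {1..N}" and e': "0 < \<epsilon>'" "\<epsilon>' \<le> \<epsilon>" for i \<epsilon>'
    proof -
      have "(\<integral>\<^sup>+x. ennreal (f i x powr p) \<partial>lborel) \<le> (\<integral>\<^sup>+x. ennreal ((1 / a0) powr p) * ennreal (\<bar>wbar x\<bar> powr p) \<partial>lborel)"
      proof (rule nn_integral_mono_AE)
        show "AE x in lborel. ennreal (f i x powr p) \<le> ennreal ((1 / a0) powr p) * ennreal (\<bar>wbar x\<bar> powr p)"
          using dom[OF i] f0[OF i]
        proof eventually_elim
          case (elim x)
          have "f i x = \<bar>wibar i x\<bar> / \<bar>a i\<bar>" using elim(2) by (simp add: f_def flip: abs_divide)
          also have "\<dots> \<le> \<bar>wbar x\<bar> / a0" using elim(1) a0(1) a0(2)[OF i] by (intro frac_le) auto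
          finally have "f i x powr p \<le> (1 / a0 * \<bar>wbar x\<bar>) powr p" using elim(2) p by (intro powr_mono2) auto
          also have "\<dots> = (1 / a0) powr p * \<bar>wbar x\<bar> powr p" by (rule powr_mult)
          finally show ?case by (simp add: ennreal_mult'[symmetric] ennreal_leI)
        qed
      qed
      also have "\<dots> = ennreal ((1 / a0) powr p) * (\<integral>\<^sup>+x. ennreal (\<bar>wbar x\<bar> powr p) \<partial>lborel)"
        by (rule nn_integral_cmult) measurable
      also have "\<dots> \<le> ennreal ((1 / a0) powr p) * ennreal ((\<Lambda> * \<epsilon> powr (- \<gamma>)) powr p)"
        by (intro mult_left_mono Lpw) auto
      also have "\<dots> = ennreal ((1 / a0 * (\<Lambda> * \<epsilon> powr (- \<gamma>))) powr p)"
        using a0 La by (simp add: ennreal_mult'[symmetric] powr_mult powr_divide)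
      also have "\<dots> \<le> ennreal ((M * \<epsilon>' powr - \<gamma>) powr p)"
      proof (intro ennreal_leI powr_mono2)
        have "\<epsilon> powr - \<gamma> \<le> \<epsilon>' powr - \<gamma>" using e' g by (intro powr_mono2') auto
        then have "M * \<epsilon> powr - \<gamma> \<le> M * \<epsilon>' powr - \<gamma>" using M by (intro mult_left_mono) auto
        then show "1 / a0 * (\<Lambda> * \<epsilon> powr - \<gamma>) \<le> M * \<epsilon>' powr - \<gamma>" by (simp add: M_def)
      qed (use p a0 La in auto)
      finally show ?thesis .
    qed
    have diff: "diffuse_cloud (distr (\<mu> i) borel (X t)) (\<epsilon>' powr \<alpha>) (Cd * \<epsilon>')"
      if i: "i \<in> {1..N}" and t: "t \<ge> 0" and e': "0 < \<epsilon>'" "\<epsilon>' \<le> \<epsilon>" for i t \<epsilon>'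
      unfolding \<mu>_def by (rule diffuse) (use fm[OF i] f0[OF i] f1[OF i] fp[OF i e'] Xm[OF t] Xd[OF t] e e' in auto)
    have law: "normalized_measure (a i) (wi i t) = distr (\<mu> i) borel (X t)" if i: "i \<in> {1..N}" and t: "t \<ge> 0" for i t
      unfolding mu using tri[OF i] t wibm[OF i] wim[OF i t] Xm[OF t] Xd[OF t]
      by (intro normalized_measure_transported) (auto simp: transported_by_def)
    have bs: "biot_savart (w t) y = induced_velocity N a (\<lambda>j. distr (\<mu> j) borel (X t)) y" if t: "t \<ge> 0" for t y
    proof -
      note [measurable] = Xm[OF t] wm[OF t]
      have comp: "integrable lborel (\<lambda>x. wibar j x *\<^sub>R K (y - X t x))"
        "(\<integral>x. wibar j x *\<^sub>R K (y - X t x) \<partial>lborel) = a j *\<^sub>R (\<integral>z. K (y - z) \<partial>distr (\<mu> j) borel (X t))"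
        if j: "j \<in> {1..N}" for j
      proof -
        note [measurable] = fm[OF j]
        have eq: "wibar j x *\<^sub>R K (y - X t x) = a j *\<^sub>R (f j x *\<^sub>R K (y - X t x))" for x
          using a[OF j] by (simp add: f_def)
        have XM [measurable]: "X t \<in> \<mu> j \<rightarrow>\<^sub>M borel" by (simp add: \<mu>_def)
        have "integrable (distr (\<mu> j) borel (X t)) (\<lambda>z. K (y - z))"
          using diff[OF j t e(1) order.refl] by (rule diffuse_cloud.integrable_K)
        then have "integrable (\<mu> j) (\<lambda>x. K (y - X t x))" by (subst (asm) integrable_distr_eq) auto
        then have int: "integrable lborel (\<lambda>x. f j x *\<^sub>R K (y - X t x))"
          unfolding \<mu>_def by (subst (asm) integrable_density) (use f0[OF j] in auto)
        show "integrable lborel (\<lambda>x. wibar j x *\<^sub>R K (y - X t x))" unfolding eq using int by (rule integrable_scaleR_right)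
        have "(\<integral>z. K (y - z) \<partial>distr (\<mu> j) borel (X t)) = (\<integral>x. K (y - X t x) \<partial>\<mu> j)"
          by (subst integral_distr) auto
        also have "\<dots> = (\<integral>x. f j x *\<^sub>R K (y - X t x) \<partial>lborel)"
          unfolding \<mu>_def by (subst integral_density) (use f0[OF j] in auto)
        finally show "(\<integral>x. wibar j x *\<^sub>R K (y - X t x) \<partial>lborel) = a j *\<^sub>R (\<integral>z. K (y - z) \<partial>distr (\<mu> j) borel (X t))"
          unfolding eq by (simp only: integral_scaleR_right)
      qed
      have "biot_savart (w t) y = (\<integral>z. w t z *\<^sub>R K (y - z) \<partial>distr lborel lborel (X t))"
        unfolding biot_savart_def Xd[OF t] ..
      also have "\<dots> = (\<integral>x. w t (X t x) *\<^sub>R K (y - X t x) \<partial>lborel)" by (rule integral_distr) measurable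
      also have "\<dots> = (\<integral>x. wbar x *\<^sub>R K (y - X t x) \<partial>lborel)"
      proof (rule integral_cong_AE)
        have "AE x in lborel. w t (X t x) = wbar x" using trw t by (simp add: transported_by_def)
        then show "AE x in lborel. w t (X t x) *\<^sub>R K (y - X t x) = wbar x *\<^sub>R K (y - X t x)" by eventually_elim simp
      qed measurable
      also have "\<dots> = (\<Sum>j\<in>{1..N}. \<integral>x. wibar j x *\<^sub>R K (y - X t x) \<partial>lborel)"
        unfolding wbar scaleR_sum_left by (rule Bochner_Integration.integral_sum) (rule comp)
      finally show ?thesis unfolding induced_velocity_def using comp by simp
    qed
    have loc: "lagrangian_clouds N a \<mu> X"
    proof (rule lagrangian_clouds.intro)
      show "prob_space (\<mu> i)" "sets (\<mu> i) = sets borel" if "i \<in> {1..N}" for i using prob that sets by auto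
      show "X t \<in> borel_measurable borel" if "t \<ge> 0" for t using Xm[OF that] by simp
      show "\<exists>\<eta>. \<forall>i\<in>{1..N}. \<forall>t\<ge>0. diffuse_cloud (distr (\<mu> i) borel (X t)) \<eta> \<kappa>" if k: "\<kappa> > 0" for \<kappa>
      proof (intro exI ballI allI impI)
        fix i t assume it: "i \<in> {1..N}" "(t :: real) \<ge> 0"
        have "Cd * min \<epsilon> (\<kappa> / Cd) \<le> Cd * (\<kappa> / Cd)" using al by (intro mult_left_mono) auto
        then have "Cd * min \<epsilon> (\<kappa> / Cd) \<le> \<kappa>" using al by simp
        then show "diffuse_cloud (distr (\<mu> i) borel (X t)) (min \<epsilon> (\<kappa> / Cd) powr \<alpha>) \<kappa>"
          using e k al by (intro diffuse_cloud_mono[OF diff[OF it]]) auto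
      qed
      fix i assume i: "i \<in> {1..N}"
      let ?v = "\<lambda>x s. induced_velocity N a (\<lambda>j. distr (\<mu> j) borel (X s)) (X s x)"
      let ?u = "\<lambda>x s. biot_savart (w s) (X s x)"
      have "AE x in lborel. \<forall>t\<ge>0. (?u x) absolutely_integrable_on {0..t} \<and>
          X t x = x + integral {0..t} (?u x)"
        using flow unfolding lagrangian_flow_def by blast
      then have "AE x in lborel. \<forall>t\<ge>0. (?v x) absolutely_integrable_on {0..t} \<and>
          X t x = x + integral {0..t} (?v x)"
      proof eventually_elim
        case (elim x)
        show ?case
        proof (intro allI impI)
          fix t :: real assume t: "t \<ge> 0"
          have eq: "biot_savart (w s) (X s x) = induced_velocity N a (\<lambda>j. distr (\<mu> j) borel (X s)) (X s x)"
            if "s \<in> {0..t}" for s using bs that by simp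
          have 1: "(?u x) absolutely_integrable_on {0..t} \<longleftrightarrow>
              (?v x) absolutely_integrable_on {0..t}"
            by (rule set_integrable_cong) (use eq in auto)
          have 2: "integral {0..t} (?u x) = integral {0..t} (?v x)"
            by (rule Henstock_Kurzweil_Integration.integral_cong) (use eq in auto)
          show "(?v x) absolutely_integrable_on {0..t} \<and>
              X t x = x + integral {0..t} (?v x)"
            using elim[rule_format, OF t] unfolding 1 2 .
        qed
      qed
      then show "AE x in \<mu> i. \<forall>t\<ge>0. (?v x) absolutely_integrable_on {0..t} \<and>
          X t x = x + integral {0..t} (?v x)"
        by (intro AE_mu i) (auto elim!: eventually_mono)
    qed
    have moment: "integrable (\<mu> i) (\<lambda>x. (norm (x - Ybar i))\<^sup>2)" "(\<integral>x. (norm (x - Ybar i))\<^sup>2 \<partial>\<mu> i) \<le> \<epsilon>\<^sup>2" if i: "i \<in> {1..N}" for i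
      using W2[OF i] second_moment_le_iff[OF prob[OF i] sets, of \<epsilon> "Ybar i"] e unfolding mu by auto
    have in_spt: "AE x in \<mu> i. x \<in> spt (wibar i)" if i: "i \<in> {1..N}" for i
      using AE_zero_outside_spt[of "wibar i"] by (intro AE_mu i) (auto elim!: eventually_mono simp: f_def)
    have near: "\<exists>x. x \<in> spt (wibar i) \<and> norm (x - Ybar i) \<le> 2 * \<epsilon>" if i: "i \<in> {1..N}" for i
      by (rule exists_near_center[OF prob[OF i] e(1) moment[OF i] in_spt[OF i]])
    have start: "AE x in \<mu> i. norm (x - Ybar i) \<le> 2 * R + 2 * \<epsilon>" if i: "i \<in> {1..N}" for i
    proof -
      obtain x0 where x0: "x0 \<in> spt (wibar i)" "norm (x0 - Ybar i) \<le> 2 * \<epsilon>" using near[OF i] by blast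
      define c where "c = center (a i) (wibar i)"
      show ?thesis
        using in_spt[OF i]
      proof eventually_elim
        case (elim x)
        have "dist c x < R" "dist c x0 < R" using elim x0 ball[OF i] by (auto simp: c_def)
        then have "dist x x0 \<le> 2 * R" using dist_triangle3[of x x0 c] by simp
        then show ?case using norm_triangle_ineq[of "x - x0" "x0 - Ybar i"] x0 by (simp add: dist_norm)
      qed
    qed
    have sep: "\<delta> - 4 * \<epsilon> \<le> norm (Ybar i - Ybar j)" if i: "i \<in> {1..N}" and j: "j \<in> {1..N}" and ij: "i \<noteq> j" for i j
    proof -
      obtain x where x: "x \<in> spt (wibar i)" "norm (x - Ybar i) \<le> 2 * \<epsilon>" using near[OF i] by blast
      obtain y where y: "y \<in> spt (wibar j)" "norm (y - Ybar j) \<le> 2 * \<epsilon>" using near[OF j] by blast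
      have "\<delta> \<le> norm (x - y)" using dist[OF i j ij] setdist_le_dist[OF x(1) y(1)] by (simp add: dist_norm)
      also have "\<dots> \<le> norm (x - Ybar i) + norm (Ybar i - Ybar j) + norm (y - Ybar j)"
        using norm_diff_detour[of x y "Ybar i" "Ybar j"] by (simp add: norm_minus_commute)
      finally show ?thesis using x y by linarith
    qed
    have "transported_clouds N a \<alpha> Cd \<delta> R Ybar \<epsilon> wi \<mu> X"
      unfolding transported_clouds_def
      using loc diff[OF _ _ e(1) order.refl] law start moment(2) sep by simp
    then show "\<exists>\<mu> X. transported_clouds N a \<alpha> Cd \<delta> R Ybar \<epsilon> wi \<mu> X" by blast
  qed
qed

section \<open>Convergence to the point vortex system\<close>

theorem theorem1:
  shows "\<exists>c0::real. 0 < c0 \<and> c0 < 1 \<and>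
    (\<forall>(N::nat) (p::real) (\<gamma>::real) (\<Lambda>::real) (\<delta>::real) (R::real)
        (a :: nat \<Rightarrow> real) (Ybar :: nat \<Rightarrow> real^2).
      2 < p \<and> 0 < \<gamma> \<and> 0 < \<Lambda> \<and> 0 < R \<and> R < \<delta> \<and>
      (\<forall>i\<in>{1..N}. a i \<noteq> 0) \<and> inj_on Ybar {1..N} \<and> R \<le> c0 * \<delta> \<longrightarrow>
      (\<exists>(\<epsilon>0::real) (T::real) (C::real). 0 < \<epsilon>0 \<and> \<epsilon>0 \<le> 1 \<and> 0 < T \<and> 0 < C \<and>
        (\<exists>Y. point_vortex_solution N a Ybar T Y) \<and>
        (\<forall>Y. point_vortex_solution N a Ybar T Y \<longrightarrow>
          (\<forall>\<epsilon> w wi. 0 < \<epsilon> \<and> \<epsilon> \<le> \<epsilon>0 \<and> admissible_solution N p \<gamma> \<Lambda> \<delta> R a Ybar \<epsilon> w wi \<longrightarrow>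
            (\<forall>i\<in>{1..N}. \<forall>t\<in>{0..T}.
              W2 (normalized_measure (a i) (wi i t)) (return borel (Y i t))
                \<le> ennreal (C * exp (C * t) * \<epsilon>))))))"
proof (rule exI[of _ "1 / 100"], intro conjI allI impI)
  fix N :: nat and p \<gamma> \<Lambda> \<delta> R :: real and a :: "nat \<Rightarrow> real" and Ybar :: "nat \<Rightarrow> real^2"
  assume "2 < p \<and> 0 < \<gamma> \<and> 0 < \<Lambda> \<and> 0 < R \<and> R < \<delta> \<and>
      (\<forall>i\<in>{1..N}. a i \<noteq> 0) \<and> inj_on Ybar {1..N} \<and> R \<le> 1 / 100 * \<delta>"
  then have p: "2 < p" and g: "0 < \<gamma>" and La: "0 < \<Lambda>" and R: "R \<le> \<delta> / 100" and delta: "\<delta> > 0"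
    and a: "\<And>i. i \<in> {1..N} \<Longrightarrow> a i \<noteq> 0" and inj: "inj_on Ybar {1..N}" by auto
  \<comment> \<open>The initial vortices are nearly \<open>\<delta>\<close> apart and move by at most \<open>\<delta>/16\<close>, so they keep the distance
    \<open>\<delta>/2 = 4b\<close>; the clouds start within \<open>2R + 2\<epsilon> \<le> \<delta>/25 < b/2\<close> of their vortices.\<close>
  define b where "b = \<delta> / 8"
  have b: "b > 0" using delta by (simp add: b_def)
  obtain T0 where T0: "T0 > 0"
    and ex: "\<And>T. 0 \<le> T \<Longrightarrow> T \<le> T0 \<Longrightarrow> \<exists>Y. point_vortex_solution N a Ybar T Y"
    and close: "\<And>T Y i t. T \<le> T0 \<Longrightarrow> point_vortex_solution N a Ybar T Y \<Longrightarrow> i \<in> {1..N} \<Longrightarrow> t \<in> {0..T} \<Longrightarrow>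
       norm (Y i t - Ybar i) \<le> \<delta> / 16"
    by (rule point_vortices_short_time[OF inj, of "\<delta> / 16" a]) (use delta in auto)
  obtain \<alpha> Cd where al: "\<alpha> > 0" "Cd > 0"
    and clouds: "\<And>\<delta> R Ybar \<epsilon> w wi. \<delta> > 0 \<Longrightarrow> 0 < \<epsilon> \<Longrightarrow> \<epsilon> \<le> 1 \<Longrightarrow> admissible_solution N p \<gamma> \<Lambda> \<delta> R a Ybar \<epsilon> w wi \<Longrightarrow>
      \<exists>\<mu> X. transported_clouds N a \<alpha> Cd \<delta> R Ybar \<epsilon> wi \<mu> X"
    by (rule admissible_solution_clouds[OF p g La a]) blast+
  obtain T1 \<epsilon>1 C where T1: "T1 > 0" and e1: "0 < \<epsilon>1" "\<epsilon>1 \<le> 1" and C: "C > 0"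
    and conc: "\<And>\<mu> X Ybar Y T R0 \<epsilon> i t. concentrating_clouds N a \<mu> X Ybar Y T b R0 \<epsilon> \<alpha> Cd \<Longrightarrow> T \<le> T1 \<Longrightarrow> \<epsilon> \<le> \<epsilon>1 \<Longrightarrow>
      i \<in> {1..N} \<Longrightarrow> t \<in> {0..T} \<Longrightarrow>
      W2 (distr (\<mu> i) borel (X t)) (return borel (Y i t)) \<le> ennreal (C * \<epsilon>)"
    using concentration[OF b al, of N a] by metis
  define T where "T = min T0 T1"
  define \<epsilon>0 where "\<epsilon>0 = min \<epsilon>1 (\<delta> / 100)"
  have T: "T > 0" using T0 T1 by (simp add: T_def)
  show "\<exists>(\<epsilon>0::real) (T::real) (C::real). 0 < \<epsilon>0 \<and> \<epsilon>0 \<le> 1 \<and> 0 < T \<and> 0 < C \<and>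
        (\<exists>Y. point_vortex_solution N a Ybar T Y) \<and>
        (\<forall>Y. point_vortex_solution N a Ybar T Y \<longrightarrow>
          (\<forall>\<epsilon> w wi. 0 < \<epsilon> \<and> \<epsilon> \<le> \<epsilon>0 \<and> admissible_solution N p \<gamma> \<Lambda> \<delta> R a Ybar \<epsilon> w wi \<longrightarrow>
            (\<forall>i\<in>{1..N}. \<forall>t\<in>{0..T}.
              W2 (normalized_measure (a i) (wi i t)) (return borel (Y i t))
                \<le> ennreal (C * exp (C * t) * \<epsilon>))))"
  proof (rule exI[of _ \<epsilon>0], rule exI[of _ T], rule exI[of _ C], intro conjI allI impI ballI)
    show "0 < \<epsilon>0" "\<epsilon>0 \<le> 1" using e1 delta by (auto simp: \<epsilon>0_def)
    show "0 < T" "0 < C" by fact+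
    show "\<exists>Y. point_vortex_solution N a Ybar T Y" using ex T by (simp add: T_def)
  next
    fix Y \<epsilon> w wi i t
    assume sol: "point_vortex_solution N a Ybar T Y"
      and "0 < \<epsilon> \<and> \<epsilon> \<le> \<epsilon>0 \<and> admissible_solution N p \<gamma> \<Lambda> \<delta> R a Ybar \<epsilon> w wi"
      and i: "i \<in> {1..N}" and t: "t \<in> {0..T}"
    then have e: "0 < \<epsilon>" "\<epsilon> \<le> \<epsilon>1" "\<epsilon> \<le> 1" "\<epsilon> \<le> \<delta> / 100"
      and adm: "admissible_solution N p \<gamma> \<Lambda> \<delta> R a Ybar \<epsilon> w wi" using e1 by (auto simp: \<epsilon>0_def)
    obtain \<mu> X where "transported_clouds N a \<alpha> Cd \<delta> R Ybar \<epsilon> wi \<mu> X"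
      using clouds[OF delta e(1,3) adm] by blast
    note tc = this[unfolded transported_clouds_def]
    have lag: "lagrangian_clouds N a \<mu> X" using tc by blast
    have diff: "diffuse_cloud (distr (\<mu> i) borel (X t)) (\<epsilon> powr \<alpha>) (Cd * \<epsilon>)"
      and law: "normalized_measure (a i) (wi i t) = distr (\<mu> i) borel (X t)"
      and start: "AE x in \<mu> i. norm (x - Ybar i) \<le> 2 * R + 2 * \<epsilon>"
      and moment: "(\<integral>x. (norm (x - Ybar i))\<^sup>2 \<partial>\<mu> i) \<le> \<epsilon>\<^sup>2"
      and sep: "j \<in> {1..N} \<Longrightarrow> i \<noteq> j \<Longrightarrow> \<delta> - 4 * \<epsilon> \<le> norm (Ybar i - Ybar j)"
      if "i \<in> {1..N}" "t \<ge> 0" for i j t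
      using tc that by simp_all
    have loc: "clouds_near_vortices N a \<mu> X Ybar Y T b (2 * R + 2 * \<epsilon>)"
    proof (rule clouds_near_vortices.intro[OF lag], rule clouds_near_vortices_axioms.intro)
      show "point_vortex_solution N a Ybar T Y" "0 \<le> T" "0 < b" using sol T b by auto
      show "AE x in \<mu> i. norm (x - Ybar i) \<le> 2 * R + 2 * \<epsilon>" if "i \<in> {1..N}" for i by (rule start[OF that order.refl])
      fix t i j assume ij: "t \<in> {0..T}" "i \<in> {1..N}" "j \<in> {1..N}" "i \<noteq> j"
      have "norm (Ybar i - Ybar j) \<le> norm (Y i t - Ybar i) + norm (Y i t - Y j t) + norm (Y j t - Ybar j)"
        by (rule norm_diff_detour)
      moreover have "norm (Y i t - Ybar i) \<le> \<delta> / 16" "norm (Y j t - Ybar j) \<le> \<delta> / 16"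
        using close[OF _ sol _ ij(1)] ij by (auto simp: T_def)
      ultimately show "4 * b \<le> norm (Y i t - Y j t)" using sep[OF ij(2) order.refl ij(3,4)] e delta unfolding b_def by linarith
    qed
    have R0: "2 * R + 2 * \<epsilon> \<le> b / 2" using R e delta unfolding b_def by linarith
    have "concentrating_clouds N a \<mu> X Ybar Y T b (2 * R + 2 * \<epsilon>) \<epsilon> \<alpha> Cd"
      by (rule concentrating_clouds.intro[OF loc], rule concentrating_clouds_axioms.intro)
        (use e R0 diff moment[OF _ order.refl] in auto)
    then have "W2 (distr (\<mu> i) borel (X t)) (return borel (Y i t)) \<le> ennreal (C * \<epsilon>)"
      by (rule conc[OF _ _ e(2) i t]) (simp add: T_def)
    also have "ennreal (C * \<epsilon>) \<le> ennreal (C * exp (C * t) * \<epsilon>)"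
    proof (rule ennreal_leI)
      have "C * \<epsilon> * 1 \<le> C * \<epsilon> * exp (C * t)" using C e t by (intro mult_left_mono) auto
      then show "C * \<epsilon> \<le> C * exp (C * t) * \<epsilon>" by (simp add: mult_ac)
    qed
    finally show "W2 (normalized_measure (a i) (wi i t)) (return borel (Y i t)) \<le> ennreal (C * exp (C * t) * \<epsilon>)"
      using law[OF i, of t] t by simp
  qed
qed auto

end
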